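(* Let $\phi=\{\phi_t,t\ge 0\}$ be a $\varphi$-irreducible and aperiodic Markov chain on $\mathsf{X}$, and let $\{\mathcal{T}_z: z\in\mathbb{N}\}$ be an increasing sequence of stopping times with $\mathcal{T}_0=0$. Suppose that there are functions $V:\mathsf{X}\to(0,\infty)$, $\delta:\mathsf{X}\to[1,\infty)$, $f:\mathsf{X}\to[1,\infty)$, a small set $C$, and a constant $b\in\mathbb{R}$ such that for every $z\ge 0$ $$\mathsf{E}[V(\phi_{\mathcal{T}_{z+1}})\mid\mathcal{F}_{\mathcal{T}_z}]\le V(\phi_{\mathcal{T}_z})-\delta(\phi_{\mathcal{T}_z})+b\,1_{\{\phi_{\mathcal{T}_z}\in C\}},$$ $$\mathsf{E}\Bigl[\sum_{k=\mathcal{T}_z}^{\mathcal{T}_{z+1}-1}f(\phi_k)\,\Big|\,\mathcal{F}_{\mathcal{T}_z}\Bigr]\le\delta(\phi_{\mathcal{T}_z}).$$ Then the following hold: (i) $\phi$ is positive Harris recurrent, with unique invariant distribution $\pi$. (ii) $\pi(f):=\int f(\phi)\,\pi(d\phi)<\infty$. (iii) For any function $g$ that is bounded by $f$, in the sense that $\sup_{\phi}|g(\phi)|/f(\phi)<\infty$, and for every initial condition $\phi\in\mathsf{X}$, $$\lim_{t\to\infty}\mathsf{E}_\phi[g(\phi_t)]=\pi(g),\qquad \lim_{N\to\infty}\frac1N\sum_{t=0}^{N-1}g(\phi_t)=\pi(g)\quad\text{a.s.}$$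
   Context: $\mathsf{X}$ is a complete separable metric space that is locally compact, with Borel $\sigma$-field $\mathcal{B}(\mathsf{X})$; all functions are measurable. $\phi=\{\phi_t,t\ge0\}$ is a (time-homogeneous) Markov chain on $\mathsf{X}$ with transition probability $P$, $n$-step transitions $P^n$; $\mathsf{P}_\phi,\mathsf{E}_\phi$ denote probability and expectation when the chain starts at $\phi\in\mathsf{X}$. $\mathcal{F}_{\mathcal{T}}$ is the $\sigma$-field of events up to the stopping time $\mathcal{T}$; "increasing" means $\mathcal{T}_{z+1}>\mathcal{T}_z$. The inequalities involving conditional expectations are understood almost surely, for the chain started from any initial condition. For $A\in\mathcal{B}(\mathsf{X})$, $\tau_A:=\min(t\ge1:\phi_t\in A)$. For a sigma-finite measure $\varphi$ on $\mathcal{B}(\mathsf{X})$: the chain is $\varphi$-irreducible if $\mathsf{P}_\phi\{\tau_B<\infty\}>0$ for any $\phi\in\mathsf{X}$ and any $B\in\mathcal{B}(\mathsf{X})$ with $\varphi(B)>0$. A $\varphi$-irreducible chain is aperiodic if for any $\phi\in\mathsf{X}$ and any $B$ with $\varphi(B)>0$ there is $n_0=n_0(\phi,B)$ with $P^n(\phi,B)>0$ for all $n\ge n_0$. It is Harris recurrent if $\mathsf{P}_\phi(\tau_B<\infty)=1$ for any $\phi\in\mathsf{X}$ and any $B$ with $\varphi(B)>0$, and positive Harris recurrent if in addition there is an invariant probability measure $\pi$, i.e. $\int\pi(d\phi)P(\phi,A)=\pi(A)$ for all $A\in\mathcal{B}(\mathsf{X})$. A set $A\in\mathcal{B}(\mathsf{X})$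 is small if there are an integer $n_0\ge1$ and a positive measure $\mu$ with $\mu(\mathsf{X})>0$ such that $P^{n_0}(x,B)\ge\mu(B)$ for all $x\in A$, $B\in\mathcal{B}(\mathsf{X})$. *)

theory Defs
  imports "HOL-Probability.Probability"
begin

text \<open>
  A time-homogeneous Markov chain given by one process \<open>X\<close> and one probability measure \<open>Pr x\<close>
  for each initial condition \<open>x\<close>, all on the same measurable space.  The filtration is indexed by
  \<open>enat\<close> so that the library's stopping times may take the value \<open>\<infinity>\<close>; the \<open>F (enat t)\<close> form the
  actual filtration and \<open>F \<infinity>\<close> is the ambient sigma-algebra.
\<close>

locale markov_chain = filtration "space (F \<infinity>)" F
  for F :: "enat \<Rightarrow> 'w measure" +
  fixes P :: "'a::polish_space \<Rightarrow> 'a measure"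
    and Pr :: "'a \<Rightarrow> 'w measure"
    and X :: "nat \<Rightarrow> 'w \<Rightarrow> 'a"
  assumes kernel: "P \<in> borel \<rightarrow>\<^sub>M prob_algebra borel"
    and prob_Pr: "prob_space (Pr x)"
    and sets_Pr: "sets (Pr x) = sets (F \<infinity>)"
    and adapted: "X t \<in> F (enat t) \<rightarrow>\<^sub>M borel"
    and initial: "AE \<omega> in Pr x. X 0 \<omega> = x"
    and markov: "B \<in> sets borel \<Longrightarrow>
      AE \<omega> in Pr x. real_cond_exp (Pr x) (F (enat t)) (\<lambda>\<omega>'. indicator B (X (Suc t) \<omega>')) \<omega>
        = measure (P (X t \<omega>)) B"

primrec nstep :: "('a::topological_space \<Rightarrow> 'a measure) \<Rightarrow> nat \<Rightarrow> 'a \<Rightarrow> 'a measure" where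
  "nstep P 0 x = return borel x"
| "nstep P (Suc n) x = nstep P n x \<bind> P"

definition return_time :: "(nat \<Rightarrow> 'w \<Rightarrow> 'a) \<Rightarrow> 'a set \<Rightarrow> 'w \<Rightarrow> enat" where
  "return_time X A \<omega> = Inf {enat t | t. 1 \<le> t \<and> X t \<omega> \<in> A}"

text \<open>The value of the process at a random time; only meaningful where the time is finite.\<close>

definition at_time :: "(nat \<Rightarrow> 'w \<Rightarrow> 'a) \<Rightarrow> ('w \<Rightarrow> enat) \<Rightarrow> 'w \<Rightarrow> 'a" where
  "at_time X T \<omega> = X (the_enat (T \<omega>)) \<omega>"

definition irreducible_chain ::
  "('a::topological_space \<Rightarrow> 'w measure) \<Rightarrow> (nat \<Rightarrow> 'w \<Rightarrow> 'a) \<Rightarrow> 'a measure \<Rightarrow> bool" where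
  "irreducible_chain Pr X \<phi> \<longleftrightarrow>
    (\<forall>x. \<forall>B\<in>sets borel. emeasure \<phi> B > 0 \<longrightarrow>
      measure (Pr x) {\<omega>\<in>space (Pr x). return_time X B \<omega> < \<infinity>} > 0)"

definition aperiodic_chain ::
  "('a::topological_space \<Rightarrow> 'a measure) \<Rightarrow> 'a measure \<Rightarrow> bool" where
  "aperiodic_chain P \<phi> \<longleftrightarrow>
    (\<forall>x. \<forall>B\<in>sets borel. emeasure \<phi> B > 0 \<longrightarrow>
      (\<exists>n0. \<forall>n\<ge>n0. measure (nstep P n x) B > 0))"

definition harris_recurrent ::
  "('a::topological_space \<Rightarrow> 'w measure) \<Rightarrow> (nat \<Rightarrow> 'w \<Rightarrow> 'a) \<Rightarrow> 'a measure \<Rightarrow> bool" where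
  "harris_recurrent Pr X \<phi> \<longleftrightarrow>
    (\<forall>x. \<forall>B\<in>sets borel. emeasure \<phi> B > 0 \<longrightarrow>
      measure (Pr x) {\<omega>\<in>space (Pr x). return_time X B \<omega> < \<infinity>} = 1)"

definition invariant_prob ::
  "('a::topological_space \<Rightarrow> 'a measure) \<Rightarrow> 'a measure \<Rightarrow> bool" where
  "invariant_prob P \<pi> \<longleftrightarrow>
    prob_space \<pi> \<and> sets \<pi> = sets borel \<and>
    (\<forall>A\<in>sets borel. (\<integral>\<^sup>+ x. emeasure (P x) A \<partial>\<pi>) = emeasure \<pi> A)"

definition positive_harris_recurrent ::
  "('a::topological_space \<Rightarrow> 'a measure) \<Rightarrow> ('a \<Rightarrow> 'w measure) \<Rightarrow> (nat \<Rightarrow> 'w \<Rightarrow> 'a) \<Rightarrow> 'a measure \<Rightarrow> bool"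
where
  "positive_harris_recurrent P Pr X \<phi> \<longleftrightarrow>
    harris_recurrent Pr X \<phi> \<and> (\<exists>\<pi>. invariant_prob P \<pi>)"

definition small_set :: "('a::topological_space \<Rightarrow> 'a measure) \<Rightarrow> 'a set \<Rightarrow> bool" where
  "small_set P A \<longleftrightarrow> A \<in> sets borel \<and>
    (\<exists>n0\<ge>1. \<exists>\<mu>. sets \<mu> = sets borel \<and> emeasure \<mu> UNIV > 0 \<and>
      (\<forall>x\<in>A. \<forall>B\<in>sets borel. emeasure \<mu> B \<le> emeasure (nstep P n0 x) B))"

end

theory Submission
  imports Defs
begin

text \<open>
  For a set \<open>D\<close>, summing the drift inequalities over the times \<open>T z\<close> before the first entrance to \<open>D\<close>
  bounds the expected sum of \<open>f\<close> until this entrance by \<open>V\<close> plus \<open>\<bar>b\<bar>\<close> times the expected number of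
  visits to \<open>C\<close>, and the latter is bounded if \<open>D\<close> is reached from \<open>C\<close> with probability bounded below.
  Choosing for \<open>D\<close> a suitable small set \<open>B\<close> turns the random-time drift into a one-step drift
  \<open>P W \<le> W - f + c 1\<^sub>B\<close>.

  If \<open>P\<^sup>N \<ge> 1\<^sub>B \<otimes> \<mu>\<close>, put \<open>K = P\<^sup>N\<close> and \<open>Q = K - 1\<^sub>B \<otimes> \<mu>\<close>. Decomposing \<open>K\<^sup>t g\<close> at the first and at the last
  regeneration reduces its convergence to the elementary renewal theorem for \<open>\<mu> K\<^sup>t 1\<^sub>B\<close> and to the
  summability of \<open>\<mu> Q\<^sup>i g\<close>, which the drift provides for all \<open>g \<le> f\<close>; the limit is proportional to
  \<open>\<Sum>i. \<mu> Q\<^sup>i g\<close>. No splitting or coupling of the chain is needed.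

  The law of large numbers holds for coboundaries \<open>u - P u\<close> with \<open>u\<close> bounded by an exponential
  martingale bound. Since \<open>P\<^sup>n g\<close> converges to \<open>\<pi>(g)\<close>, these and the constants are dense in \<open>L\<^sup>1(\<pi>)\<close>, and
  the maximal ergodic inequality controls the remainder. Harris recurrence follows by applying the law of
  large numbers to indicators.
\<close>

section \<open>The renewal theorem\<close>

text \<open>The process sampled at the times \<open>T z\<close> need not be a Markov chain, so no
  drift criterion applies to it directly. The way out is that the event of not having entered
  \<open>D\<close> by time \<open>T z\<close> belongs to \<open>pre_sigma (T z)\<close>: the
  conditional inequalities can be integrated over it, and after summation over \<open>z\<close> only
  taboo kernels of \<open>P\<close> remain. The function \<open>W\<close> of the one-step drift is
  the taboo potential of \<open>f\<close>, set to 0 on the regeneration set. Since it is a potential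
  of \<open>f\<close> itself and not of 1, the convergence reaches all functions of the order of
  \<open>f\<close>.

  The hypotheses meet the renewal theorem in two places. Aperiodicity makes the renewal sequence
  eventually positive, which stands in for an arithmetic condition on the increments. The drift with
  \<open>f \<ge> 1\<close> gives the increments a finite mean, so that the limit can be computed
  from the renewal identity. The skeleton \<open>P^N\<close> enters because the minorization takes
  \<open>N\<close> steps; this is why sums of \<open>f\<close> over one period appear.\<close>

lemma filterlim_minus_const_nat:
  assumes "filterlim s at_top F"
  shows "filterlim (\<lambda>k. s k - (j::nat)) at_top F"
  unfolding filterlim_at_top
proof
  fix Z :: nat
  show "\<forall>\<^sub>F k in F. Z \<le> s k - j"
    using assms[unfolded filterlim_at_top, rule_format, of "Z + j"] by eventually_elim simp
qed

text \<open>Dominated convergence for sums. The family is doubly indexed because the renewal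
  argument takes \<open>v j k = y (s k - j)\<close> along a chosen sequence \<open>s\<close>, where
  a limit is known for each \<open>j\<close> separately.\<close>

lemma convolution_tendsto:
  fixes w :: "nat \<Rightarrow> real" and v :: "nat \<Rightarrow> nat \<Rightarrow> real"
  assumes w: "summable (\<lambda>n. \<bar>w n\<bar>)" and v: "\<And>j. (\<lambda>k. v j k) \<longlonglongrightarrow> l"
    and K: "\<And>j k. \<bar>v j k\<bar> \<le> K" and s: "filterlim s at_top sequentially"
  shows "(\<lambda>k. \<Sum>j\<le>s k. w j * v j k) \<longlonglongrightarrow> l * (\<Sum>j. w j)"
proof -
  let ?a = "\<lambda>j k. if j \<le> s k then w j * v j k else 0"
  have "(\<lambda>k. \<Sum>j. ?a j k) \<longlonglongrightarrow> (\<Sum>j. w j * l)"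
  proof (rule tannerys_theorem[THEN conjunct2, THEN conjunct2])
    show "(\<lambda>k. ?a j k) \<longlonglongrightarrow> w j * l" for j
    proof (rule Lim_transform_eventually)
      show "(\<lambda>k. w j * v j k) \<longlonglongrightarrow> w j * l"
        by (intro tendsto_intros v)
      show "\<forall>\<^sub>F k in sequentially. w j * v j k = ?a j k"
        using s[unfolded filterlim_at_top, rule_format, of j] by eventually_elim simp
    qed
    show "\<forall>\<^sub>F (j, k) in sequentially \<times>\<^sub>F sequentially. norm (?a j k) \<le> \<bar>w j\<bar> * K"
      using K order_trans[OF abs_ge_zero K[of 0 0]]
      by (intro always_eventually) (auto simp: abs_mult intro!: mult_left_mono)
    show "summable (\<lambda>j. \<bar>w j\<bar> * K)"
      by (intro summable_mult2 w)
  qed simp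
  moreover have "(\<Sum>j. ?a j k) = (\<Sum>j\<le>s k. w j * v j k)" for k
    by (subst suminf_finite[of "{..s k}"]) (auto intro!: sum.cong)
  moreover have "(\<Sum>j. w j * l) = l * (\<Sum>j. w j)"
    using summable_rabs_cancel[OF w] by (simp add: suminf_mult mult.commute)
  ultimately show ?thesis by simp
qed

text \<open>\<open>Y\<close> is the tail supremum of \<open>y\<close>, \<open>l\<close> the limit
  superior, and \<open>y (s n)\<close> nearly attains the supremum beyond \<open>n\<close>. Keeping
  the majorant \<open>Y\<close> lets later estimates use \<open>y n \<le> Y n\<close> for every
  \<open>n\<close>, not only in the limit.\<close>

lemma tail_sup:
  fixes y :: "nat \<Rightarrow> real"
  assumes K: "\<And>n. \<bar>y n\<bar> \<le> K"
  obtains Y l s where "\<And>n. y n \<le> Y n" "\<And>n. \<bar>Y n\<bar> \<le> K" "Y \<longlonglongrightarrow> l"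
    "filterlim s at_top sequentially" "(\<lambda>k. y (s k)) \<longlonglongrightarrow> l"
proof -
  define Y where "Y n = (SUP m\<in>{n..}. y m)" for n
  have bdd: "bdd_above (y ` A)" for A
    using K by (intro bdd_aboveI2[of _ _ K]) (auto simp: abs_le_iff)
  have yY: "y m \<le> Y n" if "n \<le> m" for n m
    unfolding Y_def using that by (intro cSUP_upper bdd) auto
  have YK: "\<bar>Y n\<bar> \<le> K" for n
  proof (rule abs_leI)
    show "Y n \<le> K" unfolding Y_def using K by (intro cSUP_least) (auto simp: abs_le_iff)
    show "- Y n \<le> K" using yY[of n n] K[of n] by auto
  qed
  have "decseq Y"
    unfolding decseq_def Y_def by (auto intro!: cSUP_subset_mono bdd)
  then obtain l where l: "Y \<longlonglongrightarrow> l"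
    using decseq_convergent[of Y "-K"] YK by (metis abs_le_iff minus_le_iff)
  have "\<exists>m\<ge>n. Y n - 1 / real (Suc n) < y m" for n
  proof (rule ccontr)
    assume "\<not> ?thesis"
    then have "Y n \<le> Y n - 1 / real (Suc n)"
      by (subst (1) Y_def, intro cSUP_least) (auto simp: not_less)
    then show False by (simp add: field_simps)
  qed
  then obtain s where s: "\<And>n. n \<le> s n" "\<And>n. Y n - 1 / real (Suc n) < y (s n)"
    by metis
  have lims: "filterlim s at_top sequentially"
    by (rule filterlim_at_top_mono[OF filterlim_ident]) (use s in auto)
  have "(\<lambda>k. y (s k)) \<longlonglongrightarrow> l"
  proof (rule tendsto_sandwich[of _ _ _ Y])
    show "(\<lambda>n. Y n - 1 / real (Suc n)) \<longlonglongrightarrow> l"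
      using tendsto_diff[OF l lim_1_over_n[THEN LIMSEQ_Suc]] by simp
  qed (use s yY l in \<open>auto intro!: always_eventually less_imp_le\<close>)
  from that[OF _ YK l lims this] yY show ?thesis by auto
qed

text \<open>For a probability distribution \<open>p\<close>, the term \<open>k\<close> is the
  probability that the last renewal up to time \<open>n\<close> occurs at \<open>n - k\<close>: a
  renewal there, followed by an increment larger than \<open>k\<close>. These events exhaust all
  cases.\<close>

lemma renewal_identity:
  fixes p R :: "nat \<Rightarrow> real"
  assumes R0: "R 0 = 1" and R: "\<And>n. 0 < n \<Longrightarrow> R n = (\<Sum>i=1..n. p i * R (n - i))"
    and p0: "p 0 = 0"
  shows "(\<Sum>k\<le>n. (1 - (\<Sum>i\<le>k. p i)) * R (n - k)) = 1"
proof (induction n)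
  case (Suc n)
  let ?r = "\<lambda>k. 1 - (\<Sum>i\<le>k. p i)"
  have "(\<Sum>k\<le>Suc n. ?r k * R (Suc n - k)) = R (Suc n) + (\<Sum>k\<le>n. ?r (Suc k) * R (n - k))"
    by (subst sum.atMost_Suc_shift) (simp add: p0)
  also have "\<dots> = R (Suc n) + (\<Sum>k\<le>n. ?r k * R (n - k)) - (\<Sum>k\<le>n. p (Suc k) * R (n - k))"
    by (simp add: sum_subtractf sum.distrib algebra_simps)
  also have "(\<Sum>k\<le>n. p (Suc k) * R (n - k)) = R (Suc n)"
    unfolding R[OF zero_less_Suc] by (rule sum.reindex_bij_witness[of _ "\<lambda>k. k - 1" Suc]) auto
  finally show ?case using Suc by simp
qed (simp add: R0 p0)

text \<open>\<open>R n\<close> is the probability of a renewal at time \<open>n\<close>.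
  \<open>R_pos\<close> is the form in which aperiodicity is available, and \<open>tail\<close> says
  that the increments have a finite mean, the sum of their tail probabilities.\<close>

locale renewal =
  fixes p R :: "nat \<Rightarrow> real"
  assumes p0: "p 0 = 0" and p_nonneg: "\<And>n. 0 \<le> p n" and p_sums: "p sums 1"
    and R0: "R 0 = 1" and R_Suc: "\<And>n. 0 < n \<Longrightarrow> R n = (\<Sum>i=1..n. p i * R (n - i))"
    and R_pos: "\<forall>\<^sub>F n in sequentially. 0 < R n"
    and tail: "summable (\<lambda>n. 1 - (\<Sum>i\<le>n. p i))"
begin

lemma R_nonneg: "0 \<le> R n"
proof (induction n rule: less_induct)
  case (less n)
  then show ?case
    using R0 R_Suc[of n] p_nonneg by (cases "n = 0") (auto intro!: sum_nonneg mult_nonneg_nonneg)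
qed

lemma tail_nonneg: "0 \<le> 1 - (\<Sum>i\<le>n. p i)"
  using p_nonneg p_sums sum_le_suminf[of p "{..n}"] by (auto simp: sums_iff)

lemma R_le_1: "R n \<le> 1"
proof -
  have "R n = (\<Sum>k\<le>0. (1 - (\<Sum>i\<le>k. p i)) * R (n - k))" by (simp add: p0)
  also have "\<dots> \<le> (\<Sum>k\<le>n. (1 - (\<Sum>i\<le>k. p i)) * R (n - k))"
    by (intro sum_mono2 mult_nonneg_nonneg tail_nonneg R_nonneg) auto
  finally show ?thesis using renewal_identity[OF R0 R_Suc p0] by simp
qed

text \<open>
  Along a sequence realising the upper limit \<open>l\<close> of \<open>y\<close>, all terms with positive weight on the
  right-hand side of the renewal equation must be extremal as well.
\<close>

lemma extremal_shift:
  assumes y: "\<And>n. 0 < n \<Longrightarrow> y n = (\<Sum>i=1..n. p i * y (n - i))"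
    and Y: "\<And>n. y n \<le> Y n" "\<And>n. \<bar>Y n\<bar> \<le> K" "Y \<longlonglongrightarrow> l"
    and s: "filterlim s at_top sequentially" "(\<lambda>k. y (s k)) \<longlonglongrightarrow> l"
    and i: "0 < R i"
  shows "(\<lambda>k. y (s k - i)) \<longlonglongrightarrow> l"
  using i s
proof (induction i arbitrary: s rule: less_induct)
  case (less i)
  note s = less.prems(2,3)
  show ?case
  proof (cases "i = 0")
    case False
    \<comment> \<open>A positive \<open>R i\<close> comes from some first increment \<open>j\<close>
      with \<open>p j\<close> and \<open>R (i - j)\<close> positive. Once the shift by
      \<open>j\<close> is shown to be extremal, the induction hypothesis handles the remaining
      \<open>i - j\<close> along the sequence \<open>s k - j\<close>.\<close>
    have "\<not> (\<Sum>j=1..i. p j * R (i - j)) \<le> 0"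
      using less.prems(1) False R_Suc[of i] by simp
    then obtain j where j: "j \<in> {1..i}" "\<not> p j * R (i - j) \<le> 0"
      by (meson sum_nonpos)
    moreover have "p j \<noteq> 0" "R (i - j) \<noteq> 0" using j(2) by auto
    ultimately have j: "1 \<le> j" "j \<le> i" "0 < p j" "0 < R (i - j)"
      using R_nonneg[of "i - j"] p_nonneg[of j] by auto
    have Ys: "(\<lambda>k. Y (s k - j)) \<longlonglongrightarrow> l" for j
      by (rule filterlim_compose[OF Y(3) filterlim_minus_const_nat[OF s(1)]])
    have "(\<lambda>k. \<Sum>j\<le>s k. p j * Y (s k - j)) \<longlonglongrightarrow> l * suminf p"
      using p_nonneg p_sums by (intro convolution_tendsto[where K = K] Ys s Y(2)) (auto simp: sums_iff)
    then have "(\<lambda>k. (\<Sum>j\<le>s k. p j * Y (s k - j)) - y (s k)) \<longlonglongrightarrow> l - l"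
      using p_sums s(2) by (intro tendsto_diff) (auto simp: sums_iff)
    then have lim: "(\<lambda>k. (\<Sum>j\<le>s k. p j * Y (s k - j)) - y (s k)) \<longlonglongrightarrow> 0" by simp
    \<comment> \<open>The weighted gaps between \<open>Y\<close> and \<open>y\<close> are
      nonnegative and their sum tends to \<open>l - l = 0\<close>, so the single gap with weight
      \<open>p j\<close> vanishes too.\<close>
    have "(\<lambda>k. p j * (Y (s k - j) - y (s k - j))) \<longlonglongrightarrow> 0"
    proof (rule tendsto_sandwich[OF _ _ tendsto_const lim])
      show "\<forall>\<^sub>F k in sequentially. 0 \<le> p j * (Y (s k - j) - y (s k - j))"
        using p_nonneg Y(1) by (intro always_eventually allI mult_nonneg_nonneg) auto
      show "\<forall>\<^sub>F k in sequentially. p j * (Y (s k - j) - y (s k - j))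
          \<le> (\<Sum>j\<le>s k. p j * Y (s k - j)) - y (s k)"
        using s(1)[unfolded filterlim_at_top, rule_format, of j]
      proof eventually_elim
        case (elim k)
        have "(\<Sum>j\<le>s k. p j * Y (s k - j)) - y (s k) = (\<Sum>j=1..s k. p j * (Y (s k - j) - y (s k - j)))"
          using elim j y[of "s k"]
          by (simp add: atMost_atLeast0 sum.atLeast_Suc_atMost p0 sum_subtractf right_diff_distrib)
        also have "\<dots> \<ge> (\<Sum>j\<in>{j}. p j * (Y (s k - j) - y (s k - j)))"
          using elim j p_nonneg Y(1) by (intro sum_mono2 mult_nonneg_nonneg) auto
        finally show ?case by simp
      qed
    qed
    then have "(\<lambda>k. (1 / p j) * (p j * (Y (s k - j) - y (s k - j)))) \<longlonglongrightarrow> (1 / p j) * 0"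
      by (intro tendsto_mult tendsto_const)
    then have "(\<lambda>k. Y (s k - j) - y (s k - j)) \<longlonglongrightarrow> 0"
      using j by simp
    from tendsto_diff[OF Ys[of j] this] have "(\<lambda>k. y (s k - j)) \<longlonglongrightarrow> l"
      by simp
    from less.IH[OF _ j(4) filterlim_minus_const_nat[OF s(1)] this] j show ?thesis
      by simp
  qed (use s in simp)
qed

text \<open>In the renewal identity, scaled by \<open>c\<close>, all shifted terms converge to the
  same extremal limit \<open>l\<close>, so \<open>l\<close> times the mean equals \<open>c\<close>.
  A general \<open>c\<close> covers \<open>c = 1\<close> and \<open>c = - 1\<close>, that is, the
  upper and the lower limit of \<open>R\<close>.\<close>

lemma upper_limit:
  assumes y: "\<And>n. y n = c * R n"
  obtains Y where "\<And>n. y n \<le> Y n" "Y \<longlonglongrightarrow> c / (\<Sum>n. 1 - (\<Sum>i\<le>n. p i))"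
proof -
  let ?r = "\<lambda>n. 1 - (\<Sum>i\<le>n. p i)"
  have yK: "\<bar>y n\<bar> \<le> \<bar>c\<bar>" for n
    using R_le_1[of n] R_nonneg[of n] by (auto simp: y abs_mult intro: mult_left_le)
  then obtain Y l s where Y: "\<And>n. y n \<le> Y n" "\<And>n. \<bar>Y n\<bar> \<le> \<bar>c\<bar>" "Y \<longlonglongrightarrow> l"
    "filterlim s at_top sequentially" "(\<lambda>k. y (s k)) \<longlonglongrightarrow> l"
    using tail_sup[of y "\<bar>c\<bar>"] by metis
  obtain i0 where i0: "\<And>i. i0 \<le> i \<Longrightarrow> 0 < R i"
    using R_pos by (auto simp: eventually_sequentially)
  have yn: "y n = (\<Sum>i=1..n. p i * y (n - i))" if "0 < n" for n
    using R_Suc[OF that] by (simp add: y sum_distrib_left ac_simps)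
  \<comment> \<open>Shifting by a further \<open>i0\<close> makes \<open>R (i0 + j)\<close> positive
    for every \<open>j\<close>, so \<open>extremal_shift\<close> applies to all terms of the
    sum.\<close>
  have "(\<lambda>k. \<Sum>j\<le>s k - i0. ?r j * y (s k - i0 - j)) \<longlonglongrightarrow> l * suminf ?r"
    using tail_nonneg tail extremal_shift[OF yn Y i0[OF le_add1]]
    by (intro convolution_tendsto[where K = "\<bar>c\<bar>"] yK filterlim_minus_const_nat Y) simp_all
  moreover have "(\<Sum>j\<le>n. ?r j * y (n - j)) = c" for n
    using renewal_identity[OF R0 R_Suc p0, of n] sum_distrib_left[of c "\<lambda>j. ?r j * R (n - j)" "{..n}"]
    by (simp add: y ac_simps)
  ultimately have "l * suminf ?r = c"
    by (simp del: diff_diff_left add: LIMSEQ_const_iff)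
  moreover have "1 \<le> suminf ?r"
    using sum_le_suminf[OF tail, of "{0}"] tail_nonneg p0 by auto
  ultimately have "l = c / suminf ?r" by (auto simp: field_simps)
  with Y that show ?thesis by metis
qed

theorem renewal_theorem: "R \<longlonglongrightarrow> 1 / (\<Sum>n. 1 - (\<Sum>i\<le>n. p i))"
proof -
  obtain Y where Y: "\<And>n. R n \<le> Y n" "Y \<longlonglongrightarrow> 1 / (\<Sum>n. 1 - (\<Sum>i\<le>n. p i))"
    using upper_limit[of R 1] by auto
  obtain Z where Z: "\<And>n. - R n \<le> Z n" "Z \<longlonglongrightarrow> - 1 / (\<Sum>n. 1 - (\<Sum>i\<le>n. p i))"
    using upper_limit[of "\<lambda>n. - R n" "-1"] by auto
  show ?thesis
  proof (rule tendsto_sandwich[of "\<lambda>n. - Z n" _ _ Y])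
    show "\<forall>\<^sub>F n in sequentially. - Z n \<le> R n"
      using Z(1) by (intro always_eventually allI) (simp add: minus_le_iff)
    show "(\<lambda>n. - Z n) \<longlonglongrightarrow> 1 / (\<Sum>n. 1 - (\<Sum>i\<le>n. p i))"
      using tendsto_minus[OF Z(2)] by simp
  qed (use Y in \<open>auto intro!: always_eventually\<close>)
qed

end

section \<open>Kernel operators and regeneration\<close>

lemma indicator_le_1_ennreal: "indicator A x \<le> (1::ennreal)"
  by (auto split: split_indicator)

lemma Collect_borel: "Measurable.pred borel Q \<Longrightarrow> {x. Q x} \<in> sets borel"
  by (simp add: pred_def)

lemma Collect_stream: "Measurable.pred (stream_space borel) Q \<Longrightarrow> {w. Q w} \<in> sets (stream_space borel)"
  by (simp add: pred_def space_stream_space)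

lemma sum_shift_le:
  fixes a :: "nat \<Rightarrow> ennreal"
  assumes "\<And>n. (\<Sum>i<n. a i) \<le> c"
  shows "(\<Sum>i<n. a (i + j)) \<le> c"
proof -
  have "(\<Sum>i<n. a (i + j)) = (\<Sum>i\<in>{j..<n+j}. a i)"
    by (rule sum.reindex_bij_witness[of _ "\<lambda>i. i - j" "\<lambda>i. i + j"]) auto
  also have "\<dots> \<le> (\<Sum>i<n + j. a i)"
    by (intro sum_mono2) auto
  finally show ?thesis using assms order_trans by blast
qed

text \<open>Lets the invariant measure be introduced by a formula for its integrals. Countable
  additivity is monotone continuity along partial sums of indicators; \<open>cong\<close> expresses
  that values off the space do not matter.\<close>

lemma functional_measure:
  fixes \<Lambda> :: "('a \<Rightarrow> ennreal) \<Rightarrow> ennreal"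
  assumes add: "\<And>u v. u \<in> borel_measurable M \<Longrightarrow> v \<in> borel_measurable M \<Longrightarrow> \<Lambda> (\<lambda>x. u x + v x) = \<Lambda> u + \<Lambda> v"
    and cmult: "\<And>c u. u \<in> borel_measurable M \<Longrightarrow> \<Lambda> (\<lambda>x. c * u x) = c * \<Lambda> u"
    and SUP: "\<And>U. (\<And>i. U i \<in> borel_measurable M) \<Longrightarrow> incseq U \<Longrightarrow> \<Lambda> (\<lambda>x. SUP i. U i x) = (SUP i. \<Lambda> (U i))"
    and cong: "\<And>u v. (\<And>x. x \<in> space M \<Longrightarrow> u x = v x) \<Longrightarrow> \<Lambda> u = \<Lambda> v"
  obtains \<nu> where "sets \<nu> = sets M" "\<And>u. u \<in> borel_measurable M \<Longrightarrow> (\<integral>\<^sup>+x. u x \<partial>\<nu>) = \<Lambda> u"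
proof
  define \<nu> where "\<nu> = measure_of (space M) (sets M) (\<lambda>A. \<Lambda> (indicator A))"
  have zero: "\<Lambda> (\<lambda>x. 0) = 0"
    using cmult[of "\<lambda>_. 0" 0] by simp
  have sum: "\<Lambda> (\<lambda>x. \<Sum>i<n. u i x) = (\<Sum>i<n. \<Lambda> (u i))"
    if [measurable]: "\<And>i. u i \<in> borel_measurable M" for u and n :: nat
    by (induction n) (simp_all add: zero add)
  have em: "emeasure \<nu> A = \<Lambda> (indicator A)" if A: "A \<in> sets M" for A
    unfolding \<nu>_def
  proof (rule emeasure_measure_of_sigma[OF sets.sigma_algebra_axioms _ _ A])
    show "positive (sets M) (\<lambda>A. \<Lambda> (indicator A))"
      using zero by (simp add: positive_def indicator_def[abs_def])
    show "countably_additive (sets M) (\<lambda>A. \<Lambda> (indicator A))"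
    proof (rule countably_additiveI)
      fix A :: "nat \<Rightarrow> 'a set" assume A: "range A \<subseteq> sets M" "disjoint_family A"
      then have [measurable]: "A i \<in> sets M" for i by auto
      have "\<Lambda> (indicator (\<Union>i. A i)) = \<Lambda> (\<lambda>x. SUP n. \<Sum>i<n. indicator (A i) x)"
        by (intro cong) (simp add: suminf_indicator[OF A(2), symmetric] suminf_eq_SUP)
      also have "\<dots> = (SUP n. \<Lambda> (\<lambda>x. \<Sum>i<n. indicator (A i) x))"
        by (intro SUP) (auto simp: incseq_def le_fun_def intro!: sum_mono2)
      also have "\<dots> = (\<Sum>i. \<Lambda> (indicator (A i)))"
        by (subst sum) (auto simp: suminf_eq_SUP)
      finally show "(\<Sum>i. \<Lambda> (indicator (A i))) = \<Lambda> (indicator (\<Union>i. A i))" ..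
    qed
  qed
  show sets: "sets \<nu> = sets M" by (simp add: \<nu>_def)
  fix u :: "'a \<Rightarrow> ennreal" assume "u \<in> borel_measurable M"
  then show "(\<integral>\<^sup>+x. u x \<partial>\<nu>) = \<Lambda> u"
  proof (induction rule: borel_measurable_induct)
    case (cong f g)
    then show ?case
      using nn_integral_cong[of \<nu> f g] assms(4)[of f g] sets_eq_imp_space_eq[OF sets] by simp
  next
    case (set A) then show ?case using em sets by simp
  next
    case (mult u c) then show ?case
      using assms(2) by (simp add: nn_integral_cmult measurable_cong_sets[OF sets refl])
  next
    case (add u v) then show ?case
      using assms(1) by (simp add: nn_integral_add measurable_cong_sets[OF sets refl])
  next
    case (seq U)
    then show ?case
      using SUP[of U] nn_integral_monotone_convergence_SUP[of U \<nu>]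
      by (simp add: SUP_apply[abs_def] measurable_cong_sets[OF sets refl])
  qed
qed

section \<open>Kernels acting on nonnegative functions\<close>

definition kop :: "('a \<Rightarrow> 'b measure) \<Rightarrow> ('b \<Rightarrow> ennreal) \<Rightarrow> 'a \<Rightarrow> ennreal"
  where "kop k u x = (\<integral>\<^sup>+ y. u y \<partial>k x)"

locale subkernel =
  fixes k :: "'a::topological_space \<Rightarrow> 'a measure"
  assumes k: "k \<in> borel \<rightarrow>\<^sub>M subprob_algebra borel"
begin

lemma sets_k: "sets (k x) = sets borel"
  using sets_kernel[OF k, of x] by simp

lemma measurable_k [simp]: "u \<in> borel_measurable (k x) \<longleftrightarrow> u \<in> borel_measurable borel"
  by (rule measurable_cong_sets[OF sets_k refl, THEN arg_cong])

lemma kop_measurable [measurable]: "u \<in> borel_measurable borel \<Longrightarrow> kop k u \<in> borel_measurable borel"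
  unfolding kop_def[abs_def] by (rule measurable_compose[OF k nn_integral_measurable_subprob_algebra])

lemma pow_measurable [measurable]:
  "u \<in> borel_measurable borel \<Longrightarrow> (kop k ^^ n) u \<in> borel_measurable borel"
  by (induction n) auto

lemma kop_mono: "(\<And>x. u x \<le> v x) \<Longrightarrow> kop k u x \<le> kop k v x"
  unfolding kop_def by (rule nn_integral_mono)

lemma pow_mono: "(\<And>x. u x \<le> v x) \<Longrightarrow> (kop k ^^ n) u x \<le> (kop k ^^ n) v x"
  by (induction n arbitrary: x) (auto intro: kop_mono)

lemma pow_add:
  "u \<in> borel_measurable borel \<Longrightarrow> v \<in> borel_measurable borel \<Longrightarrow>
    (kop k ^^ n) (\<lambda>x. u x + v x) = (\<lambda>x. (kop k ^^ n) u x + (kop k ^^ n) v x)"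
  by (induction n) (auto simp: kop_def nn_integral_add)

lemma pow_cmult:
  "u \<in> borel_measurable borel \<Longrightarrow> (kop k ^^ n) (\<lambda>x. c * u x) = (\<lambda>x. c * (kop k ^^ n) u x)"
  by (induction n) (auto simp: kop_def nn_integral_cmult)

text \<open>The drift inequality passes through the iterates by positivity and telescopes. All terms
  stand with a plus sign, as subtraction in \<open>ennreal\<close> would truncate.\<close>

lemma pow_drift:
  assumes [measurable]: "W \<in> borel_measurable borel" "g \<in> borel_measurable borel" "h \<in> borel_measurable borel"
    and drift: "\<And>x. kop k W x + g x \<le> W x + b * h x"
  shows "(kop k ^^ n) W x + (\<Sum>r<n. (kop k ^^ r) g x) \<le> W x + b * (\<Sum>r<n. (kop k ^^ r) h x)"
proof (induction n)
  case (Suc n)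
  have "(kop k ^^ Suc n) W x + (kop k ^^ n) g x = (kop k ^^ n) (\<lambda>x. kop k W x + g x) x"
    by (simp add: pow_add funpow_swap1)
  also have "\<dots> \<le> (kop k ^^ n) (\<lambda>x. W x + b * h x) x"
    by (rule pow_mono[OF drift])
  also have "\<dots> = (kop k ^^ n) W x + b * (kop k ^^ n) h x"
    by (simp add: pow_add pow_cmult)
  finally have "(kop k ^^ Suc n) W x + (kop k ^^ n) g x + (\<Sum>r<n. (kop k ^^ r) g x)
      \<le> (kop k ^^ n) W x + b * (kop k ^^ n) h x + (\<Sum>r<n. (kop k ^^ r) g x)"
    by (rule add_right_mono)
  also have "\<dots> \<le> (W x + b * (\<Sum>r<n. (kop k ^^ r) h x)) + b * (kop k ^^ n) h x"
    using add_right_mono[OF Suc, of "b * (kop k ^^ n) h x"] by (simp add: ac_simps)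
  finally show ?case by (simp add: ac_simps distrib_left del: funpow.simps)
qed simp

lemma pow_zero: "(kop k ^^ n) (\<lambda>x. 0) = (\<lambda>x. 0)"
  by (induction n) (auto simp: kop_def)

lemma pow_sum:
  "(\<And>i. i \<in> I \<Longrightarrow> u i \<in> borel_measurable borel) \<Longrightarrow>
    (kop k ^^ n) (\<lambda>x. \<Sum>i\<in>I. u i x) = (\<lambda>x. \<Sum>i\<in>I. (kop k ^^ n) (u i) x)"
proof (induction I rule: infinite_finite_induct)
  case (insert i I)
  then show ?case using pow_add[of "u i" "\<lambda>x. \<Sum>i\<in>I. u i x" n] by simp
qed (auto simp: pow_zero)

lemma pow_SUP:
  assumes "\<And>i. U i \<in> borel_measurable borel" "incseq U"
  shows "(kop k ^^ n) (\<lambda>x. SUP i. U i x) = (\<lambda>x. SUP i::nat. (kop k ^^ n) (U i) x)"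
proof (induction n)
  case (Suc n)
  have "incseq (\<lambda>i. (kop k ^^ n) (U i))"
    using assms(2) by (auto simp: incseq_def le_fun_def intro!: pow_mono)
  then have "kop k (\<lambda>x. SUP i. (kop k ^^ n) (U i) x) x = (SUP i. kop k ((kop k ^^ n) (U i)) x)" for x
    using assms(1) by (subst (1 2) kop_def) (simp add: nn_integral_monotone_convergence_SUP)
  then show ?case unfolding funpow.simps comp_def Suc by (rule ext)
qed simp

lemma pow_const_le: "(kop k ^^ n) (\<lambda>x. c) x \<le> c"
proof (induction n arbitrary: x)
  case (Suc n)
  interpret subprob_space "k x" using subprob_space_kernel[OF k, of x] by simp
  have "(kop k ^^ Suc n) (\<lambda>x. c) x \<le> (\<integral>\<^sup>+ y. c \<partial>k x)"
    unfolding funpow.simps comp_def by (subst kop_def) (intro nn_integral_mono Suc)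
  also have "\<dots> \<le> c * 1"
    using mult_left_mono[OF emeasure_space_le_1, of c] by simp
  finally show ?case by simp
qed simp

lemma pow_indicator_le_1: "(kop k ^^ n) (indicator A) x \<le> 1"
  by (rule order_trans[OF pow_mono[OF indicator_le_1_ennreal] pow_const_le])

end

lemma convolution_tendsto_ennreal:
  fixes w v :: "nat \<Rightarrow> ennreal"
  assumes w: "(\<Sum>j. w j) < \<infinity>" and v: "v \<longlonglongrightarrow> l" "l < \<infinity>" "\<And>j. v j < \<infinity>"
  shows "(\<lambda>t. \<Sum>j<t. w j * v (t - Suc j)) \<longlonglongrightarrow> l * (\<Sum>j. w j)"
proof -
  have wf: "w j < \<infinity>" for j
    using w ennreal_suminf_lessD by auto
  define wr vr where "wr j = enn2real (w j)" and "vr j = enn2real (v j)" for j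
  have wr: "w = (\<lambda>j. ennreal (wr j))" and vr: "v = (\<lambda>j. ennreal (vr j))"
    using wf v by (auto simp: wr_def vr_def less_top)
  have nn: "0 \<le> wr j" "0 \<le> vr j" for j by (auto simp: wr_def vr_def)
  have sw: "summable wr" using w nn unfolding wr
    by (intro summable_suminf_not_top) auto
  have vl: "vr \<longlonglongrightarrow> enn2real l"
    unfolding vr_def using v by (intro tendsto_enn2real) (auto simp: less_top)
  obtain K where K: "\<And>n. \<bar>vr n\<bar> \<le> K"
    using vl by (metis Bseq_def convergent_imp_Bseq convergentI real_norm_def)
  have "(\<lambda>n. \<Sum>j\<le>n. wr j * vr (n - j)) \<longlonglongrightarrow> enn2real l * suminf wr"
    using sw nn K filterlim_compose[OF vl filterlim_minus_const_nat[OF filterlim_ident]]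
    by (intro convolution_tendsto[where K = K]) (auto intro: filterlim_ident)
  then have "(\<lambda>n. ennreal (\<Sum>j\<le>n. wr j * vr (n - j))) \<longlonglongrightarrow> ennreal (enn2real l * suminf wr)"
    by (rule tendsto_ennrealI)
  also have "(\<lambda>n. ennreal (\<Sum>j\<le>n. wr j * vr (n - j))) = (\<lambda>n. \<Sum>j<Suc n. w j * v (Suc n - Suc j))"
    using nn by (simp add: wr vr ennreal_mult lessThan_Suc_atMost flip: sum_ennreal)
  also have "ennreal (enn2real l * suminf wr) = l * (\<Sum>j. w j)"
    using v(2) sw nn by (simp add: ennreal_mult suminf_nonneg suminf_ennreal2 wr less_top)
  finally show ?thesis by (rule LIMSEQ_imp_Suc)
qed


text \<open>From a state in \<open>B\<close> the part \<open>\<mu>\<close> of the transition forgets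
  the state; its mass is the regeneration probability, and \<open>Q\<close> moves without
  regeneration. Stating \<open>split\<close> as a sum avoids differences of possibly infinite
  integrals.\<close>

locale regenerative =
  K: subkernel K + Q: subkernel Q
  for K Q :: "'a::topological_space \<Rightarrow> 'a measure" +
  fixes B :: "'a set" and \<mu> :: "'a measure"
  assumes B [measurable]: "B \<in> sets borel"
    and sets_\<mu>: "sets \<mu> = sets borel"
    and \<mu>_pos: "0 < emeasure \<mu> UNIV" and \<mu>_fin: "emeasure \<mu> UNIV < \<infinity>"
    and K_one: "kop K (\<lambda>_. 1) = (\<lambda>_. 1)"
    and split: "\<And>u x. u \<in> borel_measurable borel \<Longrightarrow>
      kop K u x = kop Q u x + indicator B x * (\<integral>\<^sup>+ y. u y \<partial>\<mu>)"
begin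

lemma measurable_\<mu> [simp]: "u \<in> borel_measurable \<mu> \<longleftrightarrow> u \<in> borel_measurable borel"
  by (rule measurable_cong_sets[OF sets_\<mu> refl, THEN arg_cong])

lemma space_\<mu> [simp]: "space \<mu> = UNIV"
  using sets_eq_imp_space_eq[OF sets_\<mu>] by simp

abbreviation m :: "('a \<Rightarrow> ennreal) \<Rightarrow> ennreal" where "m u \<equiv> \<integral>\<^sup>+ y. u y \<partial>\<mu>"

abbreviation \<beta> :: ennreal where "\<beta> \<equiv> emeasure \<mu> UNIV"

lemma m_pow_indicator_le: "m ((kop K ^^ n) (indicator A)) \<le> \<beta>" "m ((kop Q ^^ n) (indicator A)) \<le> \<beta>"
  using nn_integral_mono[of \<mu> "(kop K ^^ n) (indicator A)" "\<lambda>_. 1"] K.pow_indicator_le_1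
    nn_integral_mono[of \<mu> "(kop Q ^^ n) (indicator A)" "\<lambda>_. 1"] Q.pow_indicator_le_1 by auto

text \<open>Expand the \<open>t\<close>-th power of \<open>Q + 1_B \<otimes> \<mu>\<close> according
  to the last factor \<open>1_B \<otimes> \<mu>\<close>: arbitrary steps before it, only
  \<open>Q\<close> after it. Thus \<open>g\<close> is met by powers of \<open>Q\<close>
  alone.\<close>

lemma last_regeneration:
  assumes [measurable]: "g \<in> borel_measurable borel"
  shows "(kop K ^^ t) g x =
    (kop Q ^^ t) g x + (\<Sum>j<t. (kop K ^^ j) (indicator B) x * m ((kop Q ^^ (t - Suc j)) g))"
proof (induction t arbitrary: x)
  case (Suc t)
  have "(kop K ^^ Suc t) g x =
      kop K (\<lambda>x. (kop Q ^^ t) g x + (\<Sum>j<t. (kop K ^^ j) (indicator B) x * m ((kop Q ^^ (t - Suc j)) g))) x"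
    unfolding funpow.simps comp_def by (intro fun_cong[OF arg_cong[where f = "kop K"]] ext Suc)
  also have "\<dots> = kop K ((kop Q ^^ t) g) x
      + (\<Sum>j<t. (kop K ^^ Suc j) (indicator B) x * m ((kop Q ^^ (t - Suc j)) g))"
    by (simp add: kop_def[of K] nn_integral_add nn_integral_sum nn_integral_multc)
  also have "\<dots> = (kop Q ^^ Suc t) g x
      + (\<Sum>j<Suc t. (kop K ^^ j) (indicator B) x * m ((kop Q ^^ (Suc t - Suc j)) g))"
    by (subst sum.lessThan_Suc_shift) (simp add: split add_ac)
  finally show ?case .
qed simp

text \<open>The same expansion by the first factor \<open>1_B \<otimes> \<mu>\<close>; now the
  initial state \<open>x\<close> is met by powers of \<open>Q\<close> alone.\<close>

lemma first_regeneration: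
  assumes [measurable]: "g \<in> borel_measurable borel"
  shows "(kop K ^^ t) g x =
    (kop Q ^^ t) g x + (\<Sum>j<t. (kop Q ^^ j) (indicator B) x * m ((kop K ^^ (t - Suc j)) g))"
proof (induction t arbitrary: x)
  case (Suc t)
  have "(kop K ^^ Suc t) g x = kop Q ((kop K ^^ t) g) x + indicator B x * m ((kop K ^^ t) g)"
    by (simp add: split)
  also have "kop Q ((kop K ^^ t) g) x =
      kop Q (\<lambda>x. (kop Q ^^ t) g x + (\<Sum>j<t. (kop Q ^^ j) (indicator B) x * m ((kop K ^^ (t - Suc j)) g))) x"
    by (intro fun_cong[OF arg_cong[where f = "kop Q"]] ext Suc)
  also have "\<dots> = (kop Q ^^ Suc t) g x
      + (\<Sum>j<t. (kop Q ^^ Suc j) (indicator B) x * m ((kop K ^^ (t - Suc j)) g))"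
    by (simp add: kop_def[of Q] nn_integral_add nn_integral_sum nn_integral_multc)
  finally show ?case
    by (subst sum.lessThan_Suc_shift) (simp add: add_ac)
qed simp

text \<open>\<open>Q\<close> loses exactly the mass \<open>\<beta>\<close> at each point of
  \<open>B\<close>, so regeneration within \<open>n\<close> steps and survival for \<open>n\<close>
  steps have total probability 1.\<close>

lemma Q_total: "\<beta> * (\<Sum>i<n. (kop Q ^^ i) (indicator B) x) + (kop Q ^^ n) (\<lambda>_. 1) x = 1"
proof (induction n)
  case (Suc n)
  have "(\<lambda>x. kop Q (\<lambda>_. 1) x + \<beta> * indicator B x) = (\<lambda>_. 1)"
    using split[of "\<lambda>_. 1"] fun_cong[OF K_one] by (auto simp: fun_eq_iff mult.commute)
  then have "(kop Q ^^ n) (\<lambda>_. 1) =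
      (kop Q ^^ n) (\<lambda>x. kop Q (\<lambda>_. 1) x + \<beta> * indicator B x)"
    by simp
  also have "\<dots> = (\<lambda>x. (kop Q ^^ Suc n) (\<lambda>_. 1) x + \<beta> * (kop Q ^^ n) (indicator B) x)"
    by (subst Q.pow_add) (simp_all add: Q.pow_cmult funpow_swap1)
  finally have "(kop Q ^^ n) (\<lambda>_. 1) x =
      (kop Q ^^ Suc n) (\<lambda>_. 1) x + \<beta> * (kop Q ^^ n) (indicator B) x"
    by (rule fun_cong)
  then show ?case using Suc by (simp add: distrib_left add_ac del: funpow.simps)
qed simp

lemma Q_visits_le: "(\<Sum>i<n. (kop Q ^^ i) (indicator B) x) \<le> 1 / \<beta>"
proof -
  have "\<beta> * (\<Sum>i<n. (kop Q ^^ i) (indicator B) x) \<le> 1"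
    using Q_total by (metis le_iff_add)
  then have "\<beta> * (\<Sum>i<n. (kop Q ^^ i) (indicator B) x) / \<beta> \<le> 1 / \<beta>"
    by (rule divide_right_mono_ennreal)
  then show ?thesis using \<mu>_pos \<mu>_fin by (simp add: mult.commute[of "\<beta>"] ennreal_mult_divide_eq)
qed


lemma Q_visits:
  assumes "(\<lambda>n. (kop Q ^^ n) (\<lambda>_. 1) x) \<longlonglongrightarrow> 0"
  shows "(\<Sum>i. (kop Q ^^ i) (indicator B) x) = 1 / \<beta>"
proof -
  have "(\<lambda>n. \<beta> * (\<Sum>i<n. (kop Q ^^ i) (indicator B) x) + (kop Q ^^ n) (\<lambda>_. 1) x)
      \<longlonglongrightarrow> \<beta> * (\<Sum>i. (kop Q ^^ i) (indicator B) x) + 0"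
    using \<mu>_fin by (intro tendsto_add assms ennreal_tendsto_cmult summable_LIMSEQ) auto
  then have "\<beta> * (\<Sum>i. (kop Q ^^ i) (indicator B) x) = 1"
    unfolding Q_total by (simp add: LIMSEQ_const_iff)
  then show ?thesis
    using \<mu>_pos \<mu>_fin by (metis ennreal_mult_divide_eq less_irrefl mult.commute top.not_eq_extremum infinity_ennreal_def)
qed

end

locale ergodic_regenerative = regenerative +
  assumes finite_mean: "(\<Sum>i. m ((kop Q ^^ i) (\<lambda>_. 1))) < \<infinity>"
    and Q_vanish: "\<And>x. (\<Sum>i. (kop Q ^^ i) (\<lambda>_. 1) x) < \<infinity>"
    and aperiodic: "\<forall>\<^sub>F n in sequentially. 0 < m ((kop K ^^ n) (indicator B))"
begin

text \<open>Started from the normalised \<open>\<mu>\<close>, the chain has mean time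
  \<open>D / \<beta>\<close> to the next regeneration, counted in steps of \<open>K\<close>; this is
  the mean in the renewal theorem.\<close>

definition D :: ennreal where "D = (\<Sum>i. m ((kop Q ^^ i) (\<lambda>_. 1)))"

lemma D_pos: "0 < D"
proof -
  have "m ((kop Q ^^ 0) (\<lambda>_. 1)) \<le> D"
    unfolding D_def by (rule sum_le_suminf[of _ "{0}", simplified]) auto
  then show ?thesis using \<mu>_pos by auto
qed

text \<open>
  With \<open>a i = m (Q\<^sup>i 1\<^sub>B)\<close>, last regeneration makes \<open>u j = m (K\<^sup>j 1\<^sub>B)\<close> the renewal sequence
  of the increment distribution \<open>a\<close>; the index shift comes from the regeneration at time \<open>0\<close>.
\<close>

lemma renewal_limit: "(\<lambda>j. m ((kop K ^^ j) (indicator B))) \<longlonglongrightarrow> \<beta> / D"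
proof -
  define a u where "a i = m ((kop Q ^^ i) (indicator B))" and "u i = m ((kop K ^^ i) (indicator B))" for i
  have fin: "a i < \<infinity>" "u i < \<infinity>" "m ((kop Q ^^ i) (\<lambda>_. 1)) < \<infinity>" for i
    unfolding a_def u_def using m_pow_indicator_le[THEN le_less_trans, OF \<mu>_fin]
      finite_mean ennreal_suminf_lessD by auto
  define b where "b = enn2real \<beta>"
  have b: "\<beta> = ennreal b" "0 < b"
    using \<mu>_fin \<mu>_pos by (auto simp: b_def less_top enn2real_positive_iff)
  define ar ur qr where "ar i = enn2real (a i)" and "ur i = enn2real (u i)"
    and "qr i = enn2real (m ((kop Q ^^ i) (\<lambda>_. 1)))" for i
  have nn: "0 \<le> ar i" "0 \<le> ur i" "0 \<le> qr i" for i by (auto simp: ar_def ur_def qr_def)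
  have ar: "a i = ennreal (ar i)" and ur: "u i = ennreal (ur i)"
    and qr: "m ((kop Q ^^ i) (\<lambda>_. 1)) = ennreal (qr i)" for i
    using fin by (auto simp: ar_def ur_def qr_def less_top)
  have "\<beta> * (\<Sum>i<n. a i) + m ((kop Q ^^ n) (\<lambda>_. 1)) = \<beta>" for n
  proof -
    have "m (\<lambda>x. \<beta> * (\<Sum>i<n. (kop Q ^^ i) (indicator B) x) + (kop Q ^^ n) (\<lambda>_. 1) x) = \<beta>"
      unfolding Q_total by simp
    then show ?thesis
      by (simp add: nn_integral_add nn_integral_cmult nn_integral_sum a_def)
  qed
  then have tail: "b * (\<Sum>i<n. ar i) + qr n = b" for n
    using b nn unfolding ar qr by (simp add: ennreal_mult[symmetric] sum_nonneg flip: ennreal_plus)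
  have sumq: "summable qr" "D = ennreal (\<Sum>i. qr i)"
    using finite_mean nn unfolding D_def qr
    by (auto intro!: summable_suminf_not_top suminf_ennreal simp: less_top[symmetric])
  have "(\<lambda>n. \<Sum>i<n. ar i) = (\<lambda>n. 1 - qr n / b)"
    using tail b(2) by (auto simp: fun_eq_iff field_simps)
  then have sa: "ar sums 1"
    unfolding sums_def using tendsto_diff[OF tendsto_const tendsto_divide[OF summable_LIMSEQ_zero[OF sumq(1)] tendsto_const], of b 1] b
    by simp
  have u_eq: "u t = a t + (\<Sum>j<t. u j * a (t - Suc j))" for t
  proof -
    have "u t = m (\<lambda>x. (kop Q ^^ t) (indicator B) x
        + (\<Sum>j<t. (kop K ^^ j) (indicator B) x * m ((kop Q ^^ (t - Suc j)) (indicator B))))"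
      unfolding u_def by (intro nn_integral_cong last_regeneration) simp
    then show ?thesis
      by (simp add: nn_integral_add nn_integral_sum nn_integral_multc u_def a_def)
  qed
  have u_rec: "ur t = ar t + (\<Sum>j<t. ur j * ar (t - Suc j))" for t
    using u_eq[of t] nn unfolding ar ur
    by (simp add: ennreal_mult[symmetric] sum_nonneg flip: ennreal_plus)
  define p where "p i = (if i = 0 then 0 else ar (i - 1))" for i
  define R where "R i = (if i = 0 then 1 else ur (i - 1))" for i
  \<comment> \<open>By \<open>Q_total\<close> the tail of the increment distribution is the
    normalised survival mass, so \<open>finite_mean\<close> is the finite mean that
    \<open>renewal\<close> requires.\<close>
  have p_tail: "1 - (\<Sum>i\<le>n. p i) = qr n / b" for n
  proof -
    have "(\<Sum>i\<le>n. p i) = (\<Sum>i<n. ar i)"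
      by (simp add: p_def sum.atMost_shift lessThan_Suc_atMost)
    then show ?thesis using tail[of n] b(2) by (simp add: field_simps)
  qed
  interpret R: renewal p R
  proof
    show "p sums 1" using sa sums_Suc_iff[of p 1] by (simp add: p_def)
    show "R n = (\<Sum>i=1..n. p i * R (n - i))" if "0 < n" for n
    proof -
      obtain t where t: "n = Suc t" using \<open>0 < n\<close> gr0_implies_Suc by blast
      have "(\<Sum>i=1..n. p i * R (n - i)) = (\<Sum>i\<le>t. ar i * R (t - i))"
        unfolding t by (rule sum.reindex_bij_witness[of _ Suc "\<lambda>i. i - 1"]) (auto simp: p_def)
      also have "\<dots> = ar t + (\<Sum>i<t. ar i * ur (t - Suc i))"
        by (simp add: lessThan_Suc_atMost[symmetric] R_def)
      also have "(\<Sum>i<t. ar i * ur (t - Suc i)) = (\<Sum>j<t. ur j * ar (t - Suc j))"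
        by (rule sum.reindex_bij_witness[of _ "\<lambda>i. t - Suc i" "\<lambda>i. t - Suc i"]) auto
      finally show ?thesis using u_rec[of t] by (simp add: t R_def)
    qed
    show "\<forall>\<^sub>F n in sequentially. 0 < R n"
    proof (subst eventually_sequentially_Suc[symmetric], rule eventually_mono[OF aperiodic])
      show "0 < R (Suc n)" if "0 < m ((kop K ^^ n) (indicator B))" for n
        using that fin(2)[of n] by (simp add: R_def ur_def u_def enn2real_positive_iff)
    qed
    show "summable (\<lambda>n. 1 - (\<Sum>i\<le>n. p i))"
      unfolding p_tail by (intro summable_divide sumq)
  qed (auto simp: p_def R_def nn)
  have "R \<longlonglongrightarrow> b / (\<Sum>n. qr n)"
    using R.renewal_theorem unfolding p_tail by (simp add: suminf_divide sumq)
  then have "(\<lambda>n. R (Suc n)) \<longlonglongrightarrow> b / (\<Sum>n. qr n)" by (rule LIMSEQ_Suc)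
  then have "ur \<longlonglongrightarrow> b / (\<Sum>n. qr n)" by (simp add: R_def)
  then have "u \<longlonglongrightarrow> ennreal (b / (\<Sum>n. qr n))"
    unfolding ur by (rule tendsto_ennrealI)
  then show ?thesis
    using b sumq D_pos unfolding u_def[symmetric] by (simp add: divide_ennreal)
qed

text \<open>Last regeneration and the renewal limit give the convergence of
  \<open>m ((kop K ^^ t) g)\<close>; first regeneration carries it over to the initial state
  \<open>x\<close>.\<close>

lemma regenerative_limit:
  assumes g [measurable]: "g \<in> borel_measurable borel"
    and g\<mu>: "(\<Sum>i. m ((kop Q ^^ i) g)) < \<infinity>" and gx: "\<And>x. (\<Sum>i. (kop Q ^^ i) g x) < \<infinity>"
  shows "(\<lambda>t. (kop K ^^ t) g x) \<longlonglongrightarrow> (\<Sum>i. m ((kop Q ^^ i) g)) / D"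
proof -
  let ?S = "\<Sum>i. m ((kop Q ^^ i) g)"
  have D_fin: "D < \<infinity>" using finite_mean by (simp add: D_def)
  have zero: "w \<longlonglongrightarrow> 0" if "(\<Sum>i. w i) < \<infinity>" for w :: "nat \<Rightarrow> ennreal"
  proof -
    have wf: "w i < \<infinity>" for i using that ennreal_suminf_lessD by auto
    then have w: "w = (\<lambda>i. ennreal (enn2real (w i)))" by (auto simp: less_top)
    have "summable (\<lambda>i. enn2real (w i))"
      using that w by (intro summable_suminf_not_top) (auto simp: less_top)
    from tendsto_ennrealI[OF summable_LIMSEQ_zero[OF this]] w show ?thesis by simp
  qed
  have v_fin: "m ((kop K ^^ j) (indicator B)) < \<infinity>" for j
    using m_pow_indicator_le(1) \<mu>_fin by (rule le_less_trans)
  have 1: "(\<lambda>t. \<Sum>j<t. m ((kop Q ^^ j) g) * m ((kop K ^^ (t - Suc j)) (indicator B)))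
      \<longlonglongrightarrow> \<beta> / D * ?S"
    using D_pos \<mu>_fin
    by (intro convolution_tendsto_ennreal g\<mu> renewal_limit v_fin)
      (auto simp: ennreal_divide_eq_top_iff less_top[symmetric])
  have 2: "(\<Sum>j<t. m ((kop Q ^^ j) g) * m ((kop K ^^ (t - Suc j)) (indicator B)))
      = (\<Sum>j<t. m ((kop K ^^ j) (indicator B)) * m ((kop Q ^^ (t - Suc j)) g))" for t
    by (rule sum.reindex_bij_witness[of _ "\<lambda>i. t - Suc i" "\<lambda>i. t - Suc i"]) (auto simp: mult.commute)
  have y: "m ((kop K ^^ t) g) = m ((kop Q ^^ t) g)
      + (\<Sum>j<t. m ((kop K ^^ j) (indicator B)) * m ((kop Q ^^ (t - Suc j)) g))" for t
    by (subst nn_integral_cong[OF last_regeneration[OF g]])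
      (simp add: nn_integral_add nn_integral_sum nn_integral_multc)
  have lim_y: "(\<lambda>t. m ((kop K ^^ t) g)) \<longlonglongrightarrow> \<beta> / D * ?S"
    unfolding y using tendsto_add[OF zero[OF g\<mu>] 1[unfolded 2]] by simp
  have y_fin: "m ((kop K ^^ t) g) < \<infinity>" for t
  proof -
    have "m ((kop Q ^^ j) g) < \<infinity>" for j using g\<mu> ennreal_suminf_lessD by auto
    then show ?thesis unfolding y using v_fin by (simp add: ennreal_mult_less_top)
  qed
  \<comment> \<open>Regeneration is certain from every \<open>x\<close>; this is why the limit does
    not depend on \<open>x\<close>.\<close>
  have vis: "(\<Sum>i. (kop Q ^^ i) (indicator B) x) = 1 / \<beta>"
    by (rule Q_visits[OF zero[OF Q_vanish]])
  have l_fin: "\<beta> / D * ?S < \<infinity>"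
    using D_pos \<mu>_fin g\<mu>
    by (auto simp: less_top[symmetric] ennreal_mult_eq_top_iff ennreal_divide_eq_top_iff)
  have "(\<lambda>t. \<Sum>j<t. (kop Q ^^ j) (indicator B) x * m ((kop K ^^ (t - Suc j)) g))
      \<longlonglongrightarrow> \<beta> / D * ?S * (1 / \<beta>)"
    unfolding vis[symmetric] using \<mu>_pos \<mu>_fin
    by (intro convolution_tendsto_ennreal lim_y l_fin y_fin)
      (auto simp: vis ennreal_divide_eq_top_iff less_top[symmetric])
  from tendsto_add[OF zero[OF gx[of x]] this]
  have "(\<lambda>t. (kop K ^^ t) g x) \<longlonglongrightarrow> \<beta> / D * ?S * (1 / \<beta>)"
    by (simp add: first_regeneration[symmetric])
  also have "\<beta> / D * ?S * (1 / \<beta>) = \<beta> / \<beta> * (?S / D)"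
    by (simp add: divide_ennreal_def ac_simps)
  also have "\<dots> = ?S / D"
    using \<mu>_pos \<mu>_fin by (subst ennreal_divide_self) auto
  finally show ?thesis .
qed

end

section \<open>Chains with a one-step drift\<close>

lemma tendsto_residue_classes:
  fixes h :: "nat \<Rightarrow> 'b::topological_space"
  assumes "0 < N" and lim: "\<And>r. r < N \<Longrightarrow> (\<lambda>t. h (N * t + r)) \<longlonglongrightarrow> l"
  shows "h \<longlonglongrightarrow> l"
proof (rule topological_tendstoI)
  fix S assume S: "open S" "l \<in> S"
  have "\<exists>T. \<forall>t\<ge>T. h (N * t + r) \<in> S" if "r < N" for r
    using topological_tendstoD[OF lim[OF that] S] by (simp add: eventually_sequentially)
  then obtain T where T: "\<And>r t. r < N \<Longrightarrow> T r \<le> t \<Longrightarrow> h (N * t + r) \<in> S"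
    by metis
  have "h n \<in> S" if "N * (\<Sum>r<N. T r) \<le> n" for n
  proof -
    have r: "n mod N < N" using assms by simp
    have "T (n mod N) \<le> (\<Sum>r<N. T r)" using r by (intro member_le_sum) auto
    also have "\<dots> \<le> n div N"
      using that assms(1) by (metis div_le_mono nonzero_mult_div_cancel_left not_gr_zero)
    finally show ?thesis using T[OF r] by fastforce
  qed
  then show "\<forall>\<^sub>F n in sequentially. h n \<in> S" by (auto simp: eventually_sequentially)
qed

locale prob_kernel =
  fixes P :: "'a::topological_space \<Rightarrow> 'a measure"
  assumes P: "P \<in> borel \<rightarrow>\<^sub>M prob_algebra borel"
begin

sublocale subkernel P
  using P by unfold_locales (rule measurable_prob_algebraD)

lemma prob_space_P: "prob_space (P x)"
  using measurable_space[OF P, of x] by (simp add: space_prob_algebra)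

lemma space_P [simp]: "space (P x) = UNIV"
  using sets_eq_imp_space_eq[OF sets_k] by simp

lemma kop_const [simp]: "kop P (\<lambda>_. c) = (\<lambda>_. c)"
  using prob_space.emeasure_space_1[OF prob_space_P] by (auto simp: kop_def fun_eq_iff)

lemma pow_const [simp]: "(kop P ^^ n) (\<lambda>_. c) = (\<lambda>_. c)"
  by (induction n) auto

lemma nstep_measurable: "nstep P n \<in> borel \<rightarrow>\<^sub>M prob_algebra borel"
proof (induction n)
  case (Suc n)
  show ?case using measurable_bind_prob_space[OF Suc P] by simp
qed (simp add: return_measurable measurable_return_prob_space)

lemma sets_nstep: "sets (nstep P n x) = sets borel"
  using measurable_space[OF nstep_measurable, of x n] by (simp add: space_prob_algebra)

lemma kop_nstep: "u \<in> borel_measurable borel \<Longrightarrow> kop (nstep P n) u x = (kop P ^^ n) u x"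
proof (induction n arbitrary: u)
  case 0 then show ?case by (simp add: kop_def nn_integral_return)
next
  case (Suc n)
  have "kop (nstep P (Suc n)) u x = kop (nstep P n) (kop P u) x"
    unfolding kop_def using Suc.prems sets_nstep[of n x]
    by (simp add: nn_integral_bind[where B = borel] measurable_prob_algebraD[OF P]
      measurable_cong_sets[OF sets_nstep refl] k)
  then show ?case using Suc by (simp add: funpow_swap1 del: nstep.simps)
qed

lemma emeasure_nstep: "A \<in> sets borel \<Longrightarrow> emeasure (nstep P n x) A = (kop P ^^ n) (indicator A) x"
  using kop_nstep[of "indicator A" n x] by (simp add: kop_def sets_nstep)

lemma invariant_nn_integral:
  assumes \<pi>: "sets \<pi> = sets borel" and u: "u \<in> borel_measurable borel"
    and inv: "\<And>A. A \<in> sets borel \<Longrightarrow> (\<integral>\<^sup>+ x. emeasure (P x) A \<partial>\<pi>) = emeasure \<pi> A"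
  shows "(\<integral>\<^sup>+ x. kop P u x \<partial>\<pi>) = (\<integral>\<^sup>+ x. u x \<partial>\<pi>)"
proof -
  have space: "space \<pi> = UNIV" using sets_eq_imp_space_eq[OF \<pi>] by simp
  have P\<pi>: "P \<in> \<pi> \<rightarrow>\<^sub>M subprob_algebra borel" using k by (simp add: measurable_cong_sets[OF \<pi> refl])
  have "\<pi> \<bind> P = \<pi>"
  proof (rule measure_eqI)
    show "sets (\<pi> \<bind> P) = sets \<pi>" using \<pi> by (simp add: sets_bind[OF sets_k] space)
    fix A assume "A \<in> sets (\<pi> \<bind> P)"
    then have A: "A \<in> sets borel" by (simp add: sets_bind[OF sets_k] space)
    then show "emeasure (\<pi> \<bind> P) A = emeasure \<pi> A"
      using inv[OF A] by (simp add: emeasure_bind[OF _ P\<pi>] space)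
  qed
  then show ?thesis
    using nn_integral_bind[OF u P\<pi>] by (simp add: kop_def)
qed

lemma scaled_limit:
  fixes p f :: "'a \<Rightarrow> real"
  assumes lim: "\<And>g. g \<in> borel_measurable borel \<Longrightarrow> (\<And>y. g y \<le> ennreal (f y)) \<Longrightarrow>
      (\<lambda>n. (kop P ^^ n) g x) \<longlonglongrightarrow> (\<integral>\<^sup>+ y. g y \<partial>\<pi>)"
    and \<pi>: "sets \<pi> = sets borel" and p: "p \<in> borel_measurable borel" "integrable \<pi> p" "\<And>y. 0 \<le> p y"
    and K: "0 < K" "\<And>y. p y \<le> K * f y"
  shows "(\<lambda>n. enn2real ((kop P ^^ n) (\<lambda>y. ennreal (p y)) x)) \<longlonglongrightarrow> (\<integral>y. p y \<partial>\<pi>)"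
proof -
  note [measurable] = p(1)
  have eq: "ennreal (p y) = ennreal K * ennreal (p y / K)" for y
    using K(1) p(3)[of y] by (simp add: ennreal_mult[symmetric])
  have "(\<lambda>n. ennreal K * (kop P ^^ n) (\<lambda>y. ennreal (p y / K)) x) \<longlonglongrightarrow> ennreal K * (\<integral>\<^sup>+ y. ennreal (p y / K) \<partial>\<pi>)"
    using K by (intro ennreal_tendsto_cmult lim ennreal_leI) (simp_all add: divide_le_eq mult.commute)
  then have "(\<lambda>n. (kop P ^^ n) (\<lambda>y. ennreal (p y)) x) \<longlonglongrightarrow> ennreal (\<integral>y. p y \<partial>\<pi>)"
    using p unfolding nn_integral_eq_integral[OF p(2) AE_I2[OF p(3)], symmetric] eq
    by (simp add: pow_cmult nn_integral_cmult measurable_cong_sets[OF \<pi> refl])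
  from tendsto_enn2real[OF this] show ?thesis using p(3) by (simp add: integral_nonneg)
qed

lemma invariant_pow:
  assumes "\<And>u. u \<in> borel_measurable borel \<Longrightarrow> (\<integral>\<^sup>+ x. kop P u x \<partial>\<pi>) = (\<integral>\<^sup>+ x. u x \<partial>\<pi>)"
    and [measurable]: "u \<in> borel_measurable borel"
  shows "(\<integral>\<^sup>+ x. (kop P ^^ n) u x \<partial>\<pi>) = (\<integral>\<^sup>+ x. u x \<partial>\<pi>)"
  by (induction n) (simp_all add: assms(1))

end

locale drift_chain = prob_kernel P
  for P :: "'a::topological_space \<Rightarrow> 'a measure" +
  fixes B :: "'a set" and N :: nat and \<mu> :: "'a measure" and f W :: "'a \<Rightarrow> ennreal" and b :: ennreal
  assumes B [measurable]: "B \<in> sets borel" and B_ne: "B \<noteq> {}"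
    and sets_\<mu>: "sets \<mu> = sets borel" and \<mu>_pos: "0 < emeasure \<mu> UNIV"
    and N: "0 < N"
    and minor: "\<And>x A. x \<in> B \<Longrightarrow> A \<in> sets borel \<Longrightarrow> emeasure \<mu> A \<le> emeasure (nstep P N x) A"
    and f [measurable]: "f \<in> borel_measurable borel" and f1: "\<And>x. 1 \<le> f x"
    and W [measurable]: "W \<in> borel_measurable borel" and W_fin: "\<And>x. W x < \<infinity>"
    and b_fin: "b < \<infinity>"
    and drift: "\<And>x. kop P W x + f x \<le> W x + b * indicator B x"
    and aper: "\<And>x. \<forall>\<^sub>F n in sequentially. 0 < (kop P ^^ n) (indicator B) x"
begin

definition Q :: "'a \<Rightarrow> 'a measure"
  where "Q x = (if x \<in> B then diff_measure (nstep P N x) \<mu> else nstep P N x)"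

lemma space_\<mu>': "space \<mu> = UNIV"
  using sets_eq_imp_space_eq[OF sets_\<mu>] by simp

lemma prob_nstep: "prob_space (nstep P n x)"
  using measurable_space[OF nstep_measurable, of x n] by (simp add: space_prob_algebra)

lemma \<mu>_le_1: "emeasure \<mu> UNIV \<le> 1"
proof -
  obtain x where "x \<in> B" using B_ne by auto
  from minor[OF this, of UNIV] show ?thesis
    using prob_space.emeasure_space_1[OF prob_nstep, of N x]
    sets_eq_imp_space_eq[OF sets_nstep, of N x] by simp
qed

lemma emeasure_Q:
  assumes [measurable]: "A \<in> sets borel"
  shows "emeasure (Q x) A = emeasure (nstep P N x) A - indicator B x * emeasure \<mu> A"
proof (cases "x \<in> B")
  case True
  have "finite_measure \<mu>"
    using \<mu>_le_1 by (intro finite_measureI) (auto simp: space_\<mu>' top_unique)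
  then have "emeasure (diff_measure (nstep P N x) \<mu>) A = emeasure (nstep P N x) A - emeasure \<mu> A"
    using minor[OF True] prob_space.finite_measure[OF prob_nstep]
    by (intro emeasure_diff_measure) (auto simp: sets_nstep sets_\<mu>)
  then show ?thesis using True by (simp add: Q_def)
qed (simp add: Q_def)

lemma sets_Q: "sets (Q x) = sets borel"
  by (simp add: Q_def sets_nstep)

lemma Q_kernel: "Q \<in> borel \<rightarrow>\<^sub>M subprob_algebra borel"
proof (rule measurable_subprob_algebra)
  fix x
  interpret prob_space "nstep P N x" by (rule prob_nstep)
  have space: "space (nstep P N x) = UNIV" using sets_eq_imp_space_eq[OF sets_nstep] by simp
  have "emeasure (Q x) UNIV \<le> 1"
    using emeasure_space_1 by (auto simp: emeasure_Q space intro: diff_le_self_ennreal[THEN order_trans])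
  then show "subprob_space (Q x)"
    using sets_eq_imp_space_eq[OF sets_Q[of x]] by (intro subprob_spaceI) auto
  show "sets (Q x) = sets borel" by (rule sets_Q)
next
  fix A :: "'a set" assume [measurable]: "A \<in> sets borel"
  show "(\<lambda>x. emeasure (Q x) A) \<in> borel_measurable borel"
    by (simp add: emeasure_Q emeasure_nstep)
qed

lemmas meas_cong = sets_nstep[THEN measurable_cong_sets, OF refl] sets_Q[THEN measurable_cong_sets, OF refl]
  sets_\<mu>[THEN measurable_cong_sets, OF refl]

lemma K_split:
  assumes "u \<in> borel_measurable borel"
  shows "kop (nstep P N) u x = kop Q u x + indicator B x * (\<integral>\<^sup>+ y. u y \<partial>\<mu>)"
  using assms
proof (induction rule: borel_measurable_induct)
  case (cong f g) then show ?case by (simp add: fun_eq_iff[symmetric])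
next
  case (set A)
  have "indicator B x * emeasure \<mu> A \<le> emeasure (nstep P N x) A"
    using minor[of x A] set by (auto split: split_indicator)
  then show ?case using set
    by (simp add: kop_def sets_nstep sets_Q sets_\<mu> emeasure_Q diff_add_cancel_ennreal)
next
  case (mult u c)
  then show ?case
    by (simp add: kop_def nn_integral_cmult meas_cong distrib_left ac_simps)
next
  case (add u v)
  then show ?case
    by (simp add: kop_def nn_integral_add meas_cong distrib_left ac_simps)
next
  case (seq U)
  have inc: "incseq (\<lambda>i. kop Q (U i) x)" "incseq (\<lambda>i. indicator B x * (\<integral>\<^sup>+ y. U i y \<partial>\<mu>))"
    using seq(3) by (auto simp: incseq_def le_fun_def kop_def intro!: nn_integral_mono mult_left_mono)
  have "kop (nstep P N) (SUP i. U i) x = (SUP i. kop (nstep P N) (U i) x)"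
    using seq by (simp add: kop_def SUP_apply[abs_def] nn_integral_monotone_convergence_SUP
      meas_cong)
  also have "\<dots> = (SUP i. kop Q (U i) x + indicator B x * (\<integral>\<^sup>+ y. U i y \<partial>\<mu>))"
    using seq by simp
  also have "\<dots> = (SUP i. kop Q (U i) x) + (SUP i. indicator B x * (\<integral>\<^sup>+ y. U i y \<partial>\<mu>))"
    by (rule ennreal_SUP_add[OF inc])
  also have "\<dots> = kop Q (SUP i. U i) x + indicator B x * (\<integral>\<^sup>+ y. (SUP i. U i) y \<partial>\<mu>)"
    using seq by (simp add: kop_def SUP_apply[abs_def] nn_integral_monotone_convergence_SUP
      meas_cong SUP_mult_left_ennreal)
  finally show ?case .
qed

sublocale regenerative "nstep P N" Q B \<mu>
proof
  show "nstep P N \<in> borel \<rightarrow>\<^sub>M subprob_algebra borel"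
    by (rule measurable_prob_algebraD[OF nstep_measurable])
  show "emeasure \<mu> UNIV < \<infinity>" using \<mu>_le_1 by (auto simp: less_top[symmetric] top_unique)
  show "kop (nstep P N) (\<lambda>_. 1) = (\<lambda>_. 1)" by (simp add: fun_eq_iff kop_nstep)
qed (use Q_kernel B sets_\<mu> \<mu>_pos K_split in auto)

lemma K_pow:
  assumes [measurable]: "u \<in> borel_measurable borel"
  shows "(kop (nstep P N) ^^ t) u = (kop P ^^ (N * t)) u"
proof (induction t)
  case (Suc t)
  have "(kop (nstep P N) ^^ Suc t) u = (kop P ^^ N) ((kop P ^^ (N * t)) u)"
    unfolding funpow.simps comp_def Suc by (rule ext) (simp add: kop_nstep)
  then show ?case by (simp add: funpow_add)
qed simp

lemma drift_iterate:
  "(kop P ^^ n) W x + (\<Sum>r<n. (kop P ^^ r) f x) \<le> W x + b * (\<Sum>r<n. (kop P ^^ r) (indicator B) x)"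
  by (rule pow_drift[OF W f _ drift]) simp

text \<open>
  The sums over one period for which the skeleton \<open>P\<^sup>N\<close> inherits the drift condition, with \<open>ft\<close> in
  place of \<open>f\<close> and \<open>st\<close> in place of the indicator of \<open>B\<close>.
\<close>

definition ft where "ft x = (\<Sum>r<N. (kop P ^^ r) f x)"
definition st where "st x = (\<Sum>r<N. (kop P ^^ r) (indicator B) x)"

lemma ft_measurable [measurable]: "ft \<in> borel_measurable borel"
  unfolding ft_def[abs_def] by measurable
lemma st_measurable [measurable]: "st \<in> borel_measurable borel"
  unfolding st_def[abs_def] by measurable

lemma pow_f_le_ft: "r < N \<Longrightarrow> (kop P ^^ r) f x \<le> ft x"
  unfolding ft_def by (rule member_le_sum) auto

lemma st_le: "st x \<le> N"
  using sum_mono[of "{..<N}", OF pow_indicator_le_1] by (simp add: st_def)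

text \<open>The time from which \<open>aper\<close> guarantees positivity depends on the state. For
  some \<open>k\<close>, the set of states for which \<open>k\<close> suffices is charged by
  \<open>\<mu>\<close>, and that \<open>k\<close> works for the integral.\<close>

lemma aper_\<mu>: "\<forall>\<^sub>F n in sequentially. 0 < m ((kop P ^^ n) (indicator B))"
proof -
  define E where "E k = {x. \<forall>n\<ge>k. 0 < (kop P ^^ n) (indicator B) x}" for k :: nat
  have E [measurable]: "E k \<in> sets borel" for k unfolding E_def by measurable
  have "\<exists>k. x \<in> E k" for x
    using aper[of x] by (simp add: E_def eventually_sequentially)
  then have "(\<Union>k. E k) = UNIV" by auto
  moreover have "emeasure \<mu> (\<Union>k. E k) = 0" if "\<And>k. emeasure \<mu> (E k) = 0"
    using that E by (intro emeasure_UN_eq_0) (auto simp: sets_\<mu>)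
  ultimately have "\<exists>k. emeasure \<mu> (E k) \<noteq> 0"
    using \<mu>_pos by (metis less_irrefl)
  then obtain k where k: "emeasure \<mu> (E k) \<noteq> 0" ..
  have "0 < m ((kop P ^^ n) (indicator B))" if "k \<le> n" for n
  proof (rule ccontr)
    assume "\<not> ?thesis"
    then have "AE x in \<mu>. (kop P ^^ n) (indicator B) x = 0"
      by (simp add: nn_integral_0_iff_AE)
    then have "AE x in \<mu>. x \<notin> E k"
      by eventually_elim (use that in \<open>auto simp: E_def\<close>)
    then show False
      using k AE_iff_measurable[of "E k" \<mu> "\<lambda>x. x \<notin> E k"] by (simp add: sets_\<mu>)
  qed
  then show ?thesis by (auto simp: eventually_sequentially)
qed

text \<open>
  By aperiodicity, a visit to \<open>B\<close> at any time \<open>r < N\<close> leads back to \<open>B\<close> at the common time \<open>N * J\<close>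
  with probability bounded below.
\<close>

lemma st_le_K: obtains c J where "0 < c" "c < \<infinity>" "\<And>x. c * st x \<le> N * (kop (nstep P N) ^^ J) (indicator B) x"
proof -
  obtain n0 where n0: "\<And>n. n0 \<le> n \<Longrightarrow> 0 < m ((kop P ^^ n) (indicator B))"
    using aper_\<mu> by (auto simp: eventually_sequentially)
  \<comment> \<open>The window contains all times \<open>N * n0 + (N - r)\<close> with
    \<open>r < N\<close> that are used below, so one constant serves every residue
    \<open>r\<close>.\<close>
  define c where "c = Min ((\<lambda>n. m ((kop P ^^ n) (indicator B))) ` {n0..N*n0+N})"
  have ci: "c \<le> m ((kop P ^^ n) (indicator B))" if "n \<in> {n0..N*n0+N}" for n
    unfolding c_def using that by (intro Min_le) auto
  have ne: "n0 \<in> {n0..N*n0+N}" using N by (cases N) (auto simp: trans_le_add1 trans_le_add2)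
  have "c \<in> (\<lambda>n. m ((kop P ^^ n) (indicator B))) ` {n0..N*n0+N}"
    unfolding c_def using ne by (intro Min_in) blast+
  then have c0: "0 < c" using n0 by auto
  have "m ((kop P ^^ n0) (indicator B)) \<le> m (\<lambda>_. 1)"
    by (intro nn_integral_mono pow_indicator_le_1)
  then have c1: "c < \<infinity>"
    using ci[OF ne] \<mu>_fin by (auto intro: le_less_trans)
  define J where "J = n0 + 2"
  show ?thesis
  proof (rule that[OF c0 c1])
    fix x
    have "c * (kop P ^^ r) (indicator B) x \<le> (kop P ^^ (N * J)) (indicator B) x" if "r < N" for r
    proof -
      \<comment> \<open>The lag is chosen so that \<open>r + N + n\<close> is the multiple
        \<open>N * (n0 + 2)\<close> for every \<open>r\<close>; the middle \<open>N\<close> steps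
        are spent on the minorization.\<close>
      define n where "n = N * n0 + (N - r)"
      have n: "N * J = r + (N + n)" "n \<in> {n0..N*n0+N}"
        using that by (simp add: J_def n_def algebra_simps)
          (use N in \<open>auto simp: n_def intro!: trans_le_add1\<close>)
      have "c * (kop P ^^ r) (indicator B) x = (kop P ^^ r) (\<lambda>y. c * indicator B y) x"
        by (simp add: pow_cmult)
      also have "\<dots> \<le> (kop P ^^ r) ((kop P ^^ N) ((kop P ^^ n) (indicator B))) x"
      proof (rule pow_mono)
        fix y
        have "c * indicator B y \<le> indicator B y * m ((kop P ^^ n) (indicator B))"
          using ci[OF n(2)] by (auto split: split_indicator)
        also have "\<dots> \<le> kop (nstep P N) ((kop P ^^ n) (indicator B)) y"
          by (subst split) auto
        finally show "c * indicator B y \<le> (kop P ^^ N) ((kop P ^^ n) (indicator B)) y"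
          by (simp add: kop_nstep)
      qed
      also have "\<dots> = (kop P ^^ (N * J)) (indicator B) x"
        by (simp add: n funpow_add)
      finally show ?thesis .
    qed
    from sum_mono[of "{..<N}", OF this]
    show "c * st x \<le> N * (kop (nstep P N) ^^ J) (indicator B) x"
      by (simp add: st_def sum_distrib_left K_pow)
  qed
qed

text \<open>A visit to \<open>B\<close> off the grid of multiples of \<open>N\<close> is charged to
  a visit on the grid at the end of \<open>J\<close> skeleton steps. First regeneration bounds the
  latter by visits under \<open>Q\<close>, and these number at most \<open>1 / \<beta>\<close> in
  expectation, whatever the initial state.\<close>

lemma Q_st_bounded: obtains c where "c < \<infinity>" "\<And>n x. (\<Sum>i<n. (kop Q ^^ i) st x) \<le> c"
proof -
  obtain c J where c: "0 < c" "c < \<infinity>"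
      "\<And>x. c * st x \<le> N * (kop (nstep P N) ^^ J) (indicator B) x"
    using st_le_K by blast
  have KQ: "(kop (nstep P N) ^^ J) (indicator B) x \<le> (\<Sum>j<Suc J. (kop Q ^^ j) (indicator B) x)" for x
  proof -
    have "m ((kop (nstep P N) ^^ i) (indicator B)) \<le> 1" for i
      using m_pow_indicator_le(1) \<mu>_le_1 by (rule order_trans)
    then have "(\<Sum>j<J. (kop Q ^^ j) (indicator B) x * m ((kop (nstep P N) ^^ (J - Suc j)) (indicator B)))
      \<le> (\<Sum>j<J. (kop Q ^^ j) (indicator B) x * 1)"
      by (intro sum_mono mult_left_mono) auto
    then show ?thesis by (subst first_regeneration) (auto intro: add_left_mono simp: add.commute)
  qed
  have "c * (\<Sum>i<n. (kop Q ^^ i) st x) \<le> N * (Suc J * (1 / \<beta>))" for n x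
  proof -
    have "c * (kop Q ^^ i) st x \<le> N * (\<Sum>j<Suc J. (kop Q ^^ (i + j)) (indicator B) x)" for i
    proof -
      have "c * (kop Q ^^ i) st x = (kop Q ^^ i) (\<lambda>x. c * st x) x"
        by (simp add: Q.pow_cmult)
      also have "\<dots> \<le> (kop Q ^^ i) (\<lambda>x. of_nat N * (\<Sum>j<Suc J. (kop Q ^^ j) (indicator B) x)) x"
        by (intro Q.pow_mono order_trans[OF c(3)] mult_left_mono KQ) auto
      also have "\<dots> = N * (\<Sum>j<Suc J. (kop Q ^^ (i + j)) (indicator B) x)"
        by (simp add: Q.pow_cmult Q.pow_sum funpow_add del: sum.lessThan_Suc)
      finally show ?thesis .
    qed
    then have "c * (\<Sum>i<n. (kop Q ^^ i) st x)
        \<le> (\<Sum>i<n. N * (\<Sum>j<Suc J. (kop Q ^^ (i + j)) (indicator B) x))"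
      unfolding sum_distrib_left by (intro sum_mono) (simp add: sum_distrib_left)
    also have "\<dots> = N * (\<Sum>j<Suc J. \<Sum>i<n. (kop Q ^^ (i + j)) (indicator B) x)"
      by (subst sum.swap) (simp add: sum_distrib_left del: sum.lessThan_Suc)
    also have "\<dots> \<le> N * (\<Sum>j<Suc J. 1 / \<beta>)"
      by (intro mult_left_mono sum_mono sum_shift_le Q_visits_le) simp
    finally show ?thesis by (simp del: sum.lessThan_Suc)
  qed
  then have "(\<Sum>i<n. (kop Q ^^ i) st x) * c / c \<le> N * (Suc J * (1 / \<beta>)) / c" for n x
    by (intro divide_right_mono_ennreal) (simp add: mult.commute)
  then have "(\<Sum>i<n. (kop Q ^^ i) st x) \<le> N * (Suc J * (1 / \<beta>)) / c" for n x
    using c by (subst (asm) ennreal_mult_divide_eq) auto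
  moreover have "N * (Suc J * (1 / \<beta>)) / c < \<infinity>"
    using c \<mu>_pos by (auto simp: less_top[symmetric] ennreal_mult_eq_top_iff ennreal_divide_eq_top_iff)
  ultimately show ?thesis by (rule that[rotated])
qed

lemma Q_drift: "(kop Q ^^ n) W x + (\<Sum>i<n. (kop Q ^^ i) ft x) \<le> W x + b * (\<Sum>i<n. (kop Q ^^ i) st x)"
proof (rule Q.pow_drift)
  fix x
  have "kop Q W x \<le> (kop P ^^ N) W x" using split[of W x] by (simp add: kop_nstep)
  then show "kop Q W x + ft x \<le> W x + b * st x"
    using drift_iterate[of N x] unfolding ft_def st_def by (meson add_right_mono order_trans)
qed measurable

lemma Q_ft_le: obtains c where "c < \<infinity>" "\<And>x. (\<Sum>i. (kop Q ^^ i) ft x) \<le> W x + c"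
proof -
  obtain c where c: "c < \<infinity>" "\<And>n x. (\<Sum>i<n. (kop Q ^^ i) st x) \<le> c"
    using Q_st_bounded by blast
  have "(\<Sum>i<n. (kop Q ^^ i) ft x) \<le> W x + b * c" for n x
  proof -
    have "(\<Sum>i<n. (kop Q ^^ i) ft x) \<le> W x + b * (\<Sum>i<n. (kop Q ^^ i) st x)"
      by (rule order_trans[OF _ Q_drift]) (simp add: add_increasing)
    also have "\<dots> \<le> W x + b * c"
      using c by (intro add_left_mono mult_left_mono) auto
    finally show ?thesis .
  qed
  then have "(\<Sum>i. (kop Q ^^ i) ft x) \<le> W x + b * c" for x
    by (auto simp: suminf_eq_SUP intro!: SUP_least)
  moreover have "b * c < \<infinity>" using b_fin c by (simp add: ennreal_mult_less_top)
  ultimately show ?thesis by (rule that[rotated])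
qed

text \<open>A single state of \<open>B\<close> suffices: \<open>\<mu>\<close> lies below its
  \<open>N\<close>-step distribution, under which the drift bounds the integral of
  \<open>W\<close>.\<close>

lemma \<mu>_W_fin: "m W < \<infinity>"
proof -
  obtain x where x: "x \<in> B" using B_ne by auto
  have "m W \<le> kop (nstep P N) W x" using x by (subst split) auto
  also have "\<dots> \<le> W x + b * st x"
    using drift_iterate[of N x] by (auto simp: kop_nstep st_def dest: add_le_imp_le_right intro: order_trans[rotated])
  also have "\<dots> \<le> W x + b * N" by (intro add_left_mono mult_left_mono st_le) auto
  also have "\<dots> < \<infinity>" using b_fin W_fin[of x] by (simp add: ennreal_mult_less_top of_nat_less_top)
  finally show ?thesis .
qed

lemma \<mu>_Q_ft_fin: "(\<Sum>i. m ((kop Q ^^ i) ft)) < \<infinity>"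
proof -
  obtain c where c: "c < \<infinity>" "\<And>x. (\<Sum>i. (kop Q ^^ i) ft x) \<le> W x + c"
    using Q_ft_le by blast
  have "(\<Sum>i. m ((kop Q ^^ i) ft)) = m (\<lambda>x. \<Sum>i. (kop Q ^^ i) ft x)"
    by (simp add: nn_integral_suminf)
  also have "\<dots> \<le> m (\<lambda>x. W x + c)" by (intro nn_integral_mono c)
  also have "\<dots> = m W + c * \<beta>" by (simp add: nn_integral_add)
  also have "\<dots> < \<infinity>" using \<mu>_W_fin c \<mu>_fin by (simp add: ennreal_mult_less_top)
  finally show ?thesis .
qed

lemma Q_ft_fin: "(\<Sum>i. (kop Q ^^ i) ft x) < \<infinity>"
proof -
  obtain c where c: "c < \<infinity>" "\<And>x. (\<Sum>i. (kop Q ^^ i) ft x) \<le> W x + c"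
    using Q_ft_le by blast
  then show ?thesis using W_fin[of x] by (auto intro: le_less_trans[OF c(2)])
qed

lemma one_le_ft: "1 \<le> ft x"
  using pow_f_le_ft[OF N, of x] f1[of x] by simp

lemma Q_dominated:
  assumes "\<And>x. g x \<le> ft x"
  shows "(\<Sum>i. m ((kop Q ^^ i) g)) < \<infinity>" "(\<Sum>i. (kop Q ^^ i) g x) < \<infinity>"
proof -
  show "(\<Sum>i. m ((kop Q ^^ i) g)) < \<infinity>"
    using assms by (intro le_less_trans[OF _ \<mu>_Q_ft_fin] suminf_le nn_integral_mono Q.pow_mono) auto
  show "(\<Sum>i. (kop Q ^^ i) g x) < \<infinity>"
    using assms by (intro le_less_trans[OF _ Q_ft_fin[of x]] suminf_le Q.pow_mono) auto
qed

sublocale ergodic_regenerative "nstep P N" Q B \<mu>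
proof
  show "(\<Sum>i. m ((kop Q ^^ i) (\<lambda>_. 1))) < \<infinity>" "(\<Sum>i. (kop Q ^^ i) (\<lambda>_. 1) x) < \<infinity>" for x
    by (rule Q_dominated[OF one_le_ft])+
  show "\<forall>\<^sub>F n in sequentially. 0 < m ((kop (nstep P N) ^^ n) (indicator B))"
    unfolding K_pow[OF borel_measurable_indicator[OF B]]
    using eventually_compose_filterlim[OF aper_\<mu> mult_nat_left_at_top[OF N]] .
qed

text \<open>\<open>\<pi>\<close> is the normalised occupation measure of one regeneration cycle of
  the skeleton. Its invariance under \<open>P\<close> is not computed from this formula but read off
  from the convergence.\<close>

theorem ergodic:
  obtains \<pi> where "prob_space \<pi>" "sets \<pi> = sets borel"
    "\<And>u. u \<in> borel_measurable borel \<Longrightarrow> (\<integral>\<^sup>+ x. kop P u x \<partial>\<pi>) = (\<integral>\<^sup>+ x. u x \<partial>\<pi>)"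
    "(\<integral>\<^sup>+ x. f x \<partial>\<pi>) < \<infinity>"
    "\<And>g x. g \<in> borel_measurable borel \<Longrightarrow> \<forall>x. g x \<le> f x \<Longrightarrow>
      (\<lambda>n. (kop P ^^ n) g x) \<longlonglongrightarrow> (\<integral>\<^sup>+ x. g x \<partial>\<pi>)"
proof -
  define \<Lambda> where "\<Lambda> u = (\<Sum>i. m ((kop Q ^^ i) u)) / D" for u
  have D: "0 < D" "D < \<infinity>" using D_pos finite_mean by (auto simp: D_def)
  obtain \<pi> where \<pi>: "sets \<pi> = sets borel" and \<Lambda>: "\<And>u. u \<in> borel_measurable borel \<Longrightarrow> (\<integral>\<^sup>+ x. u x \<partial>\<pi>) = \<Lambda> u"
  proof (rule functional_measure[of borel \<Lambda>])
    show "\<Lambda> (\<lambda>x. u x + v x) = \<Lambda> u + \<Lambda> v"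
      if [measurable]: "u \<in> borel_measurable borel" "v \<in> borel_measurable borel" for u v
      by (simp add: \<Lambda>_def Q.pow_add nn_integral_add suminf_add[symmetric] divide_ennreal_def distrib_right)
    show "\<Lambda> (\<lambda>x. c * u x) = c * \<Lambda> u" if [measurable]: "u \<in> borel_measurable borel" for c u
      by (simp add: \<Lambda>_def Q.pow_cmult nn_integral_cmult divide_ennreal_def mult.assoc)
    show "\<Lambda> (\<lambda>x. SUP i. U i x) = (SUP i. \<Lambda> (U i))"
      if U: "\<And>i. U i \<in> borel_measurable borel" "incseq U" for U :: "nat \<Rightarrow> 'a \<Rightarrow> ennreal"
    proof -
      have inc: "incseq (\<lambda>i. (kop Q ^^ n) (U i))" for n
        using U(2) by (auto simp: incseq_def le_fun_def intro!: Q.pow_mono)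
      have "m (\<lambda>x. SUP i. (kop Q ^^ n) (U i) x) = (SUP i. m ((kop Q ^^ n) (U i)))" for n
        using U(1) by (intro nn_integral_monotone_convergence_SUP inc) simp
      moreover have "(\<Sum>n. SUP i. m ((kop Q ^^ n) (U i))) = (SUP i. \<Sum>n. m ((kop Q ^^ n) (U i)))"
        using inc by (intro ennreal_suminf_SUP_eq) (auto simp: incseq_def le_fun_def intro!: nn_integral_mono)
      ultimately show ?thesis
        by (simp add: \<Lambda>_def Q.pow_SUP[OF U] divide_ennreal_def SUP_mult_right_ennreal)
    qed
    show "\<Lambda> u = \<Lambda> v" if "\<And>x. x \<in> space borel \<Longrightarrow> u x = v x" for u v
      using that by (auto intro!: arg_cong[where f = \<Lambda>])
  qed auto
  have meas\<pi> [simp]: "u \<in> borel_measurable \<pi> \<longleftrightarrow> u \<in> borel_measurable borel" for u :: "'a \<Rightarrow> ennreal"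
    by (rule measurable_cong_sets[OF \<pi> refl, THEN arg_cong])
  have space: "space \<pi> = UNIV" using sets_eq_imp_space_eq[OF \<pi>] by simp
  have prob: "prob_space \<pi>"
  proof
    have "emeasure \<pi> (space \<pi>) = \<Lambda> (\<lambda>_. 1)" by (subst \<Lambda>[symmetric]) auto
    then show "emeasure \<pi> (space \<pi>) = 1" using D by (simp add: \<Lambda>_def D_def[symmetric])
  qed
  have limK: "(\<lambda>t. (kop P ^^ (N * t)) g x) \<longlonglongrightarrow> (\<integral>\<^sup>+ x. g x \<partial>\<pi>)"
    if g [measurable]: "g \<in> borel_measurable borel" and le: "\<And>x. g x \<le> ft x" for g x
    using regenerative_limit[OF g Q_dominated[OF le]] by (simp add: K_pow \<Lambda> \<Lambda>_def)
  have inv1: "(\<integral>\<^sup>+ x. kop P (indicator A) x \<partial>\<pi>) = emeasure \<pi> A" if [measurable]: "A \<in> sets borel" for A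
  proof -
    \<comment> \<open>Averaging the convergence over the first step from an arbitrary
      \<open>x\<close> gives the limit \<open>\<pi>(A)\<close>; applying the convergence to
      \<open>kop P (indicator A)\<close> gives the other integral. Both are limits of the same
      sequence.\<close>
    obtain x :: 'a where True by auto
    have "(\<lambda>t. \<integral>\<^sup>+ y. (kop P ^^ (N * t)) (indicator A) y \<partial>P x) \<longlonglongrightarrow> (\<integral>\<^sup>+ y. (\<integral>\<^sup>+ x. indicator A x \<partial>\<pi>) \<partial>P x)"
    proof (rule nn_integral_dominated_convergence[where w = "\<lambda>_. 1"])
      show "AE y in P x. (kop P ^^ (N * t)) (indicator A) y \<le> 1" for t
        by (intro AE_I2 pow_indicator_le_1)
      show "AE y in P x. (\<lambda>t. (kop P ^^ (N * t)) (indicator A) y) \<longlonglongrightarrow> (\<integral>\<^sup>+ x. indicator A x \<partial>\<pi>)"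
        using order_trans[OF indicator_le_1_ennreal one_le_ft] by (intro AE_I2 limK) auto
    qed (auto simp: prob_space.emeasure_space_1[OF prob_space_P, simplified])
    then have "(\<lambda>t. (kop P ^^ (N * t)) (kop P (indicator A)) x) \<longlonglongrightarrow> emeasure \<pi> A"
      using prob_space.emeasure_space_1[OF prob_space_P, of x] \<pi>
      by (simp add: funpow_swap1[symmetric] kop_def[symmetric])
    moreover have "(\<lambda>t. (kop P ^^ (N * t)) (kop P (indicator A)) x) \<longlonglongrightarrow> (\<integral>\<^sup>+ x. kop P (indicator A) x \<partial>\<pi>)"
      using kop_mono[OF indicator_le_1_ennreal] by (intro limK order_trans[OF _ one_le_ft]) auto
    ultimately show ?thesis by (rule LIMSEQ_unique[rotated])
  qed
  have inv: "(\<integral>\<^sup>+ x. kop P u x \<partial>\<pi>) = (\<integral>\<^sup>+ x. u x \<partial>\<pi>)" if "u \<in> borel_measurable borel" for u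
    using inv1 by (intro invariant_nn_integral[OF \<pi> that]) (simp add: kop_def sets_k)
  show ?thesis
  proof (rule that[OF prob \<pi> inv])
    have "(\<Sum>i. m ((kop Q ^^ i) f)) < \<infinity>"
      using pow_f_le_ft[OF N] by (intro Q_dominated) simp
    then show "(\<integral>\<^sup>+ x. f x \<partial>\<pi>) < \<infinity>"
      using D by (auto simp: \<Lambda> \<Lambda>_def less_top[symmetric] ennreal_divide_eq_top_iff)
    show "(\<lambda>n. (kop P ^^ n) g x) \<longlonglongrightarrow> (\<integral>\<^sup>+ x. g x \<partial>\<pi>)"
      if [measurable]: "g \<in> borel_measurable borel" and le': "\<forall>x. g x \<le> f x" for g x
    proof (rule tendsto_residue_classes[OF N])
      have le: "g x \<le> f x" for x using le' by blast
      fix r assume r: "r < N"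
      have "(kop P ^^ r) g x \<le> ft x" for x
        by (rule order_trans[OF pow_mono[OF le] pow_f_le_ft[OF r]])
      from limK[OF _ this]
      show "(\<lambda>t. (kop P ^^ (N * t + r)) g x) \<longlonglongrightarrow> (\<integral>\<^sup>+ x. g x \<partial>\<pi>)"
        by (simp add: funpow_add invariant_pow[OF inv])
    qed
  qed auto
qed

end

section \<open>The path law of a Markov chain\<close>

lemma sets_stream_space_borel:
  "sets (stream_space (borel :: 'a::topological_space measure)) =
    sigma_sets UNIV (scylinder UNIV ` lists (sets borel))" (is "_ = sigma_sets UNIV ?G")
proof
  have "sets (stream_space borel) \<subseteq> sets (sigma UNIV ?G)"
  proof (rule sets_stream_space_in_sets)
    fix i
    show "(\<lambda>x. x !! i) \<in> measurable (sigma UNIV ?G) (borel :: 'a measure)"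
    proof (rule measurableI)
      fix A :: "'a set" assume A: "A \<in> sets borel"
      have "(\<lambda>x. x !! i) -` A = scylinder UNIV (replicate i UNIV @ [A])"
        by (induction i) auto
      also have "\<dots> \<in> sets (sigma UNIV ?G)"
        using A by (auto intro!: sigma_sets.Basic imageI)
      finally show "(\<lambda>x. x !! i) -` A \<inter> space (sigma UNIV ?G) \<in> sets (sigma UNIV ?G)" by simp
    qed auto
  qed simp
  then show "sets (stream_space borel) \<subseteq> sigma_sets UNIV ?G" by simp
  have "scylinder UNIV As \<in> sets (stream_space (borel :: 'a measure))" if "As \<in> lists (sets borel)" for As
    using sets_scylinder[of As "borel :: 'a measure"] that by (simp add: in_lists_conv_set)
  then show "sigma_sets UNIV ?G \<subseteq> sets (stream_space borel)"
    using sets.sigma_sets_subset[of ?G "stream_space borel"] by (auto simp: space_stream_space)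
qed

lemma Int_stable_scylinder: "Int_stable (scylinder UNIV ` lists (sets (borel :: 'a::topological_space measure)))"
proof -
  have "scylinder UNIV As \<inter> scylinder UNIV Bs \<in> scylinder UNIV ` lists (sets (borel :: 'a measure))"
    if "As \<in> lists (sets borel)" "Bs \<in> lists (sets borel)" for As Bs :: "'a set list"
    using that
  proof (induction As Bs rule: list_induct2')
    case 1
    show ?case by (intro image_eqI[of _ _ "[]"]) auto
  next
    case (2 A As)
    then show ?case by (intro image_eqI[of _ _ "A # As"]) auto
  next
    case (3 B Bs)
    then show ?case by (intro image_eqI[of _ _ "B # Bs"]) auto
  next
    case (4 A As B Bs)
    then obtain Cs where "Cs \<in> lists (sets borel)" "scylinder UNIV As \<inter> scylinder UNIV Bs = scylinder UNIV Cs"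
      by auto
    with 4 show ?case by (intro image_eqI[of _ _ "(A \<inter> B) # Cs"]) auto
  qed
  then show ?thesis by (auto simp: Int_stable_def)
qed

text \<open>What the law of large numbers needs to know of the chain: laws on the path space that
  depend measurably on the starting point and satisfy the Markov property at time 1. The filtration
  and the original space are left behind.\<close>

locale path_law = prob_kernel P
  for P :: "'a::polish_space \<Rightarrow> 'a measure" +
  fixes law :: "'a \<Rightarrow> 'a stream measure"
  assumes law_measurable: "law \<in> borel \<rightarrow>\<^sub>M prob_algebra (stream_space borel)"
    and law_shift: "\<And>\<Phi> x. \<Phi> \<in> borel_measurable (stream_space borel) \<Longrightarrow>
      (\<integral>\<^sup>+ w. \<Phi> w \<partial>law x) = kop P (\<lambda>y. \<integral>\<^sup>+ w. \<Phi> (x ## w) \<partial>law y) x"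

section \<open>From conditional probabilities to taboo probabilities and path laws\<close>

context markov_chain
begin

sublocale prob_kernel P by unfold_locales (rule kernel)

lemma space_Pr [simp]: "space (Pr x) = space (F \<infinity>)"
  using sets_eq_imp_space_eq[OF sets_Pr] .

lemma space_enat: "space (F (enat t)) = space (F \<infinity>)"
  by (rule space_F)

lemma measurable_F_Pr: "g \<in> F (enat t) \<rightarrow>\<^sub>M N \<Longrightarrow> g \<in> Pr x \<rightarrow>\<^sub>M N"
  using sets_F_mono[of "enat t" \<infinity>] by (auto simp: measurable_def space_enat sets_Pr subset_iff)

lemma X_Pr [measurable]: "X t \<in> Pr x \<rightarrow>\<^sub>M borel"
  by (rule measurable_F_Pr[OF adapted])

lemma X_F: "s \<le> t \<Longrightarrow> X s \<in> F (enat t) \<rightarrow>\<^sub>M borel"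
  using adapted[of s] sets_F_mono[of "enat s" "enat t"] by (auto simp: measurable_def space_enat subset_iff)

lemma sets_F_Pr: "A \<in> sets (F (enat t)) \<Longrightarrow> A \<in> sets (Pr x)"
  using sets_F_mono[of "enat t" \<infinity>] by (auto simp: sets_Pr)

text \<open>Integrating over an event of \<open>F (enat t)\<close> turns the almost sure statement
  \<open>markov\<close> into an exact identity, the form in which the Markov property is used from
  here on.\<close>

lemma one_step_indicator:
  assumes A: "A \<in> sets (F (enat t))" and B [measurable]: "B \<in> sets borel"
  shows "(\<integral>\<^sup>+ \<omega>. indicator A \<omega> * indicator B (X (Suc t) \<omega>) \<partial>Pr x)
    = (\<integral>\<^sup>+ \<omega>. indicator A \<omega> * kop P (indicator B) (X t \<omega>) \<partial>Pr x)"
proof -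
  note [measurable] = sets_F_Pr[OF A]
  interpret prob_space "Pr x" by (rule prob_Pr)
  have sub: "subalgebra (Pr x) (F (enat t))"
    using sets_F_mono[of "enat t" \<infinity>] by (auto simp: subalgebra_def space_enat sets_Pr)
  interpret finite_measure_subalgebra "Pr x" "F (enat t)"
    by unfold_locales (rule sub)
  have int: "integrable (Pr x) (\<lambda>\<omega>. indicator B (X (Suc t) \<omega>) :: real)"
    by (rule integrable_const_bound[of _ 1]) (auto split: split_indicator)
  have P1: "measure (P y) B \<le> 1" for y
    using prob_space.prob_le_1[OF prob_space_P] .
  have "(\<lambda>y. measure (P y) B) \<in> borel_measurable borel"
    by (rule measurable_compose[OF k measurable_measure_subprob_algebra[OF B]])
  then have [measurable]: "(\<lambda>\<omega>. measure (P (X t \<omega>)) B) \<in> borel_measurable (Pr x)"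
    by measurable
  have "(\<integral>\<^sup>+ \<omega>. indicator A \<omega> * indicator B (X (Suc t) \<omega>) \<partial>Pr x)
      = (\<integral>\<^sup>+ \<omega>. ennreal (indicator A \<omega> * indicator B (X (Suc t) \<omega>)) \<partial>Pr x)"
    by (auto intro!: nn_integral_cong split: split_indicator)
  also have "\<dots> = ennreal (\<integral>\<omega>. indicator A \<omega> * indicator B (X (Suc t) \<omega>) \<partial>Pr x)"
    by (intro nn_integral_eq_integral integrable_const_bound[of _ 1]) (auto split: split_indicator)
  also have "(\<integral>\<omega>. indicator A \<omega> * indicator B (X (Suc t) \<omega>) \<partial>Pr x)
      = (\<integral>\<omega>. indicator A \<omega> * real_cond_exp (Pr x) (F (enat t)) (\<lambda>\<omega>. indicator B (X (Suc t) \<omega>)) \<omega> \<partial>Pr x)"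
    using real_cond_exp_intA[OF int A] by (simp add: set_lebesgue_integral_def)
  also have "\<dots> = (\<integral>\<omega>. indicator A \<omega> * measure (P (X t \<omega>)) B \<partial>Pr x)"
  proof (rule integral_cong_AE)
    show "AE \<omega> in Pr x. indicator A \<omega> * real_cond_exp (Pr x) (F (enat t)) (\<lambda>\<omega>. indicator B (X (Suc t) \<omega>)) \<omega>
        = indicator A \<omega> * measure (P (X t \<omega>)) B"
      using markov[OF B, of x t] by eventually_elim simp
  qed measurable
  also have "ennreal \<dots> = (\<integral>\<^sup>+ \<omega>. ennreal (indicator A \<omega> * measure (P (X t \<omega>)) B) \<partial>Pr x)"
    using P1 by (intro nn_integral_eq_integral[symmetric] integrable_const_bound[of _ 1])
      (auto split: split_indicator)
  also have "\<dots> = (\<integral>\<^sup>+ \<omega>. indicator A \<omega> * kop P (indicator B) (X t \<omega>) \<partial>Pr x)"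
    by (auto intro!: nn_integral_cong split: split_indicator
      simp: kop_def sets_k finite_measure.emeasure_eq_measure[OF prob_space.finite_measure[OF prob_space_P]])
  finally show ?thesis .
qed

lemma one_step:
  assumes A: "A \<in> sets (F (enat t))" and u: "u \<in> borel_measurable borel"
  shows "(\<integral>\<^sup>+ \<omega>. indicator A \<omega> * u (X (Suc t) \<omega>) \<partial>Pr x) = (\<integral>\<^sup>+ \<omega>. indicator A \<omega> * kop P u (X t \<omega>) \<partial>Pr x)"
proof -
  note [measurable] = sets_F_Pr[OF A]
  show ?thesis
    using u
  proof (induction rule: borel_measurable_induct)
    case (set B)
    then show ?case by (rule one_step_indicator[OF A])
  next
    case (cong f g)
    then have "f = g" by (simp add: fun_eq_iff)
    with cong show ?case by simp
  next
    case (mult u c)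
    note [measurable] = mult(2)
    have "kop P (\<lambda>x. c * u x) = (\<lambda>x. c * kop P u x)"
      by (simp add: kop_def fun_eq_iff nn_integral_cmult)
    then show ?case using mult(4)
      by (simp add: mult.left_commute[of _ c] nn_integral_cmult)
  next
    case (add u v)
    note [measurable] = add(1,3)
    have "kop P (\<lambda>x. v x + u x) = (\<lambda>x. kop P v x + kop P u x)"
      by (simp add: kop_def fun_eq_iff nn_integral_add)
    then show ?case using add by (simp add: distrib_left nn_integral_add)
  next
    case (seq U)
    note [measurable] = seq(1)
    have U: "kop P (\<lambda>x. SUP i. U i x) = (\<lambda>x. SUP i. kop P (U i) x)"
      using pow_SUP[of U 1] seq(1,3) by simp
    have "(\<integral>\<^sup>+ \<omega>. indicator A \<omega> * (SUP i. U i (X (Suc t) \<omega>)) \<partial>Pr x)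
        = (SUP i. \<integral>\<^sup>+ \<omega>. indicator A \<omega> * U i (X (Suc t) \<omega>) \<partial>Pr x)"
      unfolding SUP_mult_left_ennreal using seq(3)
      by (intro nn_integral_monotone_convergence_SUP) (auto simp: incseq_def le_fun_def intro!: mult_left_mono)
    also have "\<dots> = (SUP i. \<integral>\<^sup>+ \<omega>. indicator A \<omega> * kop P (U i) (X t \<omega>) \<partial>Pr x)"
      using seq by simp
    also have "\<dots> = (\<integral>\<^sup>+ \<omega>. indicator A \<omega> * (SUP i. kop P (U i) (X t \<omega>)) \<partial>Pr x)"
      unfolding SUP_mult_left_ennreal using seq(3)
      by (intro nn_integral_monotone_convergence_SUP[symmetric])
        (auto simp: incseq_def le_fun_def intro!: mult_left_mono kop_mono)
    finally show ?case by (simp add: SUP_apply[abs_def] U)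
  qed
qed

text \<open>Time 0 is exempt, as in \<open>return_time\<close>: a path that starts in
  \<open>D\<close> is excluded only when it comes back. Accordingly \<open>taboo_op\<close> kills on
  arrival and never tests the starting state.\<close>

definition taboo :: "'a set \<Rightarrow> nat \<Rightarrow> 'w set"
  where "taboo D n = {\<omega> \<in> space (F \<infinity>). \<forall>j\<in>{1..n}. X j \<omega> \<notin> D}"

lemma taboo_F:
  assumes [measurable]: "D \<in> sets borel"
  shows "taboo D n \<in> sets (F (enat n))"
proof -
  have "taboo D n = (\<Inter>j\<in>{1..n}. {\<omega> \<in> space (F (enat n)). X j \<omega> \<notin> D}) \<inter> space (F (enat n))"
    by (auto simp: taboo_def space_enat)
  moreover have "{\<omega> \<in> space (F (enat n)). X j \<omega> \<notin> D} \<in> sets (F (enat n))" if "j \<in> {1..n}" for j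
  proof -
    have [measurable]: "X j \<in> F (enat n) \<rightarrow>\<^sub>M borel" using that by (intro X_F) auto
    show ?thesis by measurable
  qed
  ultimately show ?thesis
    by (cases "n = 0") (auto intro!: sets.Int sets.finite_INT)
qed

definition taboo_op :: "'a set \<Rightarrow> ('a \<Rightarrow> ennreal) \<Rightarrow> 'a \<Rightarrow> ennreal"
  where "taboo_op D u = kop P (\<lambda>y. indicator (- D) y * u y)"

lemma taboo_op_measurable [measurable]:
  "D \<in> sets borel \<Longrightarrow> u \<in> borel_measurable borel \<Longrightarrow> taboo_op D u \<in> borel_measurable borel"
  unfolding taboo_op_def by (intro kop_measurable borel_measurable_times_ennreal borel_measurable_indicator) auto

lemma taboo_pow_measurable [measurable]:
  "D \<in> sets borel \<Longrightarrow> u \<in> borel_measurable borel \<Longrightarrow> (taboo_op D ^^ n) u \<in> borel_measurable borel"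
  by (induction n) auto

lemma nn_integral_taboo:
  assumes D [measurable]: "D \<in> sets borel" and u: "u \<in> borel_measurable borel"
  shows "(\<integral>\<^sup>+ \<omega>. indicator (taboo D n) \<omega> * u (X n \<omega>) \<partial>Pr x) = (taboo_op D ^^ n) u x"
  using u
proof (induction n arbitrary: u)
  case 0
  interpret prob_space "Pr x" by (rule prob_Pr)
  have "(\<integral>\<^sup>+ \<omega>. indicator (taboo D 0) \<omega> * u (X 0 \<omega>) \<partial>Pr x) = (\<integral>\<^sup>+ \<omega>. u x \<partial>Pr x)"
  proof (rule nn_integral_cong_AE)
    show "AE \<omega> in Pr x. indicator (taboo D 0) \<omega> * u (X 0 \<omega>) = u x"
      using initial[of x] AE_space[of "Pr x"] by eventually_elim (simp add: taboo_def)
  qed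
  then show ?case using emeasure_space_1 by simp
next
  case (Suc n)
  note [measurable] = Suc.prems
  have "(\<integral>\<^sup>+ \<omega>. indicator (taboo D (Suc n)) \<omega> * u (X (Suc n) \<omega>) \<partial>Pr x)
      = (\<integral>\<^sup>+ \<omega>. indicator (taboo D n) \<omega> * (indicator (- D) (X (Suc n) \<omega>) * u (X (Suc n) \<omega>)) \<partial>Pr x)"
    by (intro nn_integral_cong) (auto simp: taboo_def atLeastAtMostSuc_conv split: split_indicator)
  also have "\<dots> = (\<integral>\<^sup>+ \<omega>. indicator (taboo D n) \<omega> * taboo_op D u (X n \<omega>) \<partial>Pr x)"
    unfolding taboo_op_def by (rule one_step[OF taboo_F[OF D]]) measurable
  also have "\<dots> = (taboo_op D ^^ n) (taboo_op D u) x"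
    by (rule Suc.IH) measurable
  finally show ?case by (simp add: funpow_swap1)
qed

lemma taboo_op_empty: "taboo_op {} = kop P"
  by (simp add: taboo_op_def fun_eq_iff)

lemma nn_integral_X:
  assumes "u \<in> borel_measurable borel"
  shows "(\<integral>\<^sup>+ \<omega>. u (X n \<omega>) \<partial>Pr x) = (kop P ^^ n) u x"
proof -
  have "(\<integral>\<^sup>+ \<omega>. indicator (taboo {} n) \<omega> * u (X n \<omega>) \<partial>Pr x) = (\<integral>\<^sup>+ \<omega>. u (X n \<omega>) \<partial>Pr x)"
    by (intro nn_integral_cong) (simp add: taboo_def)
  then show ?thesis using nn_integral_taboo[OF sets.empty_sets assms, where n = n and x = x] by (simp add: taboo_op_empty)
qed

definition path :: "nat \<Rightarrow> 'w \<Rightarrow> 'a stream"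
  where "path t \<omega> = to_stream (\<lambda>n. X (t + n) \<omega>)"

lemma snth_path [simp]: "path t \<omega> !! n = X (t + n) \<omega>"
  by (simp add: path_def to_stream_def)

lemma path_Suc: "stl (path t \<omega>) = path (Suc t) \<omega>" "shd (path t \<omega>) = X t \<omega>"
proof -
  have "path t \<omega> = X t \<omega> ## path (Suc t) \<omega>"
    unfolding path_def to_stream_nat_case[symmetric]
    by (rule arg_cong[where f = to_stream]) (auto simp: fun_eq_iff split: nat.split)
  then show "stl (path t \<omega>) = path (Suc t) \<omega>" "shd (path t \<omega>) = X t \<omega>" by simp_all
qed

lemma path_measurable [measurable]: "path t \<in> Pr x \<rightarrow>\<^sub>M stream_space borel"
  by (rule measurable_stream_space2) simp

text \<open>The finite-dimensional distributions as functions of the starting point, which makes the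
  measurability of \<open>law\<close> visible.\<close>

primrec cyl :: "'a set list \<Rightarrow> 'a \<Rightarrow> ennreal" where
  "cyl [] = (\<lambda>x. 1)"
| "cyl (A # As) = (\<lambda>x. indicator A x * kop P (cyl As) x)"

lemma cyl_measurable [measurable]: "As \<in> lists (sets borel) \<Longrightarrow> cyl As \<in> borel_measurable borel"
  by (induction As) auto

lemma nn_integral_cyl:
  assumes "A \<in> sets (F (enat t))" "As \<in> lists (sets borel)"
  shows "(\<integral>\<^sup>+ \<omega>. indicator A \<omega> * indicator (scylinder UNIV As) (path t \<omega>) \<partial>Pr x)
    = (\<integral>\<^sup>+ \<omega>. indicator A \<omega> * cyl As (X t \<omega>) \<partial>Pr x)"
  using assms
proof (induction As arbitrary: A t)
  case (Cons B Bs)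
  then have [measurable]: "B \<in> sets borel" "Bs \<in> lists (sets borel)" by auto
  \<comment> \<open>The constraint on the current coordinate is absorbed into the event, which stays
    in \<open>F (enat t)\<close>; this is why the induction runs over all events and times.\<close>
  define A' where "A' = {\<omega> \<in> space (F (enat t)). \<omega> \<in> A \<and> X t \<omega> \<in> B}"
  have [measurable]: "A \<in> sets (F (enat t))" by fact
  have A': "A' \<in> sets (F (enat t))"
    unfolding A'_def using adapted[of t] by measurable
  have "A' \<in> sets (F (enat (Suc t)))"
    using A' sets_F_mono[of "enat t" "enat (Suc t)"] by auto
  have ind: "indicator A' \<omega> = (indicator A \<omega> * indicator B (X t \<omega>) :: ennreal)" if "\<omega> \<in> space (Pr x)" for \<omega>
    using that by (auto simp: A'_def space_enat split: split_indicator)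
  have "(\<integral>\<^sup>+ \<omega>. indicator A \<omega> * indicator (scylinder UNIV (B # Bs)) (path t \<omega>) \<partial>Pr x)
      = (\<integral>\<^sup>+ \<omega>. indicator A' \<omega> * indicator (scylinder UNIV Bs) (path (Suc t) \<omega>) \<partial>Pr x)"
    by (intro nn_integral_cong) (auto simp: ind path_Suc split: split_indicator)
  also have "\<dots> = (\<integral>\<^sup>+ \<omega>. indicator A' \<omega> * cyl Bs (X (Suc t) \<omega>) \<partial>Pr x)"
    by (rule Cons.IH) fact+
  also have "\<dots> = (\<integral>\<^sup>+ \<omega>. indicator A' \<omega> * kop P (cyl Bs) (X t \<omega>) \<partial>Pr x)"
    by (rule one_step[OF A']) measurable
  also have "\<dots> = (\<integral>\<^sup>+ \<omega>. indicator A \<omega> * cyl (B # Bs) (X t \<omega>) \<partial>Pr x)"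
    by (intro nn_integral_cong) (auto simp: ind ac_simps)
  finally show ?case .
qed simp

definition law :: "'a \<Rightarrow> 'a stream measure"
  where "law x = distr (Pr x) (stream_space borel) (path 0)"

lemma prob_space_law: "prob_space (law x)"
  unfolding law_def by (rule prob_space.prob_space_distr[OF prob_Pr]) measurable

lemma sets_law [simp]: "sets (law x) = sets (stream_space borel)"
  by (simp add: law_def)

lemma emeasure_law_scylinder:
  assumes "As \<in> lists (sets borel)"
  shows "emeasure (law x) (scylinder UNIV As) = cyl As x"
proof -
  interpret prob_space "Pr x" by (rule prob_Pr)
  have S: "scylinder UNIV As \<in> sets (stream_space (borel :: 'a measure))"
    using sets_scylinder[of As "borel :: 'a measure"] assms by (simp add: in_lists_conv_set)
  have "emeasure (law x) (scylinder UNIV As) = (\<integral>\<^sup>+ w. indicator (scylinder UNIV As) w \<partial>law x)"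
    using S by simp
  also have "\<dots> = (\<integral>\<^sup>+ \<omega>. indicator (space (F (enat 0))) \<omega> * indicator (scylinder UNIV As) (path 0 \<omega>) \<partial>Pr x)"
    unfolding law_def using S
    by (subst nn_integral_distr) (auto intro!: nn_integral_cong simp: space_enat)
  also have "\<dots> = (\<integral>\<^sup>+ \<omega>. indicator (space (F (enat 0))) \<omega> * cyl As (X 0 \<omega>) \<partial>Pr x)"
    by (rule nn_integral_cyl[OF sets.top assms])
  also have "\<dots> = (\<integral>\<^sup>+ \<omega>. cyl As x \<partial>Pr x)"
  proof (rule nn_integral_cong_AE)
    show "AE \<omega> in Pr x. indicator (space (F (enat 0))) \<omega> * cyl As (X 0 \<omega>) = cyl As x"
      using initial[of x] AE_space[of "Pr x"] by eventually_elim (simp add: space_enat)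
  qed
  finally show ?thesis using emeasure_space_1 by simp
qed

lemma law_kernel: "law \<in> borel \<rightarrow>\<^sub>M prob_algebra (stream_space borel)"
proof (rule measurable_prob_algebra_generated[OF sets_stream_space_borel Int_stable_scylinder])
  fix A :: "'a stream set" assume "A \<in> scylinder UNIV ` lists (sets borel)"
  then obtain As where "A = scylinder UNIV As" "As \<in> lists (sets borel)" by blast
  then show "(\<lambda>a. emeasure (law a) A) \<in> borel_measurable borel"
    by (simp only: emeasure_law_scylinder cyl_measurable)
qed (auto simp: prob_space_law)

sublocale path_law P law
proof
  show "law \<in> borel \<rightarrow>\<^sub>M prob_algebra (stream_space borel)" by (rule law_kernel)
  fix \<Phi> :: "'a stream \<Rightarrow> ennreal" and x
  assume \<Phi> [measurable]: "\<Phi> \<in> borel_measurable (stream_space borel)"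
  let ?S = "stream_space (borel :: 'a measure)"
  have "(\<lambda>y. distr (law y) ?S (\<lambda>w. x ## w)) \<in> borel \<rightarrow>\<^sub>M prob_algebra ?S"
    by (rule measurable_compose[OF law_kernel measurable_distr_prob_space]) measurable
  then have step: "(\<lambda>y. distr (law y) ?S (\<lambda>w. x ## w)) \<in> P x \<rightarrow>\<^sub>M prob_algebra ?S"
    by (simp add: measurable_cong_sets[OF sets_k refl])
  \<comment> \<open>Draw \<open>y\<close> from \<open>P x\<close>, then a path from
    \<open>law y\<close>, and prepend \<open>x\<close>. That this is again \<open>law x\<close> is
    checked on cylinders.\<close>
  let ?N = "P x \<bind> (\<lambda>y. distr (law y) ?S (\<lambda>w. x ## w))"
  have nn: "(\<integral>\<^sup>+ w. \<Psi> w \<partial>?N) = kop P (\<lambda>y. \<integral>\<^sup>+ w. \<Psi> (x ## w) \<partial>law y) x"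
    if [measurable]: "\<Psi> \<in> borel_measurable ?S" for \<Psi>
    unfolding kop_def
    by (subst nn_integral_bind[OF that measurable_prob_algebraD[OF step]])
      (simp add: nn_integral_distr measurable_cong_sets[OF sets_law refl])
  have N: "prob_space ?N" "sets ?N = sets ?S"
  proof -
    show "prob_space ?N"
      using measurable_space[OF step]
      by (intro prob_space.prob_space_bind[OF prob_space_P _ measurable_prob_algebraD[OF step]] AE_I2)
        (auto simp: space_prob_algebra)
    show "sets ?N = sets ?S"
      by (rule sets_bind[where N = ?S]) auto
  qed
  have "law x = ?N"
  proof (rule stream_space_eq_scylinder[of _ _ "sets borel" borel "{UNIV}"])
    fix As :: "'a set list" assume As: "As \<noteq> []" "As \<in> lists (sets borel)"
    then obtain B Bs where *: "As = B # Bs" and Bs: "Bs \<in> lists (sets borel)" by (cases As) auto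
    have S: "scylinder UNIV Cs \<in> sets ?S" if "Cs \<in> lists (sets borel)" for Cs
      using sets_scylinder[of Cs "borel :: 'a measure"] that by (simp add: in_lists_conv_set)
    have "emeasure ?N (scylinder UNIV As) = (\<integral>\<^sup>+ w. indicator (scylinder UNIV As) w \<partial>?N)"
      using S[OF As(2)] N by simp
    also have "\<dots> = kop P (\<lambda>y. \<integral>\<^sup>+ w. indicator B x * indicator (scylinder UNIV Bs) w \<partial>law y) x"
      using S[OF As(2)] by (subst nn) (auto simp: * indicator_def intro!: arg_cong2[where f = "kop P"] ext nn_integral_cong)
    also have "\<dots> = indicator B x * kop P (cyl Bs) x"
      using Bs S[OF Bs]
      by (simp add: nn_integral_cmult kop_def measurable_cong_sets[OF sets_law refl]
        emeasure_law_scylinder[OF Bs] cyl_measurable[OF Bs])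
    finally show "emeasure (law x) (scylinder (space borel) As) = emeasure ?N (scylinder (space borel) As)"
      using emeasure_law_scylinder[OF As(2), of x] by (simp add: *)
  qed (use N prob_space_law in \<open>auto simp: Int_stable_def sets.sigma_sets_eq[of borel, simplified] intro: sets.Int\<close>)
  with nn[OF \<Phi>] show "(\<integral>\<^sup>+ w. \<Phi> w \<partial>law x) = kop P (\<lambda>y. \<integral>\<^sup>+ w. \<Phi> (x ## w) \<partial>law y) x"
    by simp
qed

end

section \<open>The maximal ergodic inequality\<close>

context path_law
begin

abbreviation avg :: "('a \<Rightarrow> real) \<Rightarrow> nat \<Rightarrow> 'a stream \<Rightarrow> real"
  where "avg g n w \<equiv> (\<Sum>t<n. g (w !! t)) / real n"

lemma prob_space_law: "prob_space (law x)" and sets_law: "sets (law x) = sets (stream_space borel)"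
  using measurable_space[OF law_measurable, of x] by (auto simp: space_prob_algebra)

lemma space_law [simp]: "space (law x) = UNIV"
  using sets_eq_imp_space_eq[OF sets_law] by (simp add: space_stream_space)

lemma measurable_law_iff [simp]: "g \<in> law x \<rightarrow>\<^sub>M N \<longleftrightarrow> g \<in> stream_space borel \<rightarrow>\<^sub>M N"
  by (rule measurable_cong_sets[OF sets_law refl, THEN arg_cong])

lemma law_integral_measurable [measurable]:
  "\<Phi> \<in> borel_measurable (stream_space borel) \<Longrightarrow> (\<lambda>y. \<integral>\<^sup>+ w. \<Phi> w \<partial>law y) \<in> borel_measurable borel"
  by (rule measurable_compose[OF measurable_prob_algebraD[OF law_measurable] nn_integral_measurable_subprob_algebra])

lemma law_sdrop:
  assumes [measurable]: "\<Phi> \<in> borel_measurable (stream_space borel)"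
  shows "(\<integral>\<^sup>+ w. \<Phi> (sdrop t w) \<partial>law x) = (kop P ^^ t) (\<lambda>y. \<integral>\<^sup>+ w. \<Phi> w \<partial>law y) x"
proof (induction t arbitrary: x)
  case (Suc t)
  have "(\<integral>\<^sup>+ w. \<Phi> (sdrop (Suc t) w) \<partial>law x) = kop P (\<lambda>y. \<integral>\<^sup>+ w. \<Phi> (sdrop t w) \<partial>law y) x"
    by (subst law_shift) simp_all
  then show ?case using Suc by simp
qed simp

lemma law_shd:
  assumes [measurable]: "(\<lambda>(y, w). \<Phi> y w) \<in> borel_measurable (borel \<Otimes>\<^sub>M stream_space borel)"
  shows "(\<integral>\<^sup>+ w. \<Phi> (shd w) w \<partial>law x) = (\<integral>\<^sup>+ w. \<Phi> x w \<partial>law x)"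
proof -
  have 1: "(\<lambda>w. \<Phi> (shd w) w) \<in> borel_measurable (stream_space borel)" by measurable
  have 2: "\<Phi> x \<in> borel_measurable (stream_space borel)" by measurable
  show ?thesis unfolding law_shift[OF 1] law_shift[OF 2] by simp
qed

text \<open>The maximum over \<open>k \<le> n\<close> of the sums of \<open>h - l\<close> over the
  first \<open>k\<close> states, the empty sum included. Recursion from the front relates it to the
  shifted path.\<close>

primrec excess :: "('a \<Rightarrow> real) \<Rightarrow> real \<Rightarrow> nat \<Rightarrow> 'a stream \<Rightarrow> real" where
  "excess h l 0 w = 0"
| "excess h l (Suc n) w = max 0 (h (shd w) - l + excess h l n (stl w))"

lemma excess_measurable [measurable]:
  assumes [measurable]: "h \<in> borel_measurable borel"
  shows "excess h l n \<in> borel_measurable (stream_space borel)"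
  by (induction n) auto

lemma excess_nonneg: "0 \<le> excess h l n w"
  by (cases n) auto

lemma excess_mono: "excess h l n w \<le> excess h l (Suc n) w"
proof (induction n arbitrary: w)
  case (Suc n)
  have "h (shd w) - l + excess h l n (stl w) \<le> h (shd w) - l + excess h l (Suc n) (stl w)"
    using Suc[of "stl w"] by linarith
  then show ?case by (metis excess.simps(2) max.mono order_refl)
qed simp

lemma excess_ge: "k \<le> n \<Longrightarrow> (\<Sum>s<k. h (w !! s) - l) \<le> excess h l n w"
proof (induction n arbitrary: k w)
  case (Suc n)
  show ?case
  proof (cases k)
    case (Suc j)
    have "(\<Sum>s<k. h (w !! s) - l) = h (shd w) - l + (\<Sum>s<j. h (stl w !! s) - l)"
      unfolding Suc by (subst sum.lessThan_Suc_shift) simp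
    then show ?thesis using Suc.IH[of j "stl w"] Suc Suc.prems by auto
  qed simp
qed simp

text \<open>
  The maximal ergodic inequality of Hopf: on \<open>{excess > 0}\<close> the recursion gives
  \<open>l + excess (Suc n) w \<le> h (shd w) + excess n (stl w)\<close>, and by invariance the two
  excess terms cancel after integration.
\<close>

lemma maximal_inequality:
  assumes \<pi>: "prob_space \<pi>" "sets \<pi> = sets borel"
    and inv: "\<And>u. u \<in> borel_measurable borel \<Longrightarrow> (\<integral>\<^sup>+ x. kop P u x \<partial>\<pi>) = (\<integral>\<^sup>+ x. u x \<partial>\<pi>)"
    and h [measurable]: "h \<in> borel_measurable borel" and h0: "\<And>x. 0 \<le> h x"
    and fin: "(\<integral>\<^sup>+ x. ennreal (h x) \<partial>\<pi>) < \<infinity>" and l: "0 < l"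
  shows "ennreal l * (\<integral>\<^sup>+ x. emeasure (law x) {w. \<exists>n. 0 < excess h l n w} \<partial>\<pi>) \<le> (\<integral>\<^sup>+ x. ennreal (h x) \<partial>\<pi>)"
proof -
  have meas\<pi> [simp]: "u \<in> borel_measurable \<pi> \<longleftrightarrow> u \<in> borel_measurable borel" for u :: "'a \<Rightarrow> ennreal"
    by (rule measurable_cong_sets[OF \<pi>(2) refl, THEN arg_cong])
  let ?E = "\<lambda>n. {w. 0 < excess h l n w}"
  have E [measurable]: "?E n \<in> sets (stream_space borel)" for n
    by (rule Collect_stream) measurable
  define a where "a n = (\<integral>\<^sup>+ x. (\<integral>\<^sup>+ w. ennreal (excess h l n w) \<partial>law x) \<partial>\<pi>)" for n
  let ?p = "\<lambda>n. \<integral>\<^sup>+ x. emeasure (law x) (?E n) \<partial>\<pi>"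
  have step: "a (Suc n) + ennreal l * ?p (Suc n) \<le> (\<integral>\<^sup>+ x. ennreal (h x) \<partial>\<pi>) + a n" for n
  proof -
    have pt: "ennreal (excess h l (Suc n) w) + ennreal l * indicator (?E (Suc n)) w
        \<le> ennreal (h (shd w)) + ennreal (excess h l n (stl w))" for w
    proof (cases "w \<in> ?E (Suc n)")
      case True
      then have "excess h l (Suc n) w + l = h (shd w) + excess h l n (stl w)"
        by (auto simp: max_def split: if_splits)
      then show ?thesis using True l h0[of "shd w"]
        by (simp add: excess_nonneg flip: ennreal_plus del: excess.simps)
    next
      case False
      then have "excess h l (Suc n) w = 0" using excess_nonneg[of h l "Suc n" w] by (simp del: excess.simps)
      then show ?thesis using False by (simp del: excess.simps)
    qed
    have shd_eq: "(\<integral>\<^sup>+ w. ennreal (h (shd w)) \<partial>law x) = ennreal (h x)" for x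
      using law_shd[of "\<lambda>y w. ennreal (h y)" x] prob_space.emeasure_space_1[OF prob_space_law, of x] by simp
    have "a (Suc n) + ennreal l * ?p (Suc n)
        = (\<integral>\<^sup>+ x. (\<integral>\<^sup>+ w. ennreal (excess h l (Suc n) w) + ennreal l * indicator (?E (Suc n)) w \<partial>law x) \<partial>\<pi>)"
      unfolding a_def
      by (simp add: nn_integral_add nn_integral_cmult sets_law del: excess.simps flip: nn_integral_indicator)
    also have "\<dots> \<le> (\<integral>\<^sup>+ x. (\<integral>\<^sup>+ w. ennreal (h (shd w)) + ennreal (excess h l n (stl w)) \<partial>law x) \<partial>\<pi>)"
      by (intro nn_integral_mono pt)
    also have "\<dots> = (\<integral>\<^sup>+ x. (\<integral>\<^sup>+ w. ennreal (h (shd w)) \<partial>law x) \<partial>\<pi>)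
        + (\<integral>\<^sup>+ x. (\<integral>\<^sup>+ w. ennreal (excess h l n (sdrop 1 w)) \<partial>law x) \<partial>\<pi>)"
      by (simp add: nn_integral_add)
    also have "\<dots> = (\<integral>\<^sup>+ x. ennreal (h x) \<partial>\<pi>)
        + (\<integral>\<^sup>+ x. (\<integral>\<^sup>+ w. ennreal (excess h l n (sdrop 1 w)) \<partial>law x) \<partial>\<pi>)"
      by (simp only: shd_eq)
    also have "(\<integral>\<^sup>+ x. (\<integral>\<^sup>+ w. ennreal (excess h l n (sdrop 1 w)) \<partial>law x) \<partial>\<pi>) = a n"
      unfolding a_def by (subst law_sdrop) (simp_all add: inv)
    finally show ?thesis .
  qed
  \<comment> \<open>Finiteness is what permits cancelling \<open>a (Suc n)\<close> from both sides
    in the next estimate.\<close>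
  have a_fin: "a n < \<infinity>" for n
  proof (induction n)
    case (Suc n)
    have "a (Suc n) \<le> (\<integral>\<^sup>+ x. ennreal (h x) \<partial>\<pi>) + a n"
      by (rule order_trans[OF _ step]) simp
    also have "\<dots> < \<infinity>" using Suc fin by simp
    finally show ?case .
  qed (simp add: a_def)
  have p_le: "ennreal l * ?p (Suc n) \<le> (\<integral>\<^sup>+ x. ennreal (h x) \<partial>\<pi>)" for n
  proof -
    have "a n \<le> a (Suc n)"
      unfolding a_def by (intro nn_integral_mono ennreal_leI excess_mono)
    from order_trans[OF step[of n] add_left_mono[OF this]]
    have "a (Suc n) + ennreal l * ?p (Suc n) \<le> a (Suc n) + (\<integral>\<^sup>+ x. ennreal (h x) \<partial>\<pi>)"
      by (simp add: add.commute)
    then show ?thesis using a_fin[of "Suc n"] by (subst (asm) ennreal_add_left_cancel_le) auto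
  qed
  have inc: "incseq (\<lambda>n. ?E (Suc n))"
    by (rule incseq_SucI) (use excess_mono less_le_trans in blast)
  have un: "{w. \<exists>n. 0 < excess h l n w} = (\<Union>n. ?E (Suc n))"
    using excess_mono less_le_trans by blast
  have sup: "emeasure (law x) {w. \<exists>n. 0 < excess h l n w} = (SUP n. emeasure (law x) (?E (Suc n)))" for x
    unfolding un using E by (intro SUP_emeasure_incseq[OF _ inc, symmetric]) (auto simp: sets_law simp del: excess.simps)
  have em: "(\<lambda>x. emeasure (law x) (?E n)) \<in> borel_measurable borel" for n
    using law_integral_measurable[of "indicator (?E n)"] E by (simp add: sets_law)
  have "(\<integral>\<^sup>+ x. (SUP n. emeasure (law x) (?E (Suc n))) \<partial>\<pi>) = (SUP n. ?p (Suc n))"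
  proof (rule nn_integral_monotone_convergence_SUP)
    show "incseq (\<lambda>n x. emeasure (law x) (?E (Suc n)))"
      using incseqD[OF inc] E unfolding incseq_def le_fun_def
      by (intro allI impI emeasure_mono) (auto simp: sets_law simp del: excess.simps)
  qed (use em in \<open>simp del: excess.simps\<close>)
  then have "ennreal l * (\<integral>\<^sup>+ x. emeasure (law x) {w. \<exists>n. 0 < excess h l n w} \<partial>\<pi>) = (SUP n. ennreal l * ?p (Suc n))"
    unfolding sup by (simp only: SUP_mult_left_ennreal)
  then show ?thesis using p_le by (simp only: SUP_least)
qed

end

locale ergodic_path_law = path_law P law
  for P :: "'a::polish_space \<Rightarrow> 'a measure" and law +
  fixes \<pi> :: "'a measure"
  assumes prob_\<pi>: "prob_space \<pi>" and sets_\<pi>: "sets \<pi> = sets borel"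
    and inv: "\<And>u. u \<in> borel_measurable borel \<Longrightarrow> (\<integral>\<^sup>+ x. kop P u x \<partial>\<pi>) = (\<integral>\<^sup>+ x. u x \<partial>\<pi>)"
    and lim: "\<And>g x. g \<in> borel_measurable borel \<Longrightarrow> (\<And>x. g x \<le> 1) \<Longrightarrow>
      (\<lambda>n. (kop P ^^ n) g x) \<longlonglongrightarrow> (\<integral>\<^sup>+ x. g x \<partial>\<pi>)"
begin

sublocale \<pi>: prob_space \<pi> by (rule prob_\<pi>)

lemma measurable_\<pi> [simp]: "u \<in> \<pi> \<rightarrow>\<^sub>M N \<longleftrightarrow> u \<in> borel \<rightarrow>\<^sub>M N"
  by (rule measurable_cong_sets[OF sets_\<pi> refl, THEN arg_cong])

text \<open>
  The event depends only on the tail of the path. Its probability is therefore bounded, for every \<open>t\<close>,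
  by the probability of an excess of the path shifted by \<open>t\<close>, and this converges to the \<open>\<pi>\<close>-average
  from every initial state.
\<close>

lemma average_exceeds:
  assumes h [measurable]: "h \<in> borel_measurable borel" and h0: "\<And>x. 0 \<le> h x"
    and l: "0 < l" and le: "(\<integral>\<^sup>+ x. ennreal (h x) \<partial>\<pi>) \<le> ennreal (l * \<epsilon>)"
  shows "emeasure (law x) {w. \<not> (\<forall>\<^sub>F n in sequentially. avg h n w \<le> 2 * l)} \<le> ennreal \<epsilon>"
proof -
  let ?bad = "{w. \<not> (\<forall>\<^sub>F n in sequentially. avg h n w \<le> 2 * l)}"
  let ?E = "{w. \<exists>n. 0 < excess h l n w}"
  have E [measurable]: "?E \<in> sets (stream_space borel)"
    by (rule Collect_stream) measurable
  \<comment> \<open>If the path shifted by \<open>t\<close> has no excess, its sums grow at most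
    with slope \<open>l\<close>. The first \<open>t\<close> terms are a constant, eventually below
    \<open>l * n\<close>; together this gives the level \<open>2 * l\<close>.\<close>
  have bad: "sdrop t w \<in> ?E" if "\<not> (\<forall>\<^sub>F n in sequentially. avg h n w \<le> 2 * l)" for t w
  proof (rule ccontr)
    assume "sdrop t w \<notin> ?E"
    then have "excess h l n (sdrop t w) \<le> 0" for n by (auto simp: not_less)
    then have 1: "(\<Sum>s<n. h (w !! (t + s)) - l) \<le> 0" for n
      using excess_ge[of n n h "sdrop t w" l] order_trans by (fastforce simp: sdrop_snth add.commute)
    define A where "A = (\<Sum>s<t. h (w !! s))"
    have bound: "(\<Sum>s<n. h (w !! s)) \<le> A + l * real n" for n
    proof -
      have "(\<Sum>s<n. h (w !! s)) \<le> (\<Sum>s<t + n. h (w !! s))"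
        using h0 by (intro sum_mono2) auto
      also have "\<dots> = A + (\<Sum>s<n. h (w !! (t + s)))"
        unfolding A_def by (induction n) simp_all
      also have "\<dots> \<le> A + l * real n"
        using 1[of n] by (simp add: sum_subtractf mult.commute)
      finally show ?thesis .
    qed
    have "\<forall>\<^sub>F n in sequentially. A \<le> l * real n"
      using l by real_asymp
    then have "\<forall>\<^sub>F n in sequentially. avg h n w \<le> 2 * l"
      using eventually_gt_at_top[of 0]
    proof eventually_elim
      case (elim n)
      then show ?case using bound[of n] by (simp add: divide_le_eq)
    qed
    with that show False by simp
  qed
  have "emeasure (law x) ?bad
      \<le> (kop P ^^ t) (\<lambda>y. emeasure (law y) ?E) x" for t
  proof -
    have S: "sdrop t -` ?E \<inter> space (law x) \<in> sets (law x)"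
      by (rule measurable_sets[OF _ E]) simp
    have "emeasure (law x) ?bad
        \<le> emeasure (law x) (sdrop t -` ?E \<inter> space (law x))"
      using bad by (intro emeasure_mono S) auto
    also have "\<dots> = (\<integral>\<^sup>+ w. indicator ?E (sdrop t w) \<partial>law x)"
      unfolding nn_integral_indicator[OF S, symmetric]
      by (intro nn_integral_cong) (auto split: split_indicator)
    also have "\<dots> = (kop P ^^ t) (\<lambda>y. emeasure (law y) ?E) x"
      by (subst law_sdrop) (auto simp: sets_law)
    finally show ?thesis .
  qed
  moreover have "(\<lambda>t. (kop P ^^ t) (\<lambda>y. emeasure (law y) ?E) x) \<longlonglongrightarrow> (\<integral>\<^sup>+ y. emeasure (law y) ?E \<partial>\<pi>)"
    using law_integral_measurable[of "indicator ?E"] prob_space.emeasure_le_1[OF prob_space_law]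
    by (intro lim) (simp_all add: sets_law)
  ultimately have "emeasure (law x) ?bad
      \<le> (\<integral>\<^sup>+ y. emeasure (law y) ?E \<partial>\<pi>)"
    by (intro LIMSEQ_le_const) auto
  also have "\<dots> \<le> ennreal \<epsilon>"
  proof -
    have "ennreal l * (\<integral>\<^sup>+ y. emeasure (law y) ?E \<partial>\<pi>) \<le> ennreal (l * \<epsilon>)"
      using le by (intro order_trans[OF maximal_inequality[OF prob_\<pi> sets_\<pi> inv h h0 _ l]])
        (auto intro: le_less_trans)
    then have "ennreal l * (\<integral>\<^sup>+ y. emeasure (law y) ?E \<partial>\<pi>) \<le> ennreal l * ennreal \<epsilon>"
      using l by (cases "0 \<le> \<epsilon>") (auto simp: ennreal_mult ennreal_neg mult_pos_neg mult_nonneg_nonpos)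
    then show ?thesis
      using l by (subst (asm) ennreal_mult_le_mult_iff) auto
  qed
  finally show ?thesis .
qed

end

section \<open>The law of large numbers\<close>

context path_law
begin

definition increments :: "('a \<Rightarrow> real) \<Rightarrow> nat \<Rightarrow> 'a stream \<Rightarrow> real"
  where "increments u n w = (\<Sum>t<n. u (w !! Suc t) - (\<integral>y. u y \<partial>P (w !! t)))"

lemma integral_P_measurable [measurable]:
  fixes u :: "'a \<Rightarrow> real"
  assumes [measurable]: "u \<in> borel_measurable borel"
  shows "(\<lambda>x. \<integral>y. u y \<partial>P x) \<in> borel_measurable borel"
  by (rule measurable_compose[OF k integral_measurable_subprob_algebra]) simp

lemma increments_measurable [measurable]:
  assumes [measurable]: "u \<in> borel_measurable borel"
  shows "increments u n \<in> borel_measurable (stream_space borel)"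
  unfolding increments_def by (simp del: snth.simps)

lemma increments_Stream:
  "increments u (Suc n) (x ## w) = (u (shd w) - (\<integral>y. u y \<partial>P x)) + increments u n w"
  unfolding increments_def by (subst sum.lessThan_Suc_shift) simp

text \<open>Each increment is conditionally centred and ranges over an interval of length
  \<open>2 * c\<close>, for which Hoeffding's lemma gives the factor
  \<open>exp (s\<^sup>2 * c\<^sup>2 / 2)\<close>. The induction peels off the first step of the
  path.\<close>

lemma increments_exp_moment:
  assumes u [measurable]: "u \<in> borel_measurable borel" and c: "\<And>y. \<bar>u y\<bar> \<le> c" and s: "0 < s"
  shows "(\<integral>\<^sup>+ w. ennreal (exp (s * increments u n w)) \<partial>law x) \<le> ennreal (exp (s\<^sup>2 * c\<^sup>2 / 2)) ^ n"
proof (induction n arbitrary: x)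
  case 0
  show ?case
    using prob_space.emeasure_space_1[OF prob_space_law, of x] by (simp add: increments_def)
next
  case (Suc n)
  let ?r = "ennreal (exp (s\<^sup>2 * c\<^sup>2 / 2))" and ?e = "\<lambda>y. exp (s * (u y - (\<integral>y. u y \<partial>P x)))"
  interpret interval_bounded_random_variable "P x" u "-c" c
    using c by (intro interval_bounded_random_variable.intro prob_space_P
      interval_bounded_random_variable_axioms.intro AE_I2) (auto simp: abs_le_iff minus_le_iff)
  have "(\<integral>\<^sup>+ w. ennreal (exp (s * increments u (Suc n) w)) \<partial>law x)
      = kop P (\<lambda>y. \<integral>\<^sup>+ w. ennreal (?e (shd w)) * ennreal (exp (s * increments u n w)) \<partial>law y) x"
    by (subst law_shift) (simp_all add: increments_Stream exp_add distrib_left ennreal_mult)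
  also have "\<dots> = kop P (\<lambda>y. \<integral>\<^sup>+ w. ennreal (?e y) * ennreal (exp (s * increments u n w)) \<partial>law y) x"
    using law_shd[of "\<lambda>y w. ennreal (?e y) * ennreal (exp (s * increments u n w))"] by simp
  also have "\<dots> = kop P (\<lambda>y. ennreal (?e y) * (\<integral>\<^sup>+ w. ennreal (exp (s * increments u n w)) \<partial>law y)) x"
    by (simp add: nn_integral_cmult)
  also have "\<dots> \<le> kop P (\<lambda>y. ennreal (?e y) * ?r ^ n) x"
    by (intro kop_mono mult_left_mono Suc) simp
  also have "\<dots> = (\<integral>\<^sup>+ y. ennreal (?e y) \<partial>P x) * ?r ^ n"
    by (simp add: kop_def nn_integral_multc)
  also have "\<dots> \<le> ?r * ?r ^ n"
    using Hoeffdings_lemma_nn_integral[OF s] by (intro mult_right_mono) (simp_all add: power2_eq_square mult_ac)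
  finally show ?case by simp
qed

lemma increments_le_eventually:
  assumes u [measurable]: "u \<in> borel_measurable borel" and c: "\<And>y. \<bar>u y\<bar> \<le> c" "0 < c" and \<epsilon>: "0 < \<epsilon>"
  shows "AE w in law x. \<forall>\<^sub>F n in sequentially. increments u n w \<le> \<epsilon> * real n"
proof -
  interpret prob_space "law x" by (rule prob_space_law)
  \<comment> \<open>\<open>s\<close> minimises
    \<open>s\<^sup>2 * c\<^sup>2 / 2 - s * \<epsilon>\<close>, and \<open>q\<close> is the
    exponential of this minimum, so the exceptional probabilities are geometrically
    summable.\<close>
  define s q where "s = \<epsilon> / c\<^sup>2" and "q = exp (- (\<epsilon>\<^sup>2 / (2 * c\<^sup>2)))"
  have s: "0 < s" using \<epsilon> c by (simp add: s_def)
  let ?A = "\<lambda>n. {w. \<epsilon> * real n < increments u n w}"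
  have A [measurable]: "?A n \<in> sets (law x)" for n
    unfolding sets_law by (rule Collect_stream) measurable
  have "emeasure (law x) (?A n) \<le> ennreal (q ^ n)" for n
  proof -
    have "emeasure (law x) (?A n) = (\<integral>\<^sup>+ w. indicator (?A n) w \<partial>law x)"
      by (simp only: nn_integral_indicator[OF A])
    also have "\<dots> \<le> (\<integral>\<^sup>+ w. ennreal (exp (- (s * \<epsilon> * real n))) * ennreal (exp (s * increments u n w)) \<partial>law x)"
      using s by (intro nn_integral_mono)
        (auto simp: ennreal_mult[symmetric] exp_add[symmetric] ennreal_ge_1 mult.assoc split: split_indicator)
    also have "\<dots> \<le> ennreal (exp (- (s * \<epsilon> * real n))) * ennreal (exp (s\<^sup>2 * c\<^sup>2 / 2)) ^ n"
      by (subst nn_integral_cmult) (auto intro!: mult_left_mono increments_exp_moment c s)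
    also have "\<dots> = ennreal ((exp (- (s * \<epsilon>)) * exp (s\<^sup>2 * c\<^sup>2 / 2)) ^ n)"
      by (simp add: ennreal_power ennreal_mult[symmetric] power_mult_distrib exp_of_nat_mult[symmetric] mult_ac)
    also have "exp (- (s * \<epsilon>)) * exp (s\<^sup>2 * c\<^sup>2 / 2) = q"
      using c by (simp add: s_def q_def exp_add[symmetric] power2_eq_square field_simps)
    finally show ?thesis .
  qed
  then have "measure (law x) (?A n) \<le> q ^ n" for n
    by (simp add: emeasure_eq_measure q_def)
  then have "summable (\<lambda>n. measure (law x) (?A n))"
    using \<epsilon> c by (intro summable_comparison_test'[OF summable_geometric[of q], of 0]) (auto simp: q_def)
  from borel_cantelli_AE1[OF A _ this]
  have "AE w in law x. \<forall>\<^sub>F n in sequentially. w \<in> space (law x) - ?A n"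
    by (simp add: emeasure_eq_measure)
  then show ?thesis
    by eventually_elim (auto elim!: eventually_mono simp: not_less)
qed

text \<open>Along the path, the sum of \<open>u - P u\<close> differs from the martingale
  \<open>increments u\<close> by the bounded boundary term \<open>u (w !! 0) - u (w !! n)\<close>.
  The one-sided estimate, applied to \<open>u\<close> and \<open>- u\<close>, controls the
  martingale.\<close>

lemma coboundary_average:
  assumes u [measurable]: "u \<in> borel_measurable borel" and c: "\<And>y. \<bar>u y\<bar> \<le> c"
  shows "AE w in law x. (\<lambda>n. (\<Sum>t<n. u (w !! t) - (\<integral>y. u y \<partial>P (w !! t))) / real n) \<longlonglongrightarrow> 0"
proof -
  have c': "\<bar>u y\<bar> \<le> \<bar>c\<bar> + 1" for y using c[of y] by auto
  have neg: "increments (\<lambda>y. - u y) n w = - increments u n w" for n w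
    by (simp add: increments_def sum_negf[symmetric])
  have "AE w in law x. \<forall>k::nat. (\<forall>\<^sub>F n in sequentially. increments u n w \<le> (1 / Suc k) * real n)
      \<and> (\<forall>\<^sub>F n in sequentially. increments (\<lambda>y. - u y) n w \<le> (1 / Suc k) * real n)"
    using c' by (intro AE_all_countable[THEN iffD2] allI AE_conjI increments_le_eventually[where c = "\<bar>c\<bar> + 1"]) auto
  then show ?thesis
  proof eventually_elim
    case (elim w)
    have "(\<lambda>n. increments u n w / real n) \<longlonglongrightarrow> 0"
    proof (rule LIMSEQ_I)
      fix r :: real assume "0 < r"
      then obtain k where k: "1 / real (Suc k) < r" using nat_approx_posE by blast
      from elim[THEN spec[of _ k], THEN conjunct1] elim[THEN spec[of _ k], THEN conjunct2]
      have "\<forall>\<^sub>F n in sequentially. norm (increments u n w / real n - 0) < r"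
      proof eventually_elim
        case (elim n)
        show ?case
        proof (cases "n = 0")
          case False
          then have "\<bar>increments u n w / real n\<bar> \<le> 1 / real (Suc k)"
            using elim unfolding neg by (simp add: abs_le_iff divide_le_eq field_simps)
          then show ?thesis using k by simp
        qed (use \<open>0 < r\<close> in simp)
      qed
      then show "\<exists>no. \<forall>n\<ge>no. norm (increments u n w / real n - 0) < r"
        by (simp add: eventually_sequentially)
    qed
    moreover have "(\<lambda>n. (u (w !! 0) - u (w !! n)) / real n) \<longlonglongrightarrow> 0"
    proof (rule tendsto_rabs_zero_cancel, rule tendsto_sandwich[OF _ _ tendsto_const])
      show "\<forall>\<^sub>F n in sequentially. \<bar>(u (w !! 0) - u (w !! n)) / real n\<bar> \<le> 2 * c / real n"
      proof (intro always_eventually allI)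
        fix n
        have "\<bar>u (w !! 0) - u (w !! n)\<bar> \<le> 2 * c"
          using c[of "w !! 0"] c[of "w !! n"] by linarith
        then show "\<bar>(u (w !! 0) - u (w !! n)) / real n\<bar> \<le> 2 * c / real n"
          unfolding abs_divide by (simp add: divide_right_mono)
      qed
      show "(\<lambda>n. 2 * c / real n) \<longlonglongrightarrow> 0" by real_asymp
    qed simp
    ultimately have "(\<lambda>n. increments u n w / real n + (u (w !! 0) - u (w !! n)) / real n) \<longlonglongrightarrow> 0 + 0"
      by (rule tendsto_add)
    moreover have "(\<Sum>t<n. u (w !! t) - (\<integral>y. u y \<partial>P (w !! t))) = increments u n w + (u (w !! 0) - u (w !! n))" for n
      by (induction n) (simp_all add: increments_def del: snth.simps(2))
    ultimately show ?case by (simp add: add_divide_distrib)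
  qed
qed

end

section \<open>From coboundaries to integrable functions\<close>

context ergodic_path_law
begin

lemma bounded_convergence:
  fixes g :: "'a \<Rightarrow> real"
  assumes g [measurable]: "g \<in> borel_measurable borel" and g0: "\<And>y. 0 \<le> g y" and gK: "\<And>y. g y \<le> K"
  shows "(\<lambda>n. enn2real ((kop P ^^ n) (\<lambda>y. ennreal (g y)) x)) \<longlonglongrightarrow> (\<integral>y. g y \<partial>\<pi>)"
proof (rule scaled_limit[where f = "\<lambda>_. 1" and K = "K + 1"])
  show "0 < K + 1" using order_trans[OF g0 gK] by (simp add: add_nonneg_pos)
  show "integrable \<pi> g" using g0 gK by (intro \<pi>.integrable_const_bound[of _ K]) auto
qed (use g g0 gK lim sets_\<pi> in \<open>auto intro: add_increasing2\<close>)

text \<open>Take for \<open>u\<close> the sum of \<open>P^k g\<close> over \<open>k < n\<close> and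
  \<open>v = P^n g\<close>; then \<open>u - P u\<close> telescopes to \<open>g - P^n g\<close>. For
  large \<open>n\<close>, dominated convergence brings \<open>v\<close> close to the constant
  \<open>\<pi>(g)\<close> in \<open>L^1(\<pi>)\<close>.\<close>

lemma truncated_decomposition:
  fixes g :: "'a \<Rightarrow> real"
  assumes g [measurable]: "g \<in> borel_measurable borel" and g0: "\<And>y. 0 \<le> g y" and gK: "\<And>y. g y \<le> K"
    and d: "0 < d"
  obtains u v :: "'a \<Rightarrow> real" and c where
    "u \<in> borel_measurable borel" "v \<in> borel_measurable borel" "\<And>y. \<bar>u y\<bar> \<le> c"
    "\<And>y. g y = u y - (\<integral>z. u z \<partial>P y) + v y"
    "(\<integral>\<^sup>+ y. ennreal \<bar>v y - (\<integral>z. g z \<partial>\<pi>)\<bar> \<partial>\<pi>) \<le> ennreal d"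
proof -
  define V where "V n y = enn2real ((kop P ^^ n) (\<lambda>y. ennreal (g y)) y)" for n y
  have V [measurable]: "V n \<in> borel_measurable borel" for n
    unfolding V_def by measurable
  have K0: "0 \<le> K" using order_trans[OF g0 gK] .
  have le: "(kop P ^^ n) (\<lambda>y. ennreal (g y)) y \<le> ennreal K" for n y
    using pow_mono[of "\<lambda>y. ennreal (g y)" "\<lambda>_. ennreal K" n y] gK by (simp add: ennreal_leI)
  have eV: "ennreal (V n y) = (kop P ^^ n) (\<lambda>y. ennreal (g y)) y" for n y
    unfolding V_def using le[of n y] by (intro ennreal_enn2real) (auto simp: less_top intro: le_less_trans)
  have V0: "0 \<le> V n y" and VK: "V n y \<le> K" for n y
    using le[of n y] K0 by (auto simp: V_def enn2real_leI)
  have int: "integrable (P y) (V n)" for n y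
  proof -
    interpret prob_space "P y" by (rule prob_space_P)
    show ?thesis using V0 VK by (intro integrable_const_bound[of _ K]) auto
  qed
  have PV: "(\<integral>z. V n z \<partial>P y) = V (Suc n) y" for n y
    using V0 by (subst integral_eq_nn_integral) (simp_all add: eV V_def[of "Suc n"] kop_def)
  let ?k = "\<integral>z. g z \<partial>\<pi>"
  have k: "0 \<le> ?k" "?k \<le> K"
    using g0 gK \<pi>.integrable_const_bound[of g K] by (auto intro!: integral_nonneg \<pi>.integral_le_const)
  have "(\<lambda>n. \<integral>\<^sup>+ y. ennreal \<bar>V n y - ?k\<bar> \<partial>\<pi>) \<longlonglongrightarrow> (\<integral>\<^sup>+ y. 0 \<partial>\<pi>)"
  proof (rule nn_integral_dominated_convergence[where w = "\<lambda>_. ennreal K"])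
    have "\<bar>V n y - ?k\<bar> \<le> K" for n y using V0[of n y] VK[of n y] k by (simp add: abs_le_iff)
    then show "AE y in \<pi>. ennreal \<bar>V n y - ?k\<bar> \<le> ennreal K" for n by (simp add: ennreal_leI)
    have "(\<lambda>n. \<bar>V n y - ?k\<bar>) \<longlonglongrightarrow> \<bar>?k - ?k\<bar>" for y
      unfolding V_def by (intro tendsto_intros bounded_convergence[OF g g0 gK])
    then show "AE y in \<pi>. (\<lambda>n. ennreal \<bar>V n y - ?k\<bar>) \<longlonglongrightarrow> 0"
      using tendsto_ennrealI by (intro AE_I2) fastforce
  qed (auto simp: \<pi>.emeasure_space_1)
  then have "\<forall>\<^sub>F n in sequentially. (\<integral>\<^sup>+ y. ennreal \<bar>V n y - ?k\<bar> \<partial>\<pi>) < ennreal d"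
    using d by (intro order_tendstoD) auto
  then obtain n where n: "(\<integral>\<^sup>+ y. ennreal \<bar>V n y - ?k\<bar> \<partial>\<pi>) < ennreal d"
    by (auto simp: eventually_sequentially)
  show ?thesis
  proof (rule that[of "\<lambda>y. \<Sum>k<n. V k y" "V n" "real n * K"])
    show "\<bar>\<Sum>k<n. V k y\<bar> \<le> real n * K" for y
      using sum_bounded_above[of "{..<n}" "\<lambda>k. V k y" K] V0 VK by (simp add: sum_nonneg)
    show "g y = (\<Sum>k<n. V k y) - (\<integral>z. (\<Sum>k<n. V k z) \<partial>P y) + V n y" for y
      using sum_lessThan_telescope'[of "\<lambda>k. V k y" n] g0[of y]
      by (simp add: Bochner_Integration.integral_sum int PV sum_subtractf[symmetric]) (simp add: V_def)
  qed (use n in auto)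
qed

text \<open>The error \<open>4 * \<eta>\<close> consists of \<open>2 * \<eta>\<close> for the
  average of the remainder \<open>h\<close>, \<open>\<eta>\<close> for the coboundary and
  \<open>\<eta>\<close> for the change of the mean by truncation.\<close>

lemma lln_approx:
  fixes g :: "'a \<Rightarrow> real"
  assumes g [measurable]: "g \<in> borel_measurable borel" and g0: "\<And>y. 0 \<le> g y" and int: "integrable \<pi> g"
    and \<eta>: "0 < \<eta>" and \<epsilon>: "0 < \<epsilon>" "\<epsilon> \<le> 1"
  shows "emeasure (law x) {w. \<not> (\<forall>\<^sub>F n in sequentially. \<bar>avg g n w - (\<integral>y. g y \<partial>\<pi>)\<bar> \<le> 4 * \<eta>)}
    \<le> ennreal \<epsilon>"
proof -
  \<comment> \<open>Truncation and remainder each cost \<open>d\<close> in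
    \<open>L^1(\<pi>)\<close>. Their total \<open>\<eta> * \<epsilon>\<close> is what
    \<open>average_exceeds\<close>, with \<open>l = \<eta>\<close>, converts into probability
    \<open>\<epsilon>\<close>.\<close>
  define d where "d = \<eta> * \<epsilon> / 2"
  have d: "0 < d" "d \<le> \<eta>" "d + d = \<eta> * \<epsilon>"
    using \<eta> \<epsilon> mult_left_le[of \<epsilon> \<eta>] by (auto simp: d_def)
  have "(\<lambda>K. \<integral>y. g y - min (g y) (real K) \<partial>\<pi>) \<longlonglongrightarrow> (\<integral>y. 0 \<partial>\<pi>)"
  proof (rule integral_dominated_convergence[where w = g])
    show "AE y in \<pi>. (\<lambda>K. g y - min (g y) (real K)) \<longlonglongrightarrow> 0"
    proof (intro AE_I2 tendsto_eventually)
      fix y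
      show "\<forall>\<^sub>F K in sequentially. g y - min (g y) (real K) = 0"
        using eventually_ge_at_top[of "nat \<lceil>g y\<rceil>"]
      proof eventually_elim
        case (elim K)
        then have "g y \<le> real K" by linarith
        then show ?case by simp
      qed
    qed
  qed (use g0 int in \<open>auto simp: min_def\<close>)
  then have "\<forall>\<^sub>F K in sequentially. (\<integral>y. g y - min (g y) (real K) \<partial>\<pi>) < d"
    using d by (intro order_tendstoD) auto
  then obtain K where K: "(\<integral>y. g y - min (g y) (real K) \<partial>\<pi>) < d"
    by (auto simp: eventually_sequentially)
  define gK where "gK y = min (g y) (real K)" for y
  have gKm [measurable]: "gK \<in> borel_measurable borel" unfolding gK_def by measurable
  have gK: "0 \<le> gK y" "gK y \<le> real K" "gK y \<le> g y" for y using g0[of y] by (auto simp: gK_def)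
  have intK: "integrable \<pi> gK" using gK by (intro \<pi>.integrable_const_bound[of _ "real K"]) auto
  let ?k = "\<integral>y. gK y \<partial>\<pi>" and ?g = "\<integral>y. g y \<partial>\<pi>"
  have kg: "\<bar>?k - ?g\<bar> \<le> \<eta>"
  proof -
    have "?k \<le> ?g" using int intK gK by (intro integral_mono) auto
    moreover have "?g - ?k < d" using K int intK unfolding gK_def[symmetric] by simp
    ultimately show ?thesis using d by simp
  qed
  obtain u v c where uv [measurable]: "u \<in> borel_measurable borel" "v \<in> borel_measurable borel"
    and c: "\<And>y. \<bar>u y\<bar> \<le> c" and dec: "\<And>y. gK y = u y - (\<integral>z. u z \<partial>P y) + v y"
    and v: "(\<integral>\<^sup>+ y. ennreal \<bar>v y - ?k\<bar> \<partial>\<pi>) \<le> ennreal d"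
    by (rule truncated_decomposition[OF gKm gK(1,2) d(1)]) blast
  define h where "h y = (g y - gK y) + \<bar>v y - ?k\<bar>" for y
  have [measurable]: "h \<in> borel_measurable borel" unfolding h_def by measurable
  have h0: "0 \<le> h y" for y using gK[of y] by (simp add: h_def)
  let ?bad = "{w. \<not> (\<forall>\<^sub>F n in sequentially. avg h n w \<le> 2 * \<eta>)}"
  have "(\<integral>\<^sup>+ y. ennreal (h y) \<partial>\<pi>) = (\<integral>\<^sup>+ y. ennreal (g y - gK y) \<partial>\<pi>) + (\<integral>\<^sup>+ y. ennreal \<bar>v y - ?k\<bar> \<partial>\<pi>)"
    unfolding h_def using gK by (subst nn_integral_add[symmetric]) auto
  also have "\<dots> \<le> ennreal d + ennreal d"
    using K v int intK gK unfolding gK_def[symmetric]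
    by (intro add_mono) (simp_all add: nn_integral_eq_integral ennreal_leI)
  also have "\<dots> = ennreal (\<eta> * \<epsilon>)"
    using d by (simp flip: ennreal_plus)
  finally have h: "emeasure (law x) ?bad \<le> ennreal \<epsilon>"
    by (intro average_exceeds[OF _ h0 \<eta>]) auto
  have "AE w in law x. w \<in> {w. \<not> (\<forall>\<^sub>F n in sequentially. \<bar>avg g n w - ?g\<bar> \<le> 4 * \<eta>)} \<longrightarrow>
      w \<in> ?bad"
    using coboundary_average[OF uv(1) c]
  proof eventually_elim
    case (elim w)
    have "\<forall>\<^sub>F n in sequentially. \<bar>avg g n w - ?g\<bar> \<le> 4 * \<eta>"
      if h_ev: "\<forall>\<^sub>F n in sequentially. avg h n w \<le> 2 * \<eta>"
    proof -
      let ?c = "\<lambda>n. (\<Sum>t<n. u (w !! t) - (\<integral>y. u y \<partial>P (w !! t))) / real n"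
      have "\<forall>\<^sub>F n in sequentially. \<bar>?c n\<bar> < \<eta>"
        using tendstoD[OF elim \<eta>] by (simp add: dist_real_def)
      with h_ev eventually_gt_at_top[of 0] show ?thesis
      proof eventually_elim
        case (elim n)
        have "avg g n w - ?g
            = ?c n + (\<Sum>t<n. (g (w !! t) - gK (w !! t)) + (v (w !! t) - ?k)) / real n + (?k - ?g)"
          using elim(2) unfolding dec
          by (simp add: sum.distrib sum_subtractf field_simps)
        moreover have "\<bar>\<Sum>t<n. (g (w !! t) - gK (w !! t)) + (v (w !! t) - ?k)\<bar> \<le> (\<Sum>t<n. h (w !! t))"
          using gK(3) by (intro sum_abs[THEN order_trans] sum_mono) (simp add: h_def, smt (verit))
        then have "\<bar>(\<Sum>t<n. (g (w !! t) - gK (w !! t)) + (v (w !! t) - ?k)) / real n\<bar> \<le> 2 * \<eta>"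
          using elim(1) by (simp add: abs_divide) (meson divide_right_mono of_nat_0_le_iff order_trans)
        ultimately show ?case using elim(3) kg by linarith
      qed
    qed
    then show ?case by blast
  qed
  moreover have "?bad \<in> sets (law x)"
    unfolding sets_law eventually_sequentially by (rule Collect_stream) measurable
  ultimately show ?thesis
    using emeasure_mono_AE h order_trans by blast
qed

lemma lln_nonneg:
  fixes g :: "'a \<Rightarrow> real"
  assumes g [measurable]: "g \<in> borel_measurable borel" and g0: "\<And>y. 0 \<le> g y" and int: "integrable \<pi> g"
  shows "AE w in law x. (\<lambda>n. avg g n w) \<longlonglongrightarrow> (\<integral>y. g y \<partial>\<pi>)"
proof -
  let ?good = "\<lambda>\<eta> w. \<forall>\<^sub>F n in sequentially. \<bar>avg g n w - (\<integral>y. g y \<partial>\<pi>)\<bar> \<le> 4 * \<eta>"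
  have ae: "AE w in law x. ?good \<eta> w" if \<eta>: "0 < \<eta>" for \<eta>
  proof (rule AE_I)
    show "{w \<in> space (law x). \<not> ?good \<eta> w} \<subseteq> {w. \<not> ?good \<eta> w}" by auto
    show "{w. \<not> ?good \<eta> w} \<in> sets (law x)"
      unfolding sets_law eventually_sequentially by (rule Collect_stream) measurable
    have le: "emeasure (law x) {w. \<not> ?good \<eta> w} \<le> ennreal \<epsilon>" if "0 < \<epsilon>" for \<epsilon>
      using lln_approx[OF g g0 int \<eta>, of "min \<epsilon> 1" x] that
      by (intro order_trans[OF _ ennreal_leI[of "min \<epsilon> 1" \<epsilon>]]) auto
    show "emeasure (law x) {w. \<not> ?good \<eta> w} = 0"
    proof (rule ccontr)
      assume "\<not> ?thesis"
      then show False
        using ennreal_le_epsilon[of 0 "emeasure (law x) {w. \<not> ?good \<eta> w}"] le by simp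
    qed
  qed
  have "AE w in law x. \<forall>k::nat. ?good (1 / Suc k) w"
    by (intro AE_all_countable[THEN iffD2] allI ae) simp
  then show ?thesis
  proof eventually_elim
    case (elim w)
    show ?case
    proof (rule LIMSEQ_I)
      fix r :: real assume "0 < r"
      then obtain k where k: "1 / real (Suc k) < r / 4" using nat_approx_posE[of "r / 4"] by auto
      have "\<forall>\<^sub>F n in sequentially. norm (avg g n w - (\<integral>y. g y \<partial>\<pi>)) < r"
        using elim[rule_format, of k] by eventually_elim (use k in simp)
      then show "\<exists>no. \<forall>n\<ge>no. norm (avg g n w - (\<integral>y. g y \<partial>\<pi>)) < r"
        by (simp add: eventually_sequentially)
    qed
  qed
qed

theorem lln:
  fixes g :: "'a \<Rightarrow> real"
  assumes g [measurable]: "g \<in> borel_measurable borel" and int: "integrable \<pi> g"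
  shows "AE w in law x. (\<lambda>n. avg g n w) \<longlonglongrightarrow> (\<integral>y. g y \<partial>\<pi>)"
proof -
  have i: "integrable \<pi> (\<lambda>y. max 0 (g y))" "integrable \<pi> (\<lambda>y. max 0 (- g y))" using int by auto
  have g_eq: "g y = max 0 (g y) - max 0 (- g y)" for y by auto
  have "AE w in law x. (\<lambda>n. (\<Sum>t<n. max 0 (g (w !! t))) / real n) \<longlonglongrightarrow> (\<integral>y. max 0 (g y) \<partial>\<pi>)"
    "AE w in law x. (\<lambda>n. (\<Sum>t<n. max 0 (- g (w !! t))) / real n) \<longlonglongrightarrow> (\<integral>y. max 0 (- g y) \<partial>\<pi>)"
    using i by (auto intro!: lln_nonneg)
  then show ?thesis
  proof eventually_elim
    case (elim w)
    have "avg g n w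
        = (\<Sum>t<n. max 0 (g (w !! t))) / real n - (\<Sum>t<n. max 0 (- g (w !! t))) / real n" for n
      by (subst g_eq) (simp add: sum_subtractf diff_divide_distrib)
    moreover have "(\<integral>y. g y \<partial>\<pi>) = (\<integral>y. max 0 (g y) \<partial>\<pi>) - (\<integral>y. max 0 (- g y) \<partial>\<pi>)"
      by (subst g_eq) (simp add: i)
    ultimately show ?case using tendsto_diff[OF elim] by simp
  qed
qed

end

section \<open>Random-time drift\<close>

context markov_chain
begin

lemma taboo_op_mono: "(\<And>x. u x \<le> v x) \<Longrightarrow> taboo_op D u x \<le> taboo_op D v x"
  unfolding taboo_op_def by (intro kop_mono mult_left_mono) auto

lemma taboo_pow_mono: "(\<And>x. u x \<le> v x) \<Longrightarrow> (taboo_op D ^^ n) u x \<le> (taboo_op D ^^ n) v x"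
  by (induction n arbitrary: x) (auto intro: taboo_op_mono)

lemma taboo_op_cmult:
  assumes [measurable]: "D \<in> sets borel" "u \<in> borel_measurable borel"
  shows "taboo_op D (\<lambda>x. c * u x) = (\<lambda>x. c * taboo_op D u x)"
  by (simp add: taboo_op_def kop_def fun_eq_iff mult.left_commute[of _ c] nn_integral_cmult)

lemma taboo_pow_cmult:
  assumes [measurable]: "D \<in> sets borel" "u \<in> borel_measurable borel"
  shows "(taboo_op D ^^ n) (\<lambda>x. c * u x) = (\<lambda>x. c * (taboo_op D ^^ n) u x)"
  by (induction n) (simp_all add: taboo_op_cmult)

lemma taboo_op_sum:
  assumes [measurable]: "D \<in> sets borel" "\<And>i. u i \<in> borel_measurable borel"
  shows "taboo_op D (\<lambda>x. \<Sum>i\<in>I. u i x) = (\<lambda>x. \<Sum>i\<in>I. taboo_op D (u i) x)"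
  by (simp add: taboo_op_def kop_def fun_eq_iff sum_distrib_left nn_integral_sum)

lemma taboo_pow_sum:
  assumes [measurable]: "D \<in> sets borel" "\<And>i. u i \<in> borel_measurable borel"
  shows "(taboo_op D ^^ n) (\<lambda>x. \<Sum>i\<in>I. u i x) = (\<lambda>x. \<Sum>i\<in>I. (taboo_op D ^^ n) (u i) x)"
  by (induction n) (simp_all add: taboo_op_sum)

lemma taboo_op_suminf:
  assumes [measurable]: "D \<in> sets borel" "\<And>i. u i \<in> borel_measurable borel"
  shows "taboo_op D (\<lambda>x. \<Sum>i. u i x) = (\<lambda>x. \<Sum>i. taboo_op D (u i) x)"
proof
  fix x
  have "indicator (- D) y * (\<Sum>i. u i y) = (\<Sum>i. indicator (- D) y * u i y)" for y by simp
  then show "taboo_op D (\<lambda>x. \<Sum>i. u i x) x = (\<Sum>i. taboo_op D (u i) x)"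
    unfolding taboo_op_def kop_def by (simp only:) (rule nn_integral_suminf, simp)
qed

lemma entrance_plus_taboo:
  assumes [measurable]: "D \<in> sets borel" "u \<in> borel_measurable borel"
  shows "kop P u x = kop P (\<lambda>y. indicator D y * u y) x + taboo_op D u x"
proof -
  have "u y = indicator D y * u y + indicator (- D) y * u y" for y
    by (auto split: split_indicator)
  then have "kop P u x = kop P (\<lambda>y. indicator D y * u y + indicator (- D) y * u y) x" by simp
  also have "\<dots> = kop P (\<lambda>y. indicator D y * u y) x + taboo_op D u x"
    unfolding taboo_op_def kop_def by (rule nn_integral_add) auto
  finally show ?thesis .
qed

text \<open>The summands are the probabilities that the first entrance to \<open>D\<close> after
  time 0 happens at time \<open>i + 1\<close>; the missing mass is that of no entrance up to time
  \<open>n\<close>.\<close>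

lemma taboo_entrance_le_1:
  assumes [measurable]: "D \<in> sets borel"
  shows "(\<Sum>i<n. (taboo_op D ^^ i) (kop P (indicator D)) x) \<le> 1"
proof -
  have "(\<Sum>i<n. (taboo_op D ^^ i) (kop P (indicator D)) x) + (taboo_op D ^^ n) (\<lambda>_. 1) x = 1"
  proof (induction n)
    case (Suc n)
    \<comment> \<open>The two-term sum is written as a sum over \<open>bool\<close> so that
      \<open>taboo_pow_sum\<close> applies to it.\<close>
    have "(\<lambda>_. 1) = (\<lambda>x. \<Sum>b\<in>UNIV. if b then kop P (indicator D) x else taboo_op D (\<lambda>_. 1) x)"
      using entrance_plus_taboo[of D "\<lambda>_. 1"] by (simp add: UNIV_bool fun_eq_iff add.commute)
    then have "(taboo_op D ^^ n) (\<lambda>_. 1) x = (taboo_op D ^^ n) (\<lambda>x. \<Sum>b\<in>UNIV. if b then kop P (indicator D) x else taboo_op D (\<lambda>_. 1) x) x"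
      by simp
    also have "\<dots> = (\<Sum>b\<in>UNIV. (taboo_op D ^^ n) (\<lambda>x. if b then kop P (indicator D) x else taboo_op D (\<lambda>_. 1) x) x)"
      by (subst taboo_pow_sum) auto
    also have "\<dots> = (taboo_op D ^^ n) (kop P (indicator D)) x + (taboo_op D ^^ Suc n) (\<lambda>_. 1) x"
      by (simp add: UNIV_bool add.commute funpow_swap1)
    finally show ?case using Suc by (simp add: add_ac del: funpow.simps)
  qed simp
  then show ?thesis by (metis le_iff_add)
qed

text \<open>A chain that is in \<open>D\<close> at time \<open>n + 1\<close> has its first entrance
  at one of the times from 1 to \<open>n + 1\<close>.\<close>

lemma pow_le_taboo_entrances:
  assumes D [measurable]: "D \<in> sets borel"
  shows "(kop P ^^ Suc n) (indicator D) x \<le> (\<Sum>j<Suc n. (taboo_op D ^^ j) (kop P (indicator D)) x)"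
proof (induction n arbitrary: x)
  case (Suc n)
  let ?v = "(kop P ^^ Suc n) (indicator D)"
  have v1: "?v y \<le> 1" for y by (rule pow_indicator_le_1)
  have "(kop P ^^ Suc (Suc n)) (indicator D) x = kop P ?v x" by simp
  also have "\<dots> = kop P (\<lambda>y. indicator D y * ?v y) x + taboo_op D ?v x"
    by (rule entrance_plus_taboo) (use pow_measurable in auto)
  also have "\<dots> \<le> kop P (indicator D) x + taboo_op D (\<lambda>x. \<Sum>j<Suc n. (taboo_op D ^^ j) (kop P (indicator D)) x) x"
    using v1 mult_left_mono[OF v1, of "indicator D y" y for y]
    by (intro add_mono kop_mono taboo_op_mono Suc) simp
  also have "\<dots> = (\<Sum>j<Suc (Suc n). (taboo_op D ^^ j) (kop P (indicator D)) x)"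
    by (subst taboo_op_sum, simp, simp, subst sum.lessThan_Suc_shift) simp
  finally show ?case .
qed simp

text \<open>
  Every visit to \<open>C\<close> is followed, \<open>N\<close> steps later, by a visit to \<open>D\<close> with probability at least
  \<open>\<epsilon>\<close>, and at most \<open>N\<close> visits can be followed like this before the first entrance to \<open>D\<close>.
\<close>

lemma expected_visits_before_entrance:
  assumes D [measurable]: "D \<in> sets borel" and C [measurable]: "C \<in> sets borel"
    and N: "0 < N" and le: "\<And>y. y \<in> C \<Longrightarrow> \<epsilon> \<le> (kop P ^^ N) (indicator D) y"
  shows "\<epsilon> * (\<Sum>i. (taboo_op D ^^ i) (indicator C) x) \<le> of_nat N"
proof -
  let ?p = "kop P (indicator D)"
  have "\<epsilon> * (\<Sum>i<n. (taboo_op D ^^ i) (indicator C) x) \<le> of_nat N" for n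
  proof -
    have "\<epsilon> * (taboo_op D ^^ i) (indicator C) x \<le> (\<Sum>j<N. (taboo_op D ^^ (i + j)) ?p x)" for i
    proof -
      have "\<epsilon> * (taboo_op D ^^ i) (indicator C) x = (taboo_op D ^^ i) (\<lambda>y. \<epsilon> * indicator C y) x"
        by (simp add: taboo_pow_cmult)
      also have "\<dots> \<le> (taboo_op D ^^ i) (\<lambda>y. \<Sum>j<N. (taboo_op D ^^ j) ?p y) x"
      proof (rule taboo_pow_mono)
        fix y
        obtain n where n: "N = Suc n" using N gr0_implies_Suc by blast
        show "\<epsilon> * indicator C y \<le> (\<Sum>j<N. (taboo_op D ^^ j) ?p y)"
          using order_trans[OF le pow_le_taboo_entrances[OF D, of n y, folded n]]
          by (auto split: split_indicator)
      qed
      also have "\<dots> = (\<Sum>j<N. (taboo_op D ^^ (i + j)) ?p x)"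
        by (subst taboo_pow_sum) (auto simp: funpow_add)
      finally show ?thesis .
    qed
    then have "\<epsilon> * (\<Sum>i<n. (taboo_op D ^^ i) (indicator C) x) \<le> (\<Sum>i<n. \<Sum>j<N. (taboo_op D ^^ (i + j)) ?p x)"
      unfolding sum_distrib_left by (rule sum_mono)
    also have "\<dots> = (\<Sum>j<N. \<Sum>i<n. (taboo_op D ^^ (i + j)) ?p x)"
      by (rule sum.swap)
    also have "\<dots> \<le> (\<Sum>j<N. 1)"
      by (intro sum_mono sum_shift_le taboo_entrance_le_1 D)
    finally show ?thesis by simp
  qed
  then show ?thesis
    unfolding suminf_eq_SUP SUP_mult_left_ennreal by (intro SUP_least)
qed

end

section \<open>Integrating the conditional drift over the random cycles\<close>

locale random_time_drift = markov_chain F P Pr X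
  for F :: "enat \<Rightarrow> 'w measure" and P :: "'a::polish_space \<Rightarrow> 'a measure" and Pr X +
  fixes T :: "nat \<Rightarrow> 'w \<Rightarrow> enat" and V \<delta> f :: "'a \<Rightarrow> real" and C :: "'a set" and b :: real
  assumes stop: "\<And>z. stopping_time F (T z)"
    and T0: "\<And>\<omega>. \<omega> \<in> space (F \<infinity>) \<Longrightarrow> T 0 \<omega> = 0"
    and T_less: "\<And>x z. AE \<omega> in Pr x. T z \<omega> < T (Suc z) \<omega>"
    and V [measurable]: "V \<in> borel_measurable borel" and V_pos: "\<And>x. V x > 0"
    and \<delta> [measurable]: "\<delta> \<in> borel_measurable borel" and \<delta>_ge: "\<And>x. \<delta> x \<ge> 1"
    and f [measurable]: "f \<in> borel_measurable borel" and f_ge: "\<And>x. f x \<ge> 1"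
    and C [measurable]: "C \<in> sets borel"
    and drift_V: "\<And>x z. AE \<omega> in Pr x.
      enn2ereal (nn_cond_exp (Pr x) (filtration.pre_sigma (space (F \<infinity>)) F (T z))
          (\<lambda>\<omega>'. ennreal (V (at_time X (T (Suc z)) \<omega>'))) \<omega>)
        \<le> ereal (V (at_time X (T z) \<omega>) - \<delta> (at_time X (T z) \<omega>)
            + b * indicator C (at_time X (T z) \<omega>))"
    and drift_f: "\<And>x z. AE \<omega> in Pr x.
      nn_cond_exp (Pr x) (filtration.pre_sigma (space (F \<infinity>)) F (T z))
          (\<lambda>\<omega>'. \<Sum>k\<in>{the_enat (T z \<omega>')..<the_enat (T (Suc z) \<omega>')}. ennreal (f (X k \<omega>'))) \<omega>
        \<le> ennreal (\<delta> (at_time X (T z) \<omega>))"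
begin

lemma T_measurable [measurable]: "T z \<in> Pr x \<rightarrow>\<^sub>M count_space UNIV"
proof -
  have "T z \<in> F \<infinity> \<rightarrow>\<^sub>M borel"
    by (rule measurable_stopping_time[OF stop sets_F_mono space_F]) simp
  then have "T z -` {e} \<inter> space (F \<infinity>) \<in> sets (F \<infinity>)" for e
    by (rule measurable_sets) simp
  then show ?thesis
    by (simp add: measurable_count_space_eq2_countable sets_Pr)
qed

abbreviation XT :: "nat \<Rightarrow> 'w \<Rightarrow> 'a" where "XT z \<equiv> at_time X (T z)"

lemma at_time_measurable [measurable]: "at_time X (T z) \<in> Pr x \<rightarrow>\<^sub>M borel"
  unfolding at_time_def[abs_def]
  by (rule measurable_compose_countable[where g = "\<lambda>\<omega>. the_enat (T z \<omega>)"]) measurable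

lemma subalgebra_pre_sigma: "subalgebra (Pr x) (pre_sigma (T z))"
  unfolding subalgebra_def
proof
  show "space (pre_sigma (T z)) = space (Pr x)" by (simp add: space_pre_sigma)
  show "sets (pre_sigma (T z)) \<subseteq> sets (Pr x)"
  proof
    fix A assume "A \<in> sets (pre_sigma (T z))"
    from sets_pre_sigmaD[OF stop this, of \<infinity>] show "A \<in> sets (Pr x)"
      by (simp add: sets_Pr)
  qed
qed

text \<open>The event \<open>taboo D\<close> at the random time \<open>T z\<close>, in a form that
  makes sense for infinite \<open>T z\<close> as well.\<close>

definition before :: "'a set \<Rightarrow> nat \<Rightarrow> 'w set"
  where "before D z = {\<omega> \<in> space (F \<infinity>). \<forall>j\<ge>1. enat j \<le> T z \<omega> \<longrightarrow> X j \<omega> \<notin> D}"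

text \<open>This membership is what allows integrating the conditional expectations over the event.
  On \<open>T z \<le> t\<close> the condition concerns only indices \<open>j \<le> t\<close>, so it
  is decided by \<open>F t\<close>.\<close>

lemma before_pre_sigma:
  assumes [measurable]: "D \<in> sets borel"
  shows "before D z \<in> sets (pre_sigma (T z))"
proof -
  have "Measurable.pred (pre_sigma (T z)) (\<lambda>\<omega>. \<forall>j\<ge>1. enat j \<le> T z \<omega> \<longrightarrow> X j \<omega> \<notin> D)"
  proof (rule pred_pre_sigmaI[OF stop])
    fix t :: enat
    have "Measurable.pred (F t) (\<lambda>\<omega>. 1 \<le> j \<longrightarrow> enat j \<le> t \<longrightarrow> enat j \<le> T z \<omega> \<longrightarrow> X j \<omega> \<notin> D)" for j
    proof (cases "1 \<le> j \<and> enat j \<le> t")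
      case True
      have sub: "subalgebra (F t) (F (enat j))"
        unfolding subalgebra_def
      proof
        show "space (F (enat j)) = space (F t)" by (rule trans[OF space_F space_F[symmetric]])
        show "sets (F (enat j)) \<subseteq> sets (F t)" using True by (intro sets_F_mono) simp
      qed
      have "X j \<in> F t \<rightarrow>\<^sub>M borel"
        by (rule measurable_from_subalg[OF sub adapted])
      moreover have "Measurable.pred (F t) (\<lambda>\<omega>. T z \<omega> < enat j)"
        by (rule measurable_from_subalg[OF sub stopping_time_less_const[OF stop]])
      ultimately show ?thesis
        unfolding not_less[symmetric] using True by measurable
    qed auto
    moreover have "Measurable.pred (F t) (\<lambda>\<omega>. T z \<omega> \<le> t)"
      by (rule stopping_timeD[OF stop])
    ultimately have meas: "Measurable.pred (F t) (\<lambda>\<omega>. (\<forall>j. 1 \<le> j \<longrightarrow> enat j \<le> t \<longrightarrow> enat j \<le> T z \<omega> \<longrightarrow> X j \<omega> \<notin> D) \<and> T z \<omega> \<le> t)"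
      by (intro pred_intros_logic(3) pred_intros_countable(1))
    have eq: "((\<forall>j\<ge>1. enat j \<le> T z \<omega> \<longrightarrow> X j \<omega> \<notin> D) \<and> T z \<omega> \<le> t) =
        ((\<forall>j. 1 \<le> j \<longrightarrow> enat j \<le> t \<longrightarrow> enat j \<le> T z \<omega> \<longrightarrow> X j \<omega> \<notin> D) \<and> T z \<omega> \<le> t)" for \<omega>
      by (meson order_trans)
    show "Measurable.pred (F t) (\<lambda>\<omega>. (\<forall>j\<ge>1. enat j \<le> T z \<omega> \<longrightarrow> X j \<omega> \<notin> D) \<and> T z \<omega> \<le> t)"
      unfolding eq by (rule meas)
  qed
  then show ?thesis unfolding pred_def space_pre_sigma before_def .
qed

lemma before_Pr: "D \<in> sets borel \<Longrightarrow> before D z \<in> sets (Pr x)"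
  using before_pre_sigma[of D z] subalgebra_pre_sigma[of x z] by (auto simp: subalgebra_def)

lemma taboo_Pr [measurable]: "D \<in> sets borel \<Longrightarrow> taboo D n \<in> sets (Pr x)"
  by (rule sets_F_Pr[OF taboo_F])

lemma sigma_finite_pre_sigma: "sigma_finite_subalgebra (Pr x) (pre_sigma (T z))"
proof -
  interpret prob_space "Pr x" by (rule prob_Pr)
  interpret finite_measure_subalgebra "Pr x" "pre_sigma (T z)"
    by unfold_locales (rule subalgebra_pre_sigma)
  show ?thesis by (rule sigma_finite_subalgebra_axioms)
qed

abbreviation before_int :: "'a set \<Rightarrow> nat \<Rightarrow> 'a \<Rightarrow> ('w \<Rightarrow> ennreal) \<Rightarrow> ennreal"
  where "before_int D z x u \<equiv> \<integral>\<^sup>+ \<omega>. indicator (before D z) \<omega> * u \<omega> \<partial>Pr x"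

text \<open>\<open>before D z\<close> decreases in \<open>z\<close> almost surely, and the
  inequality for \<open>V\<close> may be integrated over it. Moving \<open>\<delta>\<close> to the
  left and replacing \<open>b\<close> by its absolute value keeps every term in
  \<open>ennreal\<close>.\<close>

lemma drift_step:
  assumes D: "D \<in> sets borel"
  shows "before_int D (Suc z) x (\<lambda>\<omega>. ennreal (V (XT (Suc z) \<omega>)))
      + before_int D z x (\<lambda>\<omega>. ennreal (\<delta> (XT z \<omega>)))
    \<le> before_int D z x (\<lambda>\<omega>. ennreal (V (XT z \<omega>)))
      + ennreal \<bar>b\<bar> * before_int D z x (\<lambda>\<omega>. indicator C (XT z \<omega>))"
proof -
  let ?V' = "\<lambda>\<omega>. ennreal (V (XT (Suc z) \<omega>))"
  let ?V = "\<lambda>\<omega>. ennreal (V (XT z \<omega>))"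
  let ?d = "\<lambda>\<omega>. ennreal (\<delta> (XT z \<omega>))"
  let ?C = "\<lambda>\<omega>. indicator C (XT z \<omega>)"
  note [measurable] = before_Pr[OF D]
  interpret sigma_finite_subalgebra "Pr x" "pre_sigma (T z)" by (rule sigma_finite_pre_sigma)
  let ?E = "nn_cond_exp (Pr x) (pre_sigma (T z)) (\<lambda>\<omega>'. ennreal (V (XT (Suc z) \<omega>')))"
  have E [measurable]: "?E \<in> borel_measurable (Pr x)"
    by (rule borel_measurable_nn_cond_exp2)
  have "before_int D (Suc z) x ?V'
      \<le> before_int D z x ?V'"
  proof (rule nn_integral_mono_AE)
    show "AE \<omega> in Pr x. indicator (before D (Suc z)) \<omega> * ennreal (V (XT (Suc z) \<omega>))
        \<le> indicator (before D z) \<omega> * ennreal (V (XT (Suc z) \<omega>))"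
      using T_less[of z x]
    proof eventually_elim
      case (elim \<omega>)
      then have "\<omega> \<in> before D (Suc z) \<Longrightarrow> \<omega> \<in> before D z"
        unfolding before_def using order_trans[OF _ less_imp_le[OF elim]] by blast
      then show ?case by (auto split: split_indicator)
    qed
  qed
  also have "\<dots> = before_int D z x ?E"
    by (rule nn_cond_exp_intg[symmetric]) (use before_pre_sigma[OF D, of z] in auto)
  finally have "before_int D (Suc z) x ?V'
      + before_int D z x ?d
    \<le> before_int D z x ?E
      + before_int D z x ?d"
    by (rule add_right_mono)
  also have "\<dots> = before_int D z x (\<lambda>\<omega>. (?E \<omega> + ennreal (\<delta> (XT z \<omega>))))"
    by (simp add: nn_integral_add[symmetric] distrib_left)
  also have "\<dots> \<le> before_int D z x (\<lambda>\<omega>. (ennreal (V (XT z \<omega>)) + ennreal \<bar>b\<bar> * indicator C (XT z \<omega>)))"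
  proof (rule nn_integral_mono_AE)
    show "AE \<omega> in Pr x. indicator (before D z) \<omega> * (?E \<omega> + ennreal (\<delta> (XT z \<omega>)))
      \<le> indicator (before D z) \<omega> * (ennreal (V (XT z \<omega>)) + ennreal \<bar>b\<bar> * indicator C (XT z \<omega>))"
      using drift_V[of x z]
    proof eventually_elim
      case (elim \<omega>)
      let ?y = "XT z \<omega>"
      let ?r = "V ?y - \<delta> ?y + b * indicator C ?y"
      \<comment> \<open>The hypothesis is an inequality in \<open>ereal\<close>, so its right-hand
        side dominates a nonnegative quantity and is not truncated when read in
        \<open>ennreal\<close>.\<close>
      have r0: "0 \<le> ?r"
        using order_trans[OF enn2ereal_nonneg elim] by simp
      have "?E \<omega> \<le> ennreal ?r"
        using elim r0 by (simp add: less_eq_ennreal.rep_eq enn2ereal_ennreal)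
      then have "?E \<omega> + ennreal (\<delta> ?y) \<le> ennreal ?r + ennreal (\<delta> ?y)"
        by (rule add_right_mono)
      also have "\<dots> = ennreal (V ?y + b * indicator C ?y)"
        using r0 \<delta>_ge[of ?y] by (simp flip: ennreal_plus)
      also have "\<dots> \<le> ennreal (V ?y + \<bar>b\<bar> * indicator C ?y)"
        by (intro ennreal_leI add_left_mono mult_right_mono) auto
      also have "\<dots> = ennreal (V ?y) + ennreal \<bar>b\<bar> * indicator C ?y"
        using V_pos[of ?y] by (auto simp: ennreal_plus split: split_indicator)
      finally show ?case by (rule mult_left_mono) simp
    qed
  qed
  also have "\<dots> = before_int D z x ?V
      + ennreal \<bar>b\<bar> * before_int D z x ?C"
    by (simp add: distrib_left nn_integral_add nn_integral_cmult mult.left_commute)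
  finally show ?thesis .
qed

definition cycle :: "nat \<Rightarrow> 'w \<Rightarrow> ennreal"
  where "cycle z \<omega> = (\<Sum>k\<in>{the_enat (T z \<omega>)..<the_enat (T (Suc z) \<omega>)}. ennreal (f (X k \<omega>)))"

lemma cycle_measurable [measurable]: "cycle z \<in> borel_measurable (Pr x)"
proof -
  have "(\<lambda>\<omega>. \<Sum>k\<in>{i..<j}. ennreal (f (X k \<omega>))) \<in> borel_measurable (Pr x)" for i j
    by measurable
  then have "(\<lambda>\<omega>. \<Sum>k\<in>{the_enat (T z \<omega>)..<j}. ennreal (f (X k \<omega>))) \<in> borel_measurable (Pr x)" for j
    by (rule measurable_compose_countable[where g = "\<lambda>\<omega>. the_enat (T z \<omega>)"]) measurable
  then show ?thesis
    unfolding cycle_def[abs_def]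
    by (rule measurable_compose_countable[where g = "\<lambda>\<omega>. the_enat (T (Suc z) \<omega>)"]) measurable
qed

lemma cycle_le:
  assumes D: "D \<in> sets borel"
  shows "before_int D z x (cycle z)
    \<le> before_int D z x (\<lambda>\<omega>. ennreal (\<delta> (XT z \<omega>)))"
proof -
  interpret sigma_finite_subalgebra "Pr x" "pre_sigma (T z)" by (rule sigma_finite_pre_sigma)
  have "before_int D z x (cycle z)
      = before_int D z x (\<lambda>\<omega>. nn_cond_exp (Pr x) (pre_sigma (T z)) (cycle z) \<omega>)"
    by (rule nn_cond_exp_intg[symmetric]) (use before_pre_sigma[OF D, of z] in auto)
  also have "\<dots> \<le> before_int D z x (\<lambda>\<omega>. ennreal (\<delta> (XT z \<omega>)))"
  proof (rule nn_integral_mono_AE)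
    have "AE \<omega> in Pr x. nn_cond_exp (Pr x) (pre_sigma (T z)) (cycle z) \<omega> \<le> ennreal (\<delta> (XT z \<omega>))"
      using drift_f[of x z] unfolding cycle_def[abs_def] .
    then show "AE \<omega> in Pr x. indicator (before D z) \<omega> * nn_cond_exp (Pr x) (pre_sigma (T z)) (cycle z) \<omega>
        \<le> indicator (before D z) \<omega> * ennreal (\<delta> (XT z \<omega>))"
      by eventually_elim (rule mult_left_mono, simp_all)
  qed
  finally show ?thesis .
qed

text \<open>\<open>\<delta>\<close> links the two hypotheses: outside \<open>C\<close> the function
  \<open>V\<close> drops on average by at least \<open>\<delta>\<close> per cycle, and
  \<open>\<delta>\<close> bounds the expected sum of \<open>f\<close> over that cycle. Summation
  telescopes \<open>V\<close>.\<close>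

lemma cycles_le:
  assumes D: "D \<in> sets borel"
  shows "(\<Sum>z<n. before_int D z x (cycle z))
    \<le> ennreal (V x) + ennreal \<bar>b\<bar> * (\<Sum>z<n. before_int D z x (\<lambda>\<omega>. indicator C (XT z \<omega>)))"
proof -
  let ?V = "\<lambda>z. before_int D z x (\<lambda>\<omega>. ennreal (V (XT z \<omega>)))"
  let ?s = "\<lambda>z. before_int D z x (cycle z)"
  let ?c = "\<lambda>z. before_int D z x (\<lambda>\<omega>. indicator C (XT z \<omega>))"
  have "?V n + (\<Sum>z<n. ?s z) \<le> ennreal (V x) + ennreal \<bar>b\<bar> * (\<Sum>z<n. ?c z)"
  proof (induction n)
    case 0
    interpret prob_space "Pr x" by (rule prob_Pr)
    have "?V 0 \<le> (\<integral>\<^sup>+ \<omega>. ennreal (V x) \<partial>Pr x)"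
    proof (rule nn_integral_mono_AE)
      show "AE \<omega> in Pr x. indicator (before D 0) \<omega> * ennreal (V (XT 0 \<omega>)) \<le> ennreal (V x)"
        using initial[of x] AE_space[of "Pr x"]
        by eventually_elim (auto simp: at_time_def T0 zero_enat_def split: split_indicator)
    qed
    then show ?case using emeasure_space_1 by simp
  next
    case (Suc n)
    have "?V (Suc n) + ?s n \<le> ?V n + ennreal \<bar>b\<bar> * ?c n"
      using drift_step[OF D, where z = n and x = x] cycle_le[OF D, where z = n and x = x] by (meson add_left_mono order_trans)
    then have "?V (Suc n) + ?s n + (\<Sum>z<n. ?s z) \<le> ?V n + ennreal \<bar>b\<bar> * ?c n + (\<Sum>z<n. ?s z)"
      by (rule add_right_mono)
    also have "\<dots> \<le> ennreal (V x) + ennreal \<bar>b\<bar> * (\<Sum>z<n. ?c z) + ennreal \<bar>b\<bar> * ?c n"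
      using add_right_mono[OF Suc, of "ennreal \<bar>b\<bar> * ?c n"] by (simp add: ac_simps)
    finally show ?case by (simp add: ac_simps distrib_left)
  qed
  then show ?thesis by (rule order_trans[rotated]) simp
qed

lemma random_times:
  "AE \<omega> in Pr x. \<exists>t. strict_mono t \<and> t 0 = 0 \<and> (\<forall>z. T z \<omega> = enat (t z))"
proof -
  have "AE \<omega> in Pr x. \<forall>z. T z \<omega> < T (Suc z) \<omega>"
    using T_less by (simp add: AE_all_countable)
  with AE_space[of "Pr x"] show ?thesis
  proof eventually_elim
    case (elim \<omega>)
    have "\<exists>n. T z \<omega> = enat n" for z
      using elim(2)[rule_format, of z] by (cases "T z \<omega>") auto
    then obtain t where t: "\<And>z. T z \<omega> = enat (t z)" by metis
    have "strict_mono t"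
      using elim(2) by (simp add: strict_mono_Suc_iff t)
    moreover have "t 0 = 0" using T0[of \<omega>] elim(1) t[of 0] by (simp add: zero_enat_def)
    ultimately show ?case using t by blast
  qed
qed

lemma before_iff_taboo: "T z \<omega> = enat n \<Longrightarrow> \<omega> \<in> before D z \<longleftrightarrow> \<omega> \<in> taboo D n"
  by (auto simp: before_def taboo_def)

lemma taboo_antimono: "m \<le> n \<Longrightarrow> taboo D n \<subseteq> taboo D m"
  by (auto simp: taboo_def)

text \<open>The random times disappear here. The sum of \<open>f\<close> until the entrance to
  \<open>D\<close> is at most the sum over the cycles begun before it, and the cycle starts in
  \<open>C\<close> are among all visits to \<open>C\<close> before it.\<close>

theorem taboo_potential_le:
  assumes D [measurable]: "D \<in> sets borel"
  shows "(\<Sum>k. (taboo_op D ^^ k) (\<lambda>y. ennreal (f y)) x)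
    \<le> ennreal (V x) + ennreal \<bar>b\<bar> * (\<Sum>k. (taboo_op D ^^ k) (indicator C) x)"
proof -
  note [measurable] = before_Pr[OF D]
  have "(\<Sum>k<n. (taboo_op D ^^ k) (\<lambda>y. ennreal (f y)) x)
    \<le> ennreal (V x) + ennreal \<bar>b\<bar> * (\<Sum>k. (taboo_op D ^^ k) (indicator C) x)" for n
  proof -
    have "(\<Sum>k<n. (taboo_op D ^^ k) (\<lambda>y. ennreal (f y)) x)
        = (\<integral>\<^sup>+ \<omega>. (\<Sum>k<n. indicator (taboo D k) \<omega> * ennreal (f (X k \<omega>))) \<partial>Pr x)"
      by (subst nn_integral_sum) (auto intro!: sum.cong nn_integral_taboo[symmetric])
    also have "\<dots> \<le> (\<integral>\<^sup>+ \<omega>. (\<Sum>z<n. indicator (before D z) \<omega> * cycle z \<omega>) \<partial>Pr x)"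
    proof (rule nn_integral_mono_AE)
      show "AE \<omega> in Pr x. (\<Sum>k<n. indicator (taboo D k) \<omega> * ennreal (f (X k \<omega>)))
          \<le> (\<Sum>z<n. indicator (before D z) \<omega> * cycle z \<omega>)"
        using random_times[of x]
      proof eventually_elim
        case (elim \<omega>)
        then obtain t where t: "strict_mono t" "t 0 = 0" "\<And>z. T z \<omega> = enat (t z)" by blast
        let ?g = "\<lambda>k. indicator (taboo D k) \<omega> * ennreal (f (X k \<omega>))"
        \<comment> \<open>As \<open>t n \<ge> n\<close>, the first \<open>n\<close> cycles cover the
          first \<open>n\<close> times.\<close>
        have "(\<Sum>k<n. ?g k) \<le> (\<Sum>k<t n. ?g k)"
          using strict_mono_imp_increasing[OF t(1), of n] by (intro sum_mono2) auto
        also have "\<dots> = (\<Sum>z<n. \<Sum>k\<in>{t z..<t (Suc z)}. ?g k)"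
        proof (induction n)
          case (Suc n)
          have "t n \<le> t (Suc n)" using t(1) by (simp add: strict_mono_less_eq)
          then have *: "{..<t (Suc n)} = {..<t n} \<union> {t n..<t (Suc n)}" by auto
          have "(\<Sum>k<t (Suc n). ?g k) = (\<Sum>k<t n. ?g k) + (\<Sum>k\<in>{t n..<t (Suc n)}. ?g k)"
            unfolding * by (rule sum.union_disjoint) auto
          then show ?case using Suc by simp
        qed (simp add: t)
        also have "\<dots> \<le> (\<Sum>z<n. indicator (before D z) \<omega> * cycle z \<omega>)"
        proof (rule sum_mono)
          fix z
          have "(\<Sum>k\<in>{t z..<t (Suc z)}. ?g k) \<le> (\<Sum>k\<in>{t z..<t (Suc z)}. indicator (before D z) \<omega> * ennreal (f (X k \<omega>)))"
          proof (intro sum_mono mult_right_mono)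
            fix k assume "k \<in> {t z..<t (Suc z)}"
            \<comment> \<open>A path avoiding \<open>D\<close> up to \<open>k\<close> avoids it up
              to the start \<open>t z\<close> of the cycle of \<open>k\<close>. The whole cycle is
              then charged, even if \<open>D\<close> is entered within it.\<close>
            then have "\<omega> \<in> taboo D k \<Longrightarrow> \<omega> \<in> before D z"
              using taboo_antimono[of "t z" k D] before_iff_taboo[OF t(3), of D z] by auto
            then show "indicator (taboo D k) \<omega> \<le> (indicator (before D z) \<omega> :: ennreal)"
              by (auto split: split_indicator)
          qed simp
          also have "\<dots> = indicator (before D z) \<omega> * cycle z \<omega>"
            by (simp add: cycle_def t sum_distrib_left)
          finally show "(\<Sum>k\<in>{t z..<t (Suc z)}. ?g k) \<le> indicator (before D z) \<omega> * cycle z \<omega>" .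
        qed
        finally show ?case .
      qed
    qed
    also have "\<dots> = (\<Sum>z<n. before_int D z x (cycle z))"
      by (rule nn_integral_sum) measurable
    also have "\<dots> \<le> ennreal (V x) + ennreal \<bar>b\<bar> * (\<Sum>z<n. before_int D z x (\<lambda>\<omega>. indicator C (XT z \<omega>)))"
      by (rule cycles_le[OF D])
    also have "(\<Sum>z<n. before_int D z x (\<lambda>\<omega>. indicator C (XT z \<omega>)))
        = (\<integral>\<^sup>+ \<omega>. (\<Sum>z<n. indicator (before D z) \<omega> * indicator C (XT z \<omega>)) \<partial>Pr x)"
      by (rule nn_integral_sum[symmetric]) measurable
    also have "\<dots> \<le> (\<integral>\<^sup>+ \<omega>. (\<Sum>k. indicator (taboo D k) \<omega> * indicator C (X k \<omega>)) \<partial>Pr x)"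
    proof (rule nn_integral_mono_AE)
      show "AE \<omega> in Pr x. (\<Sum>z<n. indicator (before D z) \<omega> * indicator C (XT z \<omega>))
          \<le> (\<Sum>k. indicator (taboo D k) \<omega> * indicator C (X k \<omega>) :: ennreal)"
        using random_times[of x]
      proof eventually_elim
        case (elim \<omega>)
        then obtain t where t: "strict_mono t" "t 0 = 0" "\<And>z. T z \<omega> = enat (t z)" by blast
        let ?g = "\<lambda>k. indicator (taboo D k) \<omega> * indicator C (X k \<omega>) :: ennreal"
        have "(\<Sum>z<n. indicator (before D z) \<omega> * indicator C (XT z \<omega>)) = (\<Sum>z<n. ?g (t z))"
          using before_iff_taboo[OF t(3), of D] by (intro sum.cong) (auto simp: at_time_def t(3) split: split_indicator)
        also have "\<dots> = (\<Sum>k\<in>t ` {..<n}. ?g k)"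
          by (subst sum.reindex) (auto intro: inj_on_subset[OF strict_mono_imp_inj_on[OF t(1)]])
        also have "\<dots> \<le> (\<Sum>k. ?g k)" by (intro sum_le_suminf) auto
        finally show ?case .
      qed
    qed
    also have "\<dots> = (\<Sum>k. (taboo_op D ^^ k) (indicator C) x)"
      by (subst nn_integral_suminf) (auto intro!: suminf_cong nn_integral_taboo)
    finally show ?thesis by (simp add: add_left_mono mult_left_mono)
  qed
  then show ?thesis by (subst suminf_eq_SUP) (rule SUP_least)
qed

end

section \<open>Positive Harris recurrence and ergodicity\<close>

lemma return_time_less_infinity: "return_time X A \<omega> < \<infinity> \<longleftrightarrow> (\<exists>t\<ge>1. X t \<omega> \<in> A)"
  unfolding return_time_def Inf_less_iff by auto

text \<open>Countably many sets of this form cover the space, so one of them is charged. This turns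
  positivity at each state into a uniform lower bound on a set of positive measure.\<close>

lemma exhaustion_charged:
  fixes u :: "nat \<Rightarrow> 'a::topological_space \<Rightarrow> ennreal"
  assumes M: "sets M = sets borel" "0 < emeasure M UNIV"
    and u: "\<And>n. u n \<in> borel_measurable borel" and pos: "\<And>x. \<exists>n. 0 < u n x" and S: "\<And>k. S k \<in> sets borel"
    and cover: "\<And>x. \<exists>k::nat. x \<in> S k"
  obtains n m k where "0 < emeasure M ({x. ennreal (1 / real (Suc m)) \<le> u n x} \<inter> S k)"
proof -
  let ?A = "\<lambda>(n, m, k). {x. ennreal (1 / real (Suc m)) \<le> u n x} \<inter> S k"
  have A: "?A i \<in> sets M" for i
  proof (cases i)
    case (fields n m k)
    have "{x. ennreal (1 / real (Suc m)) \<le> u n x} \<in> sets borel"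
      using u[of n] by (intro Collect_borel) measurable
    then show ?thesis using S[of k] by (simp add: fields M)
  qed
  have "\<exists>i. x \<in> ?A i" for x
  proof -
    obtain n k where n: "0 < u n x" "x \<in> S k" using pos cover by metis
    have "\<exists>m. ennreal (1 / real (Suc m)) \<le> u n x"
    proof (cases "u n x")
      case (real r)
      then obtain m where "1 / real (Suc m) < r" using n nat_approx_posE[of r] by auto
      then show ?thesis using real by (auto intro!: exI[of _ m] ennreal_leI)
    qed auto
    then show ?thesis using n by auto
  qed
  then have "(\<Union>i. ?A i) = UNIV" by (simp only: set_eq_iff UN_iff) blast
  moreover have "emeasure M (\<Union>i. ?A i) = 0" if "\<And>i. emeasure M (?A i) = 0"
    using null_sets_UN[of ?A M] that A by (auto simp: null_sets_def)
  ultimately obtain i where "emeasure M (?A i) \<noteq> 0" using M(2) by (metis less_irrefl)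
  then show ?thesis using that by (cases i) (auto simp: zero_less_iff_neq_zero)
qed

section \<open>From random times to a one-step drift\<close>

context random_time_drift
begin

text \<open>
  \<open>C\<close> itself cannot serve as regeneration set: \<open>V\<close> may be unbounded on it, and its minorizing measure
  may not charge it. \<open>B\<close> consists of the states of a sublevel set of \<open>V\<close> from which \<open>C\<close> is reached in a
  fixed number of steps with probability bounded below.
\<close>

lemma regeneration_set:
  assumes small: "small_set P C"
  obtains B N \<mu> c where "B \<in> sets borel" "B \<noteq> {}" "0 < N" "sets \<mu> = sets borel" "0 < emeasure \<mu> UNIV"
    "\<And>x A. x \<in> B \<Longrightarrow> A \<in> sets borel \<Longrightarrow> emeasure \<mu> A \<le> emeasure (nstep P N x) A"
    "\<And>x. (\<Sum>k. (taboo_op B ^^ k) (\<lambda>y. ennreal (f y)) x) < \<infinity>"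
    "c < \<infinity>" "\<And>x. x \<in> B \<Longrightarrow> (\<Sum>k. (taboo_op B ^^ k) (\<lambda>y. ennreal (f y)) x) \<le> c"
    "\<And>x. \<exists>n. 0 < (kop P ^^ n) (indicator B) x"
proof -
  obtain n0 \<nu> where n0: "1 \<le> n0" and \<nu>: "sets \<nu> = sets borel" "0 < emeasure \<nu> UNIV"
    and minor: "\<And>x A. x \<in> C \<Longrightarrow> A \<in> sets borel \<Longrightarrow> emeasure \<nu> A \<le> emeasure (nstep P n0 x) A"
    using small unfolding small_set_def by blast
  \<comment> \<open>If \<open>C\<close> were never reached, the bound with \<open>D = {}\<close>
    would make the sum of all \<open>P^k f\<close> at most \<open>V x\<close>, although each term is
    at least 1.\<close>
  have visit: "\<exists>n. 0 < (kop P ^^ n) (indicator C) x" for x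
  proof (rule ccontr)
    assume "\<not> ?thesis"
    then have "(kop P ^^ n) (indicator C) x = 0" for n by (auto simp: zero_less_iff_neq_zero)
    then have le: "(\<Sum>k. (kop P ^^ k) (\<lambda>y. ennreal (f y)) x) \<le> ennreal (V x)"
      using taboo_potential_le[of "{}" x] by (simp add: taboo_op_empty)
    have "of_nat n \<le> ennreal (V x)" for n
    proof -
      have "of_nat n = (\<Sum>k<n. (kop P ^^ k) (\<lambda>y. 1) x)" by simp
      also have "\<dots> \<le> (\<Sum>k<n. (kop P ^^ k) (\<lambda>y. ennreal (f y)) x)"
        using f_ge by (intro sum_mono pow_mono) (simp add: ennreal_ge_1)
      also have "\<dots> \<le> (\<Sum>k. (kop P ^^ k) (\<lambda>y. ennreal (f y)) x)"
        by (intro sum_le_suminf) auto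
      finally show ?thesis using le by (rule order_trans)
    qed
    then have "real n \<le> V x" for n
      using V_pos[of x] by (metis ennreal_le_iff ennreal_of_nat_eq_real_of_nat less_imp_le)
    then show False using reals_Archimedean2[of "V x"] by (auto simp: not_le[symmetric])
  qed
  have C_ne: "C \<noteq> {}"
  proof
    assume "C = {}"
    then have "(kop P ^^ n) (indicator C) x = 0" for n x using pow_const[of n 0] by (simp add: indicator_def[abs_def])
    then show False using visit[of undefined] by simp
  qed
  have S: "{x. V x \<le> real k} \<in> sets borel" for k
    by (rule Collect_borel) measurable
  obtain n m k where pos: "0 < emeasure \<nu> ({x. ennreal (1 / real (Suc m)) \<le> (kop P ^^ n) (indicator C) x} \<inter> {x. V x \<le> real k})"
    by (rule exhaustion_charged[OF \<nu>, of "\<lambda>n. (kop P ^^ n) (indicator C)" "\<lambda>k. {x. V x \<le> real k}"])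
      (auto intro!: visit real_arch_simple S[simplified])
  define B where "B = {x. ennreal (1 / real (Suc m)) \<le> (kop P ^^ n) (indicator C) x} \<inter> {x. V x \<le> real k}"
  define e where "e = ennreal (1 / real (Suc m))"
  have e: "0 < e" "e < \<infinity>" by (auto simp: e_def)
  have B [measurable]: "B \<in> sets borel"
    unfolding B_def by (intro sets.Int S Collect_borel) measurable
  have C_le: "indicator C y * emeasure \<nu> A \<le> (kop P ^^ n0) (indicator A) y" if "A \<in> sets borel" for A y
    using minor[of y A] that by (auto simp: emeasure_nstep split: split_indicator)
  have \<nu>B: "0 < emeasure \<nu> B" using pos by (simp add: B_def)
  have \<nu>_fin: "emeasure \<nu> A \<le> 1" if [measurable]: "A \<in> sets borel" for A
  proof -
    obtain y where "y \<in> C" using C_ne by auto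
    then have "emeasure \<nu> A \<le> (kop P ^^ n0) (indicator A) y" using C_le[of A y] by simp
    also have "\<dots> \<le> 1" by (rule pow_indicator_le_1)
    finally show ?thesis .
  qed
  define c where "c = of_nat n0 / emeasure \<nu> B"
  have c: "c < \<infinity>" using \<nu>B by (auto simp: c_def less_top[symmetric] ennreal_divide_eq_top_iff)
  have visits: "(\<Sum>i. (taboo_op B ^^ i) (indicator C) x) \<le> c" for x
  proof -
    have "emeasure \<nu> B * (\<Sum>i. (taboo_op B ^^ i) (indicator C) x) \<le> of_nat n0"
    proof (rule expected_visits_before_entrance[OF B C])
      show "emeasure \<nu> B \<le> (kop P ^^ n0) (indicator B) y" if "y \<in> C" for y
        using C_le[OF B, of y] that by simp
    qed (use n0 in simp)
    then have "(\<Sum>i. (taboo_op B ^^ i) (indicator C) x) * emeasure \<nu> B / emeasure \<nu> B \<le> c"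
      unfolding c_def by (intro divide_right_mono_ennreal) (simp add: mult.commute)
    then show ?thesis
      using \<nu>B \<nu>_fin[OF B] by (subst (asm) ennreal_mult_divide_eq) (auto simp: top_unique)
  qed
  have pot: "(\<Sum>k. (taboo_op B ^^ k) (\<lambda>y. ennreal (f y)) x) \<le> ennreal (V x) + ennreal \<bar>b\<bar> * c" for x
    by (rule order_trans[OF taboo_potential_le[OF B]]) (intro add_left_mono mult_left_mono visits, simp)
  have bc: "ennreal \<bar>b\<bar> * c < \<infinity>" using c by (simp add: ennreal_mult_less_top)
  show ?thesis
  \<comment> \<open>From \<open>B\<close> the set \<open>C\<close> is reached in \<open>n\<close>
    steps with probability at least \<open>e\<close>, and from \<open>C\<close> another
    \<open>n0\<close> steps dominate \<open>\<nu>\<close>. The summand \<open>real k\<close> bounds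
    \<open>V\<close> on \<open>B\<close>.\<close>
  proof (rule that[of B "n + n0" "scale_measure e \<nu>" "ennreal (real k) + ennreal \<bar>b\<bar> * c"])
    show "B \<noteq> {}" using \<nu>B by auto
    show "0 < n + n0" using n0 by simp
    show "0 < emeasure (scale_measure e \<nu>) UNIV"
      using e \<nu>(2) by (simp add: ennreal_zero_less_mult_iff)
    show "emeasure (scale_measure e \<nu>) A \<le> emeasure (nstep P (n + n0) x) A" if "x \<in> B" "A \<in> sets borel" for x A
    proof -
      have "emeasure (scale_measure e \<nu>) A = e * emeasure \<nu> A" by simp
      also have "\<dots> \<le> (kop P ^^ n) (indicator C) x * emeasure \<nu> A"
        using that(1) by (intro mult_right_mono) (simp_all add: B_def e_def)
      also have "\<dots> = (kop P ^^ n) (\<lambda>y. emeasure \<nu> A * indicator C y) x"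
        by (subst pow_cmult) (simp_all add: mult.commute)
      also have "\<dots> \<le> (kop P ^^ n) ((kop P ^^ n0) (indicator A)) x"
        using C_le[OF that(2)] by (intro pow_mono) (simp add: mult.commute)
      finally show ?thesis using that(2) by (simp add: emeasure_nstep funpow_add)
    qed
    show "(\<Sum>k. (taboo_op B ^^ k) (\<lambda>y. ennreal (f y)) x) < \<infinity>" for x
      using pot[of x] bc by (auto intro: le_less_trans)
    show "ennreal (real k) + ennreal \<bar>b\<bar> * c < \<infinity>" using bc by simp
    show "(\<Sum>k. (taboo_op B ^^ k) (\<lambda>y. ennreal (f y)) x) \<le> ennreal (real k) + ennreal \<bar>b\<bar> * c" if "x \<in> B" for x
    proof -
      have "V x \<le> real k" using that by (simp add: B_def)
      then show ?thesis by (intro order_trans[OF pot] add_right_mono ennreal_leI)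
    qed
    \<comment> \<open>Every state leads to \<open>C\<close>, and \<open>C\<close> leads to
      \<open>B\<close> because \<open>\<nu>\<close> charges \<open>B\<close>.\<close>
    show "\<exists>j. 0 < (kop P ^^ j) (indicator B) x" for x
    proof -
      obtain j where j: "0 < (kop P ^^ j) (indicator C) x" using visit by blast
      have "0 < emeasure \<nu> B * (kop P ^^ j) (indicator C) x"
        using j \<nu>B by (simp add: ennreal_zero_less_mult_iff)
      also have "\<dots> = (kop P ^^ j) (\<lambda>y. emeasure \<nu> B * indicator C y) x"
        by (simp add: pow_cmult)
      also have "\<dots> \<le> (kop P ^^ j) ((kop P ^^ n0) (indicator B)) x"
        using C_le[OF B] by (intro pow_mono) (simp add: mult.commute)
      finally show ?thesis by (intro exI[of _ "j + n0"]) (simp add: funpow_add)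
    qed
  qed (use \<nu> in auto)
qed

text \<open>The potential \<open>h\<close> of \<open>f\<close> with taboo set \<open>B\<close>
  solves \<open>h = P W + f\<close>, where \<open>W\<close> is \<open>h\<close> off \<open>B\<close>
  and 0 on \<open>B\<close>. Off \<open>B\<close> this is the drift condition with equality; on
  \<open>B\<close> the left side is bounded by \<open>c\<close>.\<close>

theorem ergodic_measure:
  assumes small: "small_set P C"
    and \<phi>: "sets \<phi> = sets borel" "0 < emeasure \<phi> UNIV" and aper: "aperiodic_chain P \<phi>"
  obtains \<pi> where "prob_space \<pi>" "sets \<pi> = sets borel"
    "\<And>u. u \<in> borel_measurable borel \<Longrightarrow> (\<integral>\<^sup>+ x. kop P u x \<partial>\<pi>) = (\<integral>\<^sup>+ x. u x \<partial>\<pi>)"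
    "(\<integral>\<^sup>+ x. ennreal (f x) \<partial>\<pi>) < \<infinity>"
    "\<And>g x. g \<in> borel_measurable borel \<Longrightarrow> \<forall>x. g x \<le> ennreal (f x) \<Longrightarrow>
      (\<lambda>n. (kop P ^^ n) g x) \<longlonglongrightarrow> (\<integral>\<^sup>+ x. g x \<partial>\<pi>)"
    "\<And>n x. (kop P ^^ n) (\<lambda>y. ennreal (f y)) x < \<infinity>"
proof -
  let ?f = "\<lambda>y. ennreal (f y)"
  obtain B N \<mu> c where B [measurable]: "B \<in> sets borel" and B_ne: "B \<noteq> {}" and N: "0 < N"
    and \<mu>: "sets \<mu> = sets borel" "0 < emeasure \<mu> UNIV"
    and minor: "\<And>x A. x \<in> B \<Longrightarrow> A \<in> sets borel \<Longrightarrow> emeasure \<mu> A \<le> emeasure (nstep P N x) A"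
    and fin: "\<And>x. (\<Sum>k. (taboo_op B ^^ k) ?f x) < \<infinity>"
    and c: "c < \<infinity>" "\<And>x. x \<in> B \<Longrightarrow> (\<Sum>k. (taboo_op B ^^ k) ?f x) \<le> c"
    and visit: "\<And>x. \<exists>n. 0 < (kop P ^^ n) (indicator B) x"
    by (rule regeneration_set[OF small]) (rule that, assumption+)
  define h where "h x = (\<Sum>k. (taboo_op B ^^ k) ?f x)" for x
  define W where "W x = indicator (- B) x * h x" for x
  have h [measurable]: "h \<in> borel_measurable borel" unfolding h_def by measurable
  have h_eq: "h x = kop P W x + ?f x" for x
  proof -
    have "h x = (\<Sum>k. (taboo_op B ^^ Suc k) ?f x) + ?f x"
      unfolding h_def by (subst suminf_offset[of _ 1]) (simp_all add: add.commute)
    also have "(\<Sum>k. (taboo_op B ^^ Suc k) ?f x) = taboo_op B h x"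
      unfolding h_def[abs_def] by (subst taboo_op_suminf) simp_all
    finally show ?thesis by (simp add: taboo_op_def W_def[abs_def])
  qed
  \<comment> \<open>Aperiodicity speaks of sets charged by \<open>\<phi>\<close>, and
    \<open>B\<close> need not be one. The set \<open>D\<close> is charged and leads to
    \<open>B\<close> in \<open>k\<close> steps with probability bounded below.\<close>
  obtain D k m where D: "D = {x. ennreal (1 / real (Suc m)) \<le> (kop P ^^ k) (indicator B) x}"
    and D_pos: "0 < emeasure \<phi> D"
    by (rule exhaustion_charged[OF \<phi>, of "\<lambda>n. (kop P ^^ n) (indicator B)" "\<lambda>_. UNIV"])
      (use visit in auto)
  have D_sets: "D \<in> sets borel"
    unfolding D by (rule Collect_borel) measurable
  have aperiodic: "\<forall>\<^sub>F n in sequentially. 0 < (kop P ^^ n) (indicator B) x" for x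
  proof -
    obtain n0 where n0: "\<And>n. n0 \<le> n \<Longrightarrow> 0 < measure (nstep P n x) D"
      using aper D_sets D_pos unfolding aperiodic_chain_def by blast
    have "0 < (kop P ^^ n) (indicator B) x" if "n0 + k \<le> n" for n
    proof -
      have "0 < measure (nstep P (n - k) x) D" using that by (intro n0) simp
      then have "emeasure (nstep P (n - k) x) D \<noteq> 0" by (auto simp: measure_def)
      then have "(kop P ^^ (n - k)) (indicator D) x \<noteq> 0"
        by (simp add: emeasure_nstep D_sets)
      then have "0 < ennreal (1 / real (Suc m)) * (kop P ^^ (n - k)) (indicator D) x"
        by (simp add: ennreal_zero_less_mult_iff zero_less_iff_neq_zero)
      also have "\<dots> = (kop P ^^ (n - k)) (\<lambda>y. ennreal (1 / real (Suc m)) * indicator D y) x"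
        using D_sets by (simp add: pow_cmult)
      also have "\<dots> \<le> (kop P ^^ (n - k)) ((kop P ^^ k) (indicator B)) x"
        by (rule pow_mono) (auto simp: D split: split_indicator)
      also have "\<dots> = (kop P ^^ n) (indicator B) x"
        using that by (simp flip: funpow_add[THEN fun_cong, unfolded comp_def])
      finally show ?thesis .
    qed
    then show ?thesis by (auto simp: eventually_sequentially)
  qed
  interpret drift_chain P B N \<mu> ?f W c
  proof
    show "W x < \<infinity>" for x using fin[of x] by (auto simp: W_def h_def split: split_indicator)
    show "kop P W x + ?f x \<le> W x + c * indicator B x" for x
      using c(2)[of x] unfolding h_eq[symmetric] by (auto simp: W_def h_def split: split_indicator)
    show "1 \<le> ?f x" for x using f_ge[of x] by (simp add: ennreal_ge_1)
    show "W \<in> borel_measurable borel" unfolding W_def[abs_def] by measurable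
  qed (use B B_ne \<mu> N minor c aperiodic in auto)
  have pow_fin: "(kop P ^^ n) ?f x < \<infinity>" for n x
  proof -
    have "(kop P ^^ n) ?f x \<le> (\<Sum>r<Suc n. (kop P ^^ r) ?f x)"
      by (rule member_le_sum) auto
    also have "\<dots> \<le> W x + c * (\<Sum>r<Suc n. (kop P ^^ r) (indicator B) x)"
      by (rule order_trans[OF _ drift_iterate]) (simp add: add_increasing)
    also have "\<dots> \<le> W x + c * (\<Sum>r<Suc n. 1)"
      by (intro add_left_mono mult_left_mono sum_mono pow_indicator_le_1) simp
    also have "\<dots> < \<infinity>"
      using W_fin[of x] c(1) by (simp add: ennreal_mult_less_top of_nat_less_top)
    finally show ?thesis .
  qed
  show ?thesis
    by (rule ergodic) (rule that, assumption+, rule pow_fin)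
qed

end

theorem mainTheorem1:
  fixes F :: "enat \<Rightarrow> 'w measure"
    and P :: "'a::polish_space \<Rightarrow> 'a measure"
    and Pr :: "'a \<Rightarrow> 'w measure"
    and X :: "nat \<Rightarrow> 'w \<Rightarrow> 'a"
    and \<phi> :: "'a measure"
    and T :: "nat \<Rightarrow> 'w \<Rightarrow> enat"
    and V \<delta> f :: "'a \<Rightarrow> real"
    and C :: "'a set"
    and b :: real
  assumes "locally_compact_space (euclidean :: 'a topology)"
    and "markov_chain F P Pr X"
    and "sigma_finite_measure \<phi>" and "sets \<phi> = sets borel" and "emeasure \<phi> UNIV > 0"
    and "irreducible_chain Pr X \<phi>"
    and "aperiodic_chain P \<phi>"
    and "\<And>z. stopping_time F (T z)"
    and "\<And>\<omega>. \<omega> \<in> space (F \<infinity>) \<Longrightarrow> T 0 \<omega> = 0"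
    and "\<And>x z. AE \<omega> in Pr x. T z \<omega> < T (Suc z) \<omega>"
    and "V \<in> borel_measurable borel" and "\<And>x. V x > 0"
    and "\<delta> \<in> borel_measurable borel" and "\<And>x. \<delta> x \<ge> 1"
    and "f \<in> borel_measurable borel" and "\<And>x. f x \<ge> 1"
    and "small_set P C"
    and "\<And>x z. AE \<omega> in Pr x.
      enn2ereal (nn_cond_exp (Pr x) (filtration.pre_sigma (space (F \<infinity>)) F (T z))
          (\<lambda>\<omega>'. ennreal (V (at_time X (T (Suc z)) \<omega>'))) \<omega>)
        \<le> ereal (V (at_time X (T z) \<omega>) - \<delta> (at_time X (T z) \<omega>)
            + b * indicator C (at_time X (T z) \<omega>))"
    and "\<And>x z. AE \<omega> in Pr x.
      nn_cond_exp (Pr x) (filtration.pre_sigma (space (F \<infinity>)) F (T z))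
          (\<lambda>\<omega>'. \<Sum>k\<in>{the_enat (T z \<omega>')..<the_enat (T (Suc z) \<omega>')}. ennreal (f (X k \<omega>'))) \<omega>
        \<le> ennreal (\<delta> (at_time X (T z) \<omega>))"
  shows "positive_harris_recurrent P Pr X \<phi> \<and>
    (\<exists>\<pi>. invariant_prob P \<pi> \<and> (\<forall>\<pi>'. invariant_prob P \<pi>' \<longrightarrow> \<pi>' = \<pi>) \<and>
      (\<integral>\<^sup>+ x. ennreal (f x) \<partial>\<pi>) < \<infinity> \<and>
      (\<forall>g :: 'a \<Rightarrow> real. g \<in> borel_measurable borel \<longrightarrow>
        bdd_above (range (\<lambda>x. \<bar>g x\<bar> / f x)) \<longrightarrow>
        integrable \<pi> g \<and>
        (\<forall>x. (\<forall>t. integrable (Pr x) (\<lambda>\<omega>. g (X t \<omega>))) \<and>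
          (\<lambda>t. \<integral>\<omega>. g (X t \<omega>) \<partial>Pr x) \<longlonglongrightarrow> (\<integral>y. g y \<partial>\<pi>) \<and>
          (AE \<omega> in Pr x. (\<lambda>N. (\<Sum>t<N. g (X t \<omega>)) / real N) \<longlonglongrightarrow> (\<integral>y. g y \<partial>\<pi>)))))"
proof -
  interpret markov_chain F P Pr X by fact
  interpret random_time_drift F P Pr X T V \<delta> f C b
    using assms by unfold_locales (auto simp: small_set_def)
  let ?f = "\<lambda>y. ennreal (f y)"
  obtain \<pi> where prob: "prob_space \<pi>" and sets: "sets \<pi> = sets borel"
    and inv: "\<And>u. u \<in> borel_measurable borel \<Longrightarrow> (\<integral>\<^sup>+ x. kop P u x \<partial>\<pi>) = (\<integral>\<^sup>+ x. u x \<partial>\<pi>)"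
    and \<pi>f: "(\<integral>\<^sup>+ x. ?f x \<partial>\<pi>) < \<infinity>"
    and conv: "\<And>g x. g \<in> borel_measurable borel \<Longrightarrow> \<forall>x. g x \<le> ?f x \<Longrightarrow>
      (\<lambda>n. (kop P ^^ n) g x) \<longlonglongrightarrow> (\<integral>\<^sup>+ x. g x \<partial>\<pi>)"
    and f_fin: "\<And>n x. (kop P ^^ n) ?f x < \<infinity>"
    by (rule ergodic_measure[OF \<open>small_set P C\<close> \<open>sets \<phi> = sets borel\<close> \<open>emeasure \<phi> UNIV > 0\<close> \<open>aperiodic_chain P \<phi>\<close>])
      (rule that, assumption+)
  have f_lim: "(\<lambda>n. (kop P ^^ n) g x) \<longlonglongrightarrow> (\<integral>\<^sup>+ x. g x \<partial>\<pi>)"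
    if "g \<in> borel_measurable borel" "\<And>x. g x \<le> ?f x" for g x
    using conv that by blast
  have f1: "1 \<le> ?f x" for x using f_ge[of x] by (simp add: ennreal_ge_1)
  interpret ergodic_path_law P law \<pi>
  proof (intro ergodic_path_law.intro path_law_axioms ergodic_path_law_axioms.intro prob sets)
    show "(\<integral>\<^sup>+ x. kop P u x \<partial>\<pi>) = (\<integral>\<^sup>+ x. u x \<partial>\<pi>)" if "u \<in> borel_measurable borel" for u
      using that by (rule inv)
    show "(\<lambda>n. (kop P ^^ n) g x) \<longlonglongrightarrow> (\<integral>\<^sup>+ x. g x \<partial>\<pi>)"
      if "g \<in> borel_measurable borel" "\<And>x. g x \<le> 1" for g x
      by (rule f_lim[OF that(1)]) (rule order_trans[OF that(2) f1])
  qed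
  have invariant: "invariant_prob P \<pi>"
    unfolding invariant_prob_def using prob sets inv[OF borel_measurable_indicator]
    by (auto simp: kop_def sets_k)
  have unique: "\<pi>' = \<pi>" if "invariant_prob P \<pi>'" for \<pi>'
  proof (rule measure_eqI)
    have \<pi>': "prob_space \<pi>'" "sets \<pi>' = sets borel"
      "\<And>A. A \<in> sets borel \<Longrightarrow> (\<integral>\<^sup>+ x. emeasure (P x) A \<partial>\<pi>') = emeasure \<pi>' A"
      using that by (auto simp: invariant_prob_def)
    interpret \<pi>': prob_space \<pi>' by fact
    show "sets \<pi>' = sets \<pi>" using \<pi>' sets by simp
    fix A assume "A \<in> sets \<pi>'"
    then have A [measurable]: "A \<in> sets borel" using \<pi>' by simp
    \<comment> \<open>Convergence from every state is integrated against \<open>\<pi>'\<close>; by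
      invariance of \<open>\<pi>'\<close> the sequence is constant.\<close>
    have "(\<lambda>n. \<integral>\<^sup>+ y. (kop P ^^ n) (indicator A) y \<partial>\<pi>') \<longlonglongrightarrow> (\<integral>\<^sup>+ y. (\<integral>\<^sup>+ z. indicator A z \<partial>\<pi>) \<partial>\<pi>')"
    proof (rule nn_integral_dominated_convergence[where w = "\<lambda>_. 1"])
      show "AE y in \<pi>'. (kop P ^^ n) (indicator A) y \<le> 1" for n
        by (intro AE_I2 pow_indicator_le_1)
      show "AE y in \<pi>'. (\<lambda>n. (kop P ^^ n) (indicator A) y) \<longlonglongrightarrow> (\<integral>\<^sup>+ z. indicator A z \<partial>\<pi>)"
        by (intro AE_I2 f_lim order_trans[OF indicator_le_1_ennreal f1]) measurable
    qed (auto simp: \<pi>'.emeasure_space_1 measurable_cong_sets[OF \<pi>'(2) refl])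
    moreover have "(\<integral>\<^sup>+ y. (kop P ^^ n) (indicator A) y \<partial>\<pi>') = emeasure \<pi>' A" for n
      using invariant_pow[OF invariant_nn_integral[OF \<pi>'(2) _ \<pi>'(3)], of "indicator A" n] \<pi>'(2) by simp
    ultimately show "emeasure \<pi>' A = emeasure \<pi> A"
      using \<pi>'.emeasure_space_1 sets by (simp add: LIMSEQ_const_iff)
  qed
  have harris: "harris_recurrent Pr X \<phi>"
    unfolding harris_recurrent_def
  proof (intro allI ballI impI)
    fix x B assume B [measurable]: "B \<in> sets borel" and \<phi>B: "0 < emeasure \<phi> B"
    interpret Pr: prob_space "Pr x" by (rule prob_Pr)
    \<comment> \<open>If \<open>\<pi>\<close> did not charge \<open>B\<close>, invariance would give
      a state \<open>y\<close> from which \<open>B\<close> is almost surely never visited, against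
      irreducibility.\<close>
    have "measure \<pi> B \<noteq> 0"
    proof
      assume "measure \<pi> B = 0"
      then have zero: "emeasure \<pi> B = 0" by (simp add: \<pi>.emeasure_eq_measure)
      have "AE y in \<pi>. (kop P ^^ n) (indicator B) y = 0" for n
      proof -
        have "(\<integral>\<^sup>+ y. (kop P ^^ n) (indicator B) y \<partial>\<pi>) = 0"
          using invariant_pow[OF inv, of "indicator B" n] zero sets by simp
        then show ?thesis by (subst (asm) nn_integral_0_iff_AE) auto
      qed
      then have "AE y in \<pi>. \<forall>n. (kop P ^^ n) (indicator B) y = 0" by (simp add: AE_all_countable)
      then obtain y where y: "\<And>n. (kop P ^^ n) (indicator B) y = 0"
        using eventually_happens'[OF \<pi>.ae_filter_bot] by blast
      interpret Py: prob_space "Pr y" by (rule prob_Pr)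
      have "AE \<omega> in Pr y. X n \<omega> \<notin> B" for n
      proof -
        have "(\<integral>\<^sup>+ \<omega>. indicator B (X n \<omega>) \<partial>Pr y) = 0" using y by (simp add: nn_integral_X)
        then have "AE \<omega> in Pr y. indicator B (X n \<omega>) = (0::ennreal)"
          by (subst (asm) nn_integral_0_iff_AE) auto
        then show ?thesis by eventually_elim (auto split: split_indicator_asm)
      qed
      then have "AE \<omega> in Pr y. \<forall>n. X n \<omega> \<notin> B" by (simp add: AE_all_countable)
      then have "AE \<omega> in Pr y. \<not> return_time X B \<omega> < \<infinity>"
        unfolding return_time_less_infinity by eventually_elim blast
      then have "Py.prob {\<omega> \<in> space (Pr y). return_time X B \<omega> < \<infinity>} = 0"
        by (rule Py.prob_eq_0_AE)
      moreover have "Py.prob {\<omega> \<in> space (Pr y). return_time X B \<omega> < \<infinity>} > 0"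
        using \<open>irreducible_chain Pr X \<phi>\<close> B \<phi>B unfolding irreducible_chain_def by blast
      ultimately show False by simp
    qed
    then have B_pos: "0 < measure \<pi> B" by (simp add: zero_less_measure_iff)
    have "integrable \<pi> (indicator B :: 'a \<Rightarrow> real)"
      by (rule \<pi>.integrable_const_bound[of _ 1]) (auto split: split_indicator)
    from lln[OF borel_measurable_indicator[OF B] this, of x]
    have "AE \<omega> in Pr x. (\<lambda>n. (\<Sum>t<n. indicator B (X t \<omega>)) / real n) \<longlonglongrightarrow> measure \<pi> B"
      unfolding law_def using AE_distrD[OF path_measurable] sets by fastforce
    then have "AE \<omega> in Pr x. return_time X B \<omega> < \<infinity>"
    proof eventually_elim
      case (elim \<omega>)
      show ?case
      proof (rule ccontr)
        assume "\<not> ?thesis"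
        then have no: "X t \<omega> \<notin> B" if "1 \<le> t" for t using that unfolding return_time_less_infinity by blast
        \<comment> \<open>Without a return only time 0 can count, so the averages are at most
          \<open>1 / n\<close>, against the positive limit \<open>\<pi>(B)\<close>.\<close>
        have "(\<lambda>n. (\<Sum>t<n. indicator B (X t \<omega>)) / real n) \<longlonglongrightarrow> (0::real)"
        proof (rule tendsto_sandwich[OF _ _ tendsto_const lim_1_over_n])
          have "(\<Sum>t<n. indicator B (X t \<omega>)) \<le> (1::real)" for n
          proof (cases n)
            case (Suc k)
            then show ?thesis unfolding Suc
              by (subst sum.lessThan_Suc_shift) (auto simp: no split: split_indicator)
          qed simp
          then show "\<forall>\<^sub>F n in sequentially. (\<Sum>t<n. indicator B (X t \<omega>)) / real n \<le> 1 / real n"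
            by (intro always_eventually allI divide_right_mono) auto
        qed (auto intro!: always_eventually sum_nonneg divide_nonneg_nonneg)
        then show False using LIMSEQ_unique[OF elim] B_pos by auto
      qed
    qed
    moreover have "{\<omega> \<in> space (Pr x). return_time X B \<omega> < \<infinity>} \<in> sets (Pr x)"
      unfolding return_time_less_infinity by measurable
    ultimately show "measure (Pr x) {\<omega> \<in> space (Pr x). return_time X B \<omega> < \<infinity>} = 1"
      by (subst Pr.prob_Collect_eq_1) auto
  qed
  have main: "integrable \<pi> g \<and> (\<forall>x. (\<forall>t. integrable (Pr x) (\<lambda>\<omega>. g (X t \<omega>))) \<and>
      (\<lambda>t. \<integral>\<omega>. g (X t \<omega>) \<partial>Pr x) \<longlonglongrightarrow> (\<integral>y. g y \<partial>\<pi>) \<and>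
      (AE \<omega> in Pr x. (\<lambda>N. (\<Sum>t<N. g (X t \<omega>)) / real N) \<longlonglongrightarrow> (\<integral>y. g y \<partial>\<pi>)))"
    if g [measurable]: "g \<in> borel_measurable borel" and bdd: "bdd_above (range (\<lambda>x. \<bar>g x\<bar> / f x))" for g :: "'a \<Rightarrow> real"
  proof -
    obtain K0 where K0: "\<And>x. \<bar>g x\<bar> / f x \<le> K0" using bdd by (auto simp: bdd_above_def)
    \<comment> \<open>\<open>scaled_limit\<close> divides by the constant, and \<open>K0\<close> may
      be 0.\<close>
    define K where "K = max K0 1"
    have K: "0 < K" "\<bar>g x\<bar> \<le> K * f x" for x
    proof -
      have "0 < f x" using f_ge[of x] by simp
      then have "\<bar>g x\<bar> \<le> K0 * f x" using K0[of x] by (simp add: divide_le_eq)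
      also have "\<dots> \<le> K * f x" using \<open>0 < f x\<close> by (simp add: K_def)
      finally show "\<bar>g x\<bar> \<le> K * f x" .
    qed (simp add: K_def)
    have part: "integrable \<pi> p \<and> (\<forall>t. integrable (Pr x) (\<lambda>\<omega>. p (X t \<omega>))) \<and> (\<lambda>t. \<integral>\<omega>. p (X t \<omega>) \<partial>Pr x) \<longlonglongrightarrow> (\<integral>y. p y \<partial>\<pi>)"
      if p [measurable]: "p \<in> borel_measurable borel" and p0: "\<And>y. 0 \<le> p y" and pK: "\<And>y. p y \<le> K * f y" for p and x
    proof -
      have le: "ennreal (p y) \<le> ennreal K * ?f y" for y
        using ennreal_leI[OF pK[of y]] K(1) f_ge[of y] by (simp add: ennreal_mult)
      have "(\<integral>\<^sup>+ y. ennreal (p y) \<partial>\<pi>) \<le> ennreal K * (\<integral>\<^sup>+ y. ?f y \<partial>\<pi>)"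
        using nn_integral_mono[of \<pi> "\<lambda>y. ennreal (p y)", OF le] by (simp add: nn_integral_cmult)
      also have "\<dots> < \<infinity>" using \<pi>f by (simp add: ennreal_mult_less_top)
      finally have i1: "integrable \<pi> p" using p0 by (intro integrableI_nonneg) auto
      have "(kop P ^^ t) (\<lambda>y. ennreal (p y)) x \<le> ennreal K * (kop P ^^ t) ?f x" for t
        using pow_mono[of "\<lambda>y. ennreal (p y)", OF le] by (simp add: pow_cmult)
      from le_less_trans[OF this] have "(kop P ^^ t) (\<lambda>y. ennreal (p y)) x < \<infinity>" for t
        using f_fin[of t x] by (simp add: ennreal_mult_less_top)
      then have i2: "integrable (Pr x) (\<lambda>\<omega>. p (X t \<omega>))" for t
        using p0 nn_integral_X[where u = "\<lambda>y. ennreal (p y)" and n = t and x = x] by (intro integrableI_nonneg) auto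
      have "(\<lambda>t. enn2real ((kop P ^^ t) (\<lambda>y. ennreal (p y)) x)) \<longlonglongrightarrow> (\<integral>y. p y \<partial>\<pi>)"
        by (rule scaled_limit[OF f_lim sets p i1 p0 K(1) pK])
      moreover have "enn2real ((kop P ^^ t) (\<lambda>y. ennreal (p y)) x) = (\<integral>\<omega>. p (X t \<omega>) \<partial>Pr x)" for t
        using p0 nn_integral_X[where u = "\<lambda>y. ennreal (p y)" and n = t and x = x] by (subst integral_eq_nn_integral) auto
      ultimately show ?thesis using i1 i2 by simp
    qed
    \<comment> \<open>The convergence of expectations is available for nonnegative functions; both
      parts of \<open>g\<close> are dominated by \<open>K * f\<close>.\<close>
    have g_eq: "g = (\<lambda>y. max 0 (g y) - max 0 (- g y))" by (auto simp: fun_eq_iff)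
    have p1: "integrable \<pi> (\<lambda>y. max 0 (g y))" "integrable (Pr x) (\<lambda>\<omega>. max 0 (g (X t \<omega>)))"
        "(\<lambda>t. \<integral>\<omega>. max 0 (g (X t \<omega>)) \<partial>Pr x) \<longlonglongrightarrow> (\<integral>y. max 0 (g y) \<partial>\<pi>)"
      and p2: "integrable \<pi> (\<lambda>y. max 0 (- g y))" "integrable (Pr x) (\<lambda>\<omega>. max 0 (- g (X t \<omega>)))"
        "(\<lambda>t. \<integral>\<omega>. max 0 (- g (X t \<omega>)) \<partial>Pr x) \<longlonglongrightarrow> (\<integral>y. max 0 (- g y) \<partial>\<pi>)" for x t
    proof -
      have "max 0 (g y) \<le> K * f y" "max 0 (- g y) \<le> K * f y" for y
        using K(2)[of y] by (auto simp: abs_le_iff)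
      then show "integrable \<pi> (\<lambda>y. max 0 (g y))" "integrable (Pr x) (\<lambda>\<omega>. max 0 (g (X t \<omega>)))"
        "(\<lambda>t. \<integral>\<omega>. max 0 (g (X t \<omega>)) \<partial>Pr x) \<longlonglongrightarrow> (\<integral>y. max 0 (g y) \<partial>\<pi>)"
        "integrable \<pi> (\<lambda>y. max 0 (- g y))" "integrable (Pr x) (\<lambda>\<omega>. max 0 (- g (X t \<omega>)))"
        "(\<lambda>t. \<integral>\<omega>. max 0 (- g (X t \<omega>)) \<partial>Pr x) \<longlonglongrightarrow> (\<integral>y. max 0 (- g y) \<partial>\<pi>)"
        using part[of "\<lambda>y. max 0 (g y)" x] part[of "\<lambda>y. max 0 (- g y)" x] by auto
    qed
    have int\<pi>: "integrable \<pi> g"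
      by (subst g_eq) (intro Bochner_Integration.integrable_diff p1 p2)
    have intPr: "integrable (Pr x) (\<lambda>\<omega>. g (X t \<omega>))" for x t
      by (subst g_eq) (intro Bochner_Integration.integrable_diff p1 p2)
    have "(\<lambda>t. \<integral>\<omega>. g (X t \<omega>) \<partial>Pr x) \<longlonglongrightarrow> (\<integral>y. g y \<partial>\<pi>)" for x
      using tendsto_diff[OF p1(3)[of x] p2(3)[of x]]
      by (subst (1 2) g_eq) (simp add: p1 p2)
    moreover have "AE \<omega> in Pr x. (\<lambda>N. (\<Sum>t<N. g (X t \<omega>)) / real N) \<longlonglongrightarrow> (\<integral>y. g y \<partial>\<pi>)" for x
      using AE_distrD[OF path_measurable lln[OF g int\<pi>, of x, unfolded law_def]] by simp
    ultimately show ?thesis using int\<pi> intPr by blast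
  qed
  show ?thesis
    unfolding positive_harris_recurrent_def
    using harris invariant unique \<pi>f main by blast
qed

end
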